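(* Let $\Delta_*>0$ and $\eta\in(0,1)$ be fixed. In each of the regimes below there exists $\varepsilon_*>0$ such that, for all $\varepsilon\in(0,\varepsilon_*]$, the following asymptotic bounds hold for Prony's amplitude estimates $\hat y_n^{Pr}$. Regime 1: uniformly in $\Delta\in[\Delta_*,\infty)$, $$|\hat y_n^{Pr}-y_n|\le\varepsilon\mathcal{D}_y^{(1)}e^{-\Delta\Gamma_y^{Pr}(\eta)N_1^3},\quad (n,N_1)\in\mathcal{N}_\eta,\ N_1\text{ sufficiently large},$$ for some $\Gamma_y^{Pr}(\eta),\mathcal{D}_y^{(1)}>0$. Regime 2: let $\vartheta>0$. There exists $N_1(\vartheta)\in\mathbb{N}$ such that, uniformly in $N_1\ge N_1(\vartheta)$, $$|\hat y_n^{Pr}-y_n|\le\varepsilon\mathcal{D}_y^{(2)}e^{-\vartheta\Delta},\quad (n,N_1)\in\mathcal{N}_\eta,\ \Delta\text{ sufficiently large},$$ for some constant $\mathcal{D}_y^{(2)}>0$. Regime 3: given $T>0$ and $\Delta N_1=T$, $$|\hat y_n^{Pr}-y_n|\le\varepsilon\mathcal{D}_y^{(3)}e^{-\Gamma_y^{Pr,1}(T,\eta)N_1^2},\quad (n,N_1)\in\mathcal{N}_\eta,\ N_1\text{ sufficiently large},$$ for some $\Gamma_y^{Pr,1}(T,\eta),\mathcal{D}_y^{(3)}>0$.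
   Context: Let $\mathcal{A}$ be a fixed Sturm-Liouville operator $[\mathcal{A}h](x)=-(p(x)h'(x))'-q(x)h(x)$, $x\in(0,1)$, with domain $\{h\in \mathrm{H}^2(0,1): h(0)=h(1)=0\}$, where $p,q$ are smooth real functions on $[0,1]$ (restrictions of smooth functions defined on a neighborhood of $[0,1]$) and $\min_{[0,1]}p>0$. Let $\{\lambda_n\}_{n=1}^\infty$ be the monotonically increasing, unbounded real sequence of its simple eigenvalues. For $\Delta>0$ put $\phi_n:=e^{-\lambda_n\Delta}$. Notation: $[N]=\{1,\dots,N\}$ and, for $\eta\in(0,1]$, $\mathcal{N}_\eta=\{(n,N_1)\in\mathbb{N}^2:1\le n\le\lfloor\eta N_1\rfloor\}$. The real amplitudes $y_1,\dots,y_{N_1+1}$ satisfy, with constants $\ell>1$ and $M_y>0$ not depending on $N_1,\Delta$: $\ell^{-1}\le|y_n|\le\ell$ for $n\in[N_1]$ and $|y_{N_1+1}|/|y_k|\le M_y$ for $k\in[N_1]$. Measurements with noise intensity $\varepsilon$: $\tilde m_k=\sum_{n=1}^{N_1}y_n\phi_n^k+\varepsilon y_{N_1+1}\phi_{N_1+1}^k$, $k=0,\dots,2N_1-1$. The perturbed Prony polynomial is $$\bar q(z)=\det\begin{bmatrix}1&z&\cdots&z^{N_1}\\ \tilde m_0&\tilde m_1&\cdots&\tilde m_{N_1}\\ \vdots&\vdots&&\vdots\\ \tilde m_{N_1-1}&\tilde m_{N_1}&\cdots&\tilde m_{2N_1-1}\end{bmatrix}.$$ Let $\tau\in(0,\frac12)$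 be a constant depending only on $\Delta_*$ with $|\phi_j-\phi_n|/\phi_n\ge2\tau$ for all $n\in\mathbb{N}$, $j\in\mathbb{N}\setminus\{n\}$, $\Delta\ge\Delta_*$. For sufficiently small $\varepsilon$ (threshold uniform within each regime), $\bar q$ has for each $n\in[N_1]$ a real root $\hat\phi_n^{Pr}$ with $|\hat\phi_n^{Pr}-\phi_n|\le\tau\phi_n$. Prony's amplitude estimates $\hat y_1^{Pr},\dots,\hat y_{N_1}^{Pr}$ are the solution of the Vandermonde system $\sum_{n=1}^{N_1}\hat y_n^{Pr}(\hat\phi_n^{Pr})^k=\tilde m_k$, $k=0,\dots,N_1-1$. Regimes: Regime 1: $\Delta\ge\Delta_*$ fixed and $N_1\to\infty$. Regime 2: $N_1$ large and fixed, $\Delta\ge\Delta_*$, $\Delta\to\infty$. Regime 3: $\Delta=T/N_1$ with $T>0$ fixed, $N_1\to\infty$. *)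

theory Defs
  imports "Jordan_Normal_Form.Determinant" "HOL-Analysis.Analysis"
begin

definition smooth_near_unit_interval :: "(real \<Rightarrow> real) \<Rightarrow> bool" where
  "smooth_near_unit_interval f \<longleftrightarrow>
     (\<exists>U. open U \<and> {0..1} \<subseteq> U \<and>
       (\<forall>k. \<forall>x\<in>U. (deriv ^^ k) f field_differentiable (at x)))"

(* The Sobolev space H^2(0,1), via the C^1 representative: h is C^1 on [0,1] and h' is absolutely
   continuous with derivative v in L^2(0,1).  Both are expressed by the fundamental theorem of
   calculus.  Values of h outside [0,1] are irrelevant. *)
definition sobolev_H2 :: "(real \<Rightarrow> real) set" where
  "sobolev_H2 = {h. \<exists>u v.
     v \<in> borel_measurable (lebesgue_on {0..1}) \<and>
     integrable (lebesgue_on {0..1}) (\<lambda>x. (v x)\<^sup>2) \<and>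
     (\<forall>x\<in>{0..1}. u x = u 0 + integral {0..x} v) \<and>
     (\<forall>x\<in>{0..1}. h x = h 0 + integral {0..x} u)}"

definition sl_domain :: "(real \<Rightarrow> real) set" where
  "sl_domain = {h \<in> sobolev_H2. h 0 = 0 \<and> h 1 = 0}"

(* For h in H^2(0,1) the inner derivative exists on all of (0,1), the outer one almost everywhere. *)
definition sl_operator ::
    "(real \<Rightarrow> real) \<Rightarrow> (real \<Rightarrow> real) \<Rightarrow> (real \<Rightarrow> real) \<Rightarrow> real \<Rightarrow> real" where
  "sl_operator p q h x = - deriv (\<lambda>t. p t * deriv h t) x - q x * h x"

definition sl_eigenfunction ::
    "(real \<Rightarrow> real) \<Rightarrow> (real \<Rightarrow> real) \<Rightarrow> real \<Rightarrow> (real \<Rightarrow> real) \<Rightarrow> bool" where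
  "sl_eigenfunction p q \<mu> h \<longleftrightarrow>
     h \<in> sl_domain \<and> (\<exists>x\<in>{0..1}. h x \<noteq> 0) \<and>
     (AE x in lebesgue_on {0<..<1}. sl_operator p q h x = \<mu> * h x)"

definition sl_eigenvalue :: "(real \<Rightarrow> real) \<Rightarrow> (real \<Rightarrow> real) \<Rightarrow> real \<Rightarrow> bool" where
  "sl_eigenvalue p q \<mu> \<longleftrightarrow> (\<exists>h. sl_eigenfunction p q \<mu> h)"

definition sl_simple_eigenvalue :: "(real \<Rightarrow> real) \<Rightarrow> (real \<Rightarrow> real) \<Rightarrow> real \<Rightarrow> bool" where
  "sl_simple_eigenvalue p q \<mu> \<longleftrightarrow> sl_eigenvalue p q \<mu> \<and>
     (\<forall>f g. sl_eigenfunction p q \<mu> f \<longrightarrow> sl_eigenfunction p q \<mu> g \<longrightarrow>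
        (\<exists>c. \<forall>x\<in>{0..1}. g x = c * f x))"

(* lam 1, lam 2, ... is the increasing enumeration of all eigenvalues; lam 0 is unused.
   Simplicity and unboundedness are automatic for these operators. *)
definition sl_eigenvalue_sequence ::
    "(real \<Rightarrow> real) \<Rightarrow> (real \<Rightarrow> real) \<Rightarrow> (nat \<Rightarrow> real) \<Rightarrow> bool" where
  "sl_eigenvalue_sequence p q lam \<longleftrightarrow>
     strict_mono_on {1..} lam \<and>
     filterlim lam at_top sequentially \<and>
     lam ` {1..} = {\<mu>. sl_eigenvalue p q \<mu>} \<and>
     (\<forall>n\<ge>1. sl_simple_eigenvalue p q (lam n))"

definition exp_node :: "(nat \<Rightarrow> real) \<Rightarrow> real \<Rightarrow> nat \<Rightarrow> real" where
  "exp_node lam \<Delta> n = exp (- lam n * \<Delta>)"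

definition index_region :: "real \<Rightarrow> (nat \<times> nat) set" where
  "index_region \<eta> = {(n, N). 1 \<le> n \<and> int n \<le> \<lfloor>\<eta> * real N\<rfloor>}"

definition admissible_amplitudes :: "real \<Rightarrow> real \<Rightarrow> nat \<Rightarrow> (nat \<Rightarrow> real) \<Rightarrow> bool" where
  "admissible_amplitudes ell My N y \<longleftrightarrow>
     (\<forall>n\<in>{1..N}. 1 / ell \<le> \<bar>y n\<bar> \<and> \<bar>y n\<bar> \<le> ell) \<and>
     (\<forall>k\<in>{1..N}. \<bar>y (N + 1)\<bar> / \<bar>y k\<bar> \<le> My)"

definition noisy_measurement ::
    "(nat \<Rightarrow> real) \<Rightarrow> real \<Rightarrow> nat \<Rightarrow> real \<Rightarrow> (nat \<Rightarrow> real) \<Rightarrow> nat \<Rightarrow> real" where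
  "noisy_measurement lam \<Delta> N \<epsilon> y k =
     (\<Sum>n=1..N. y n * exp_node lam \<Delta> n ^ k) + \<epsilon> * y (N + 1) * exp_node lam \<Delta> (N + 1) ^ k"

definition prony_poly :: "nat \<Rightarrow> (nat \<Rightarrow> real) \<Rightarrow> real \<Rightarrow> real" where
  "prony_poly N m z = Determinant.det (Matrix.mat (N + 1) (N + 1)
     (\<lambda>(i, j). if i = 0 then z ^ j else m (i - 1 + j)))"

(* The estimates phih n, yh n for n in {1..N}.  The last clause on phih fixes the labelling of the
   roots: it is implied by the localisation when the nodes are separated relative to tau, but not
   when the sampling step tends to 0, where several roots may lie within tau * phi_n of phi_n. *)
definition prony_estimates ::
    "(nat \<Rightarrow> real) \<Rightarrow> real \<Rightarrow> real \<Rightarrow> nat \<Rightarrow> real \<Rightarrow> (nat \<Rightarrow> real) \<Rightarrow>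
     (nat \<Rightarrow> real) \<Rightarrow> (nat \<Rightarrow> real) \<Rightarrow> bool" where
  "prony_estimates lam \<tau> \<Delta> N \<epsilon> y phih yh \<longleftrightarrow>
     (let m = noisy_measurement lam \<Delta> N \<epsilon> y in
       (\<forall>n\<in>{1..N}. prony_poly N m (phih n) = 0 \<and>
          \<bar>phih n - exp_node lam \<Delta> n\<bar> \<le> \<tau> * exp_node lam \<Delta> n) \<and>
       (\<forall>i\<in>{1..N}. \<forall>j\<in>{1..N}. i < j \<longrightarrow> phih j < phih i) \<and>
       (\<forall>k<N. (\<Sum>n=1..N. yh n * phih n ^ k) = m k))"

(* For all admissible amplitudes, Prony's estimates exist and their amplitude errors are at most B
   on the index region. *)
definition prony_amplitude_bound ::
    "(nat \<Rightarrow> real) \<Rightarrow> real \<Rightarrow> real \<Rightarrow> real \<Rightarrow> real \<Rightarrow> real \<Rightarrow> nat \<Rightarrow> real \<Rightarrow> real \<Rightarrow> bool" where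
  "prony_amplitude_bound lam \<tau> ell My \<eta> \<Delta> N \<epsilon> B \<longleftrightarrow>
     (\<forall>y. admissible_amplitudes ell My N y \<longrightarrow>
       (\<exists>phih yh. prony_estimates lam \<tau> \<Delta> N \<epsilon> y phih yh) \<and>
       (\<forall>phih yh. prony_estimates lam \<tau> \<Delta> N \<epsilon> y phih yh \<longrightarrow>
          (\<forall>n. (n, N) \<in> index_region \<eta> \<longrightarrow> \<bar>yh n - y n\<bar> \<le> B)))"

end

theory Submission
  imports Defs "HOL-Real_Asymp.Real_Asymp"
begin

text \<open>The noise is one more exponential, so the data are the moments of a discrete signed measure with
nodes \<open>\<phi>\<^sub>1, \<dots>, \<phi>\<^sub>N\<^sub>+\<^sub>1\<close> and masses \<open>c\<^sub>n = y\<^sub>n\<close> for \<open>n \<le> N\<close>, \<open>c\<^sub>N\<^sub>+\<^sub>1 = \<epsilon> y\<^sub>N\<^sub>+\<^sub>1\<close>.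

Algebra.  A zero \<open>z\<close> of the Prony determinant is a zero of a polynomial of degree at most \<open>N\<close> that is
orthogonal, for this measure, to all polynomials of degree below \<open>N\<close>: such a polynomial is a null
vector of the matrix.  Up to a factor there is only one, and it is explicit,
\<open>\<Prod>\<^sub>s\<^sub>\<le>\<^sub>N (z - \<phi>\<^sub>s) + \<Sum>\<^sub>k\<^sub>\<le>\<^sub>N (c\<^sub>N\<^sub>+\<^sub>1 / c\<^sub>k) L\<^sub>k(\<phi>\<^sub>N\<^sub>+\<^sub>1)\<^sup>2 \<Prod>\<^sub>s\<^sub>\<noteq>\<^sub>k\<^sub>,\<^sub>s\<^sub>\<le>\<^sub>N\<^sub>+\<^sub>1 (z - \<phi>\<^sub>s)\<close>,
with \<open>L\<^sub>k\<close> the Lagrange basis on \<open>\<phi>\<^sub>1, \<dots>, \<phi>\<^sub>N\<close> (lemma \<open>prony_poly_root_iff\<close>).  Near \<open>\<phi>\<^sub>n\<close>, after division by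
the factors \<open>z - \<phi>\<^sub>s\<close> with \<open>s \<noteq> n\<close>, it is a small perturbation of \<open>z - \<phi>\<^sub>n\<close>; so it has a zero there, whose
distance from \<open>\<phi>\<^sub>n\<close> is at most a multiple of \<open>\<epsilon> L\<^sub>n(\<phi>\<^sub>N\<^sub>+\<^sub>1)\<^sup>2 \<phi>\<^sub>n\<close> (\<open>root_near_node\<close>, \<open>root_displacement\<close>).

Amplitudes.  As the estimated nodes are the zeros of the orthogonal polynomial, the Vandermonde
system makes the estimated amplitudes the weights of a Gauss quadrature rule, exact up to degree
\<open>2N - 1\<close>.  Testing it on a polynomial that vanishes at all estimated nodes but the \<open>n\<close>-th and at all
true nodes but the \<open>n\<close>-th expresses the quotient of estimated and true amplitude as a product of
\<open>2N - 1\<close> factors (\<open>amplitude_formula\<close>).  Each differs from 1 by a multiple of the displacement of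
the \<open>n\<close>-th node alone, so the error inherits the smallness of \<open>L\<^sub>n(\<phi>\<^sub>N\<^sub>+\<^sub>1)\<^sup>2\<close> even though the nodes
near \<open>\<phi>\<^sub>N\<close> are estimated less well (\<open>amplitude_error\<close>).

Decay.  The factors of \<open>L\<^sub>n(\<phi>\<^sub>N\<^sub>+\<^sub>1)\<close> with \<open>s > n\<close> are of size \<open>\<phi>\<^sub>s / \<phi>\<^sub>n\<close>.  Eigenvalues satisfy
\<open>\<lambda>\<^sub>s - \<lambda>\<^sub>k \<ge> c (s\<^sup>2 - k\<^sup>2)\<close>, and \<open>\<Sum>\<^sub>s\<^sub>>\<^sub>n (s\<^sup>2 - n\<^sup>2)\<close> is of order \<open>N\<^sup>3\<close> for \<open>n \<le> \<eta> N\<close>; this produces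
\<open>exp (- \<Delta> \<Gamma> N\<^sup>3)\<close>, and \<open>exp (- \<Gamma> N\<^sup>2)\<close> when \<open>\<Delta> = T / N\<close>.  The regime of large \<open>\<Delta>\<close> is the first one
with \<open>N\<close> so large that \<open>\<Gamma> N\<^sup>3 \<ge> \<theta>\<close>.

Spectrum.  The eigenvalue bound follows from a uniform gap between the square roots of large
eigenvalues, and that gap from orthogonality: two eigenfunctions with the same initial slope
and nearly equal frequencies stay close on the whole interval, by Gronwall's inequality, and could
therefore not be orthogonal (\<open>sqrt_eigenvalue_gap\<close>).\<close>

section \<open>Eigenfunctions as classical solutions\<close>

lemma indefinite_integral_right_quotient:
  fixes f :: "real \<Rightarrow> real"
  assumes "\<And>a b. f integrable_on cbox a b"
  obtains N where "negligible N"
    "\<And>x. x \<notin> N \<Longrightarrow> ((\<lambda>h. integral {x..x+h} f / h) \<longlongrightarrow> f x) (at_right 0)"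
proof -
  obtain N where N: "negligible N"
    "\<And>x e. \<lbrakk>x \<notin> N; 0 < e\<rbrakk> \<Longrightarrow> \<exists>d>0. \<forall>h. 0 < h \<and> h < d \<longrightarrow>
        norm (integral (cbox x (x + h *\<^sub>R One)) f /\<^sub>R h ^ DIM(real) - f x) < e"
    using integrable_ccontinuous_explicit[OF assms] by blast
  have "((\<lambda>h. integral {x..x+h} f / h) \<longlongrightarrow> f x) (at_right 0)" if xN: "x \<notin> N" for x
  proof (rule tendstoI)
    fix e :: real assume "e > 0"
    then obtain d where "d > 0" "\<And>h. 0 < h \<and> h < d \<Longrightarrow>
        norm (integral (cbox x (x + h *\<^sub>R One)) f /\<^sub>R h ^ DIM(real) - f x) < e"
      using N(2)[OF xN] by blast
    then show "\<forall>\<^sub>F h in at_right 0. dist (integral {x..x+h} f / h) (f x) < e"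
      unfolding eventually_at_right_field
      by (intro exI[of _ d]) (auto simp: dist_real_def divide_inverse_commute)
  qed
  with N(1) that show thesis by blast
qed

text \<open>Lebesgue differentiation on the line.  The right-hand quotient of the integral converges almost
everywhere; the left-hand one is the right-hand one of the reflected function.\<close>
lemma indefinite_integral_has_derivative_ae:
  fixes v :: "real \<Rightarrow> real"
  assumes v: "v integrable_on {a..b}"
  obtains N where "negligible N"
    "\<And>x. x \<in> {a<..<b} - N \<Longrightarrow> ((\<lambda>t. integral {a..t} v) has_real_derivative v x) (at x)"
proof -
  define f where "f x = (if x \<in> {a..b} then v x else 0)" for x
  have fU: "f integrable_on UNIV"
    unfolding f_def using v integrable_restrict_UNIV by blast
  have f_int: "f integrable_on cbox c d" for c d
    using integrable_on_subcbox[OF fU] by simp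
  have f_int': "(\<lambda>x. f (- x)) integrable_on cbox c d" for c d
  proof -
    have "f integrable_on {-d..-c}" using f_int[of "-d" "-c"] by simp
    then show ?thesis using Henstock_Kurzweil_Integration.integrable_reflect_real[of f "-c" "-d"] by simp
  qed
  obtain N1 where N1: "negligible N1"
    "\<And>x. x \<notin> N1 \<Longrightarrow> ((\<lambda>h. integral {x..x+h} f / h) \<longlongrightarrow> f x) (at_right 0)"
    using indefinite_integral_right_quotient[OF f_int] by blast
  obtain N2 where N2: "negligible N2"
    "\<And>x. x \<notin> N2 \<Longrightarrow> ((\<lambda>h. integral {x..x+h} (\<lambda>x. f (-x)) / h) \<longlongrightarrow> f (-x)) (at_right 0)"
    using indefinite_integral_right_quotient[OF f_int'] by blast
  have neg: "negligible (N1 \<union> uminus ` N2)"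
  proof (intro negligible_Un N1(1))
    show "negligible (uminus ` N2)"
      by (rule negligible_differentiable_image_negligible[OF _ N2(1)])
         (auto intro!: derivative_intros simp: differentiable_on_def)
  qed
  have "((\<lambda>t. integral {a..t} v) has_real_derivative v x) (at x)"
    if x: "x \<in> {a<..<b} - (N1 \<union> uminus ` N2)" for x
  proof -
    have xN: "x \<notin> N1" "-x \<notin> N2" using x by (auto simp: image_iff)
    let ?F = "\<lambda>t. integral {a..t} v"
    have int: "v integrable_on {a..t}" if "t \<le> b" for t
      using v integrable_subinterval_real that by fastforce
    have diff: "integral {s..t} f = ?F t - ?F s" if "a \<le> s" "s \<le> t" "t \<le> b" for s t
    proof -
      have "integral {s..t} f = integral {s..t} v"
        by (rule integral_cong) (use that in \<open>auto simp: f_def\<close>)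
      also have "\<dots> = ?F t - ?F s"
        using Henstock_Kurzweil_Integration.integral_combine[of a s t v] int[of t] that by simp
      finally show ?thesis .
    qed
    have refl: "integral {-x..h-x} (\<lambda>x. f (-x)) = integral {x-h..x} f" for h
      using Henstock_Kurzweil_Integration.integral_reflect_real[of x "x - h" f] by simp
    have fx: "f x = v x" using x by (simp add: f_def)
    have R: "((\<lambda>h. (?F (x + h) - ?F x) / h) \<longlongrightarrow> v x) (at_right 0)"
    proof (rule Lim_transform_eventually)
      show "((\<lambda>h. integral {x..x+h} f / h) \<longlongrightarrow> v x) (at_right 0)"
        using N1(2)[OF xN(1)] fx by simp
      show "\<forall>\<^sub>F h in at_right 0. integral {x..x+h} f / h = (?F (x + h) - ?F x) / h"
        unfolding eventually_at_right_field
        by (rule exI[of _ "b - x"]) (use x in \<open>auto simp: diff\<close>)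
    qed
    have L: "((\<lambda>h. (?F (x + h) - ?F x) / h) \<longlongrightarrow> v x) (at_left 0)"
      unfolding at_left_minus[of "0::real"] filterlim_filtermap minus_zero
    proof (rule Lim_transform_eventually)
      show "((\<lambda>h. integral {-x..-x+h} (\<lambda>x. f (-x)) / h) \<longlongrightarrow> v x) (at_right 0)"
        using N2(2)[OF xN(2)] fx by simp
      show "\<forall>\<^sub>F h in at_right 0. integral {-x..-x+h} (\<lambda>x. f (-x)) / h
          = (?F (x + -h) - ?F x) / -h"
        unfolding eventually_at_right_field
        by (rule exI[of _ "x - a"]) (use x in \<open>auto simp: refl diff field_simps\<close>)
    qed
    show ?thesis
      unfolding DERIV_def filterlim_at_split using L R by simp
  qed
  with neg that show thesis by blast
qed

text \<open>The equation \<open>- (p h')' - q h = \<mu> h\<close> as a system for \<open>h\<close> and the flux \<open>w = p h'\<close>.\<close>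
definition first_order_solution ::
    "(real \<Rightarrow> real) \<Rightarrow> (real \<Rightarrow> real) \<Rightarrow> real \<Rightarrow> (real \<Rightarrow> real) \<Rightarrow> (real \<Rightarrow> real) \<Rightarrow> bool" where
  "first_order_solution p q \<mu> h w \<longleftrightarrow>
     (\<forall>x\<in>{0..1}. (h has_real_derivative w x / p x) (at x within {0..1})) \<and>
     (\<forall>x\<in>{0..1}. (w has_real_derivative - (q x + \<mu>) * h x) (at x within {0..1}))"

lemma smooth_near_unit_intervalD:
  assumes "smooth_near_unit_interval f"
  shows "\<And>x. x \<in> {0..1} \<Longrightarrow> (f has_real_derivative deriv f x) (at x)"
    and "continuous_on {0..1} (deriv f)"
proof -
  obtain U where U: "open U" "{0..1} \<subseteq> U"
    "\<And>k x. x \<in> U \<Longrightarrow> (deriv ^^ k) f field_differentiable (at x)"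
    using assms unfolding smooth_near_unit_interval_def by blast
  show "(f has_real_derivative deriv f x) (at x)" if "x \<in> {0..1}" for x
    using U(2) U(3)[of x 0] that by (auto simp: field_differentiable_derivI)
  have "continuous_on U (deriv f)"
    using U(3)[of _ 1] U(1)
    by (intro continuous_at_imp_continuous_on)
       (auto intro: field_differentiable_imp_continuous_at)
  then show "continuous_on {0..1} (deriv f)"
    using U(2) continuous_on_subset by blast
qed

lemma square_integrable_imp_integrable_unit_interval:
  fixes v :: "real \<Rightarrow> real"
  assumes "v \<in> borel_measurable (lebesgue_on {0..1})"
    and "integrable (lebesgue_on {0..1}) (\<lambda>x. (v x)\<^sup>2)"
  shows "v integrable_on {0..1}"
proof -
  have "integrable (lebesgue_on {0..1}) (\<lambda>x. 1 + (v x)\<^sup>2)"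
    using assms(2) by (intro Bochner_Integration.integrable_add)
      (auto intro!: integrable_const_ivl)
  then have "integrable (lebesgue_on {0..1}) v"
  proof (rule Bochner_Integration.integrable_bound)
    have "\<bar>t\<bar> \<le> \<bar>1 + t\<^sup>2\<bar>" for t :: real
      using zero_le_power2[of "\<bar>t\<bar> - 1"] zero_le_power2[of t] by (simp add: power2_diff)
    then show "AE x in lebesgue_on {0..1}. norm (v x) \<le> norm (1 + (v x)\<^sup>2)" by simp
  qed (use assms in auto)
  then show ?thesis by (simp add: integrable_on_lebesgue_on)
qed

text \<open>Elliptic regularity in one dimension.  Almost everywhere the equation can be solved for the weak second
derivative \<open>v\<close>; the result \<open>g\<close> is continuous because \<open>h\<close> and the weak derivative \<open>u\<close> are.  Since \<open>u\<close> sees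
\<open>v\<close> only under an integral, \<open>v\<close> may be replaced by \<open>g\<close>, and \<open>u\<close> is then continuously differentiable.\<close>
lemma eigenfunction_first_order:
  assumes p: "smooth_near_unit_interval p" and q: "smooth_near_unit_interval q"
    and p_pos: "\<And>x. x \<in> {0..1} \<Longrightarrow> p x > 0"
    and h: "sl_eigenfunction p q \<mu> h"
  obtains w where "first_order_solution p q \<mu> h w"
proof -
  note pD = smooth_near_unit_intervalD[OF p] and qD = smooth_near_unit_intervalD[OF q]
  have p_cont: "continuous_on {0..1} p"
    using pD(1) by (meson DERIV_isCont continuous_at_imp_continuous_on)
  have q_cont: "continuous_on {0..1} q"
    using qD(1) by (meson DERIV_isCont continuous_at_imp_continuous_on)
  obtain u v where uv: "v \<in> borel_measurable (lebesgue_on {0..1})"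
      "integrable (lebesgue_on {0..1}) (\<lambda>x. (v x)\<^sup>2)"
      "\<forall>x\<in>{0..1}. u x = u 0 + integral {0..x} v"
      "\<forall>x\<in>{0..1}. h x = h 0 + integral {0..x} u"
    using h unfolding sl_eigenfunction_def sl_domain_def sobolev_H2_def by blast
  have u_eq: "u 0 + integral {0..x} v = u x" and h_eq: "h 0 + integral {0..x} u = h x"
    if "x \<in> {0..1}" for x
    by (rule bspec[OF uv(3) that, symmetric], rule bspec[OF uv(4) that, symmetric])
  have v_int: "v integrable_on {0..1}"
    by (rule square_integrable_imp_integrable_unit_interval[OF uv(1,2)])
  have u_cont: "continuous_on {0..1} u"
  proof -
    have "continuous_on {0..1} (\<lambda>x. u 0 + integral {0..x} v)"
      by (intro continuous_intros indefinite_integral_continuous_1 v_int)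
    then show ?thesis by (rule continuous_on_eq) (simp add: u_eq)
  qed
  have h_deriv: "(h has_real_derivative u x) (at x within {0..1})" if "x \<in> {0..1}" for x
  proof (rule has_field_derivative_transform_within[where d = 1])
    show "((\<lambda>x. h 0 + integral {0..x} u) has_real_derivative u x) (at x within {0..1})"
      using integral_has_real_derivative[OF u_cont that] by (auto intro!: derivative_eq_intros)
  qed (use that in \<open>simp_all add: h_eq\<close>)
  have h_cont: "continuous_on {0..1} h"
    unfolding continuous_on_eq_continuous_within
    using h_deriv DERIV_continuous by blast
  have dh: "deriv h x = u x" if "x \<in> {0<..<1}" for x
    using h_deriv[of x] that at_within_Icc_at[of 0 x 1] by (intro DERIV_imp_deriv) auto
  define g where "g x = (- (q x + \<mu>) * h x - deriv p x * u x) / p x" for x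
  have g_cont: "continuous_on {0..1} g"
    unfolding g_def using p_pos
    by (intro continuous_intros pD qD p_cont q_cont u_cont h_cont) force
  obtain N where N: "negligible N"
    "\<And>x. x \<in> {0<..<1} - N \<Longrightarrow> ((\<lambda>t. integral {0..t} v) has_real_derivative v x) (at x)"
    using indefinite_integral_has_derivative_ae[OF v_int] by blast
  have "AE x in lebesgue_on {0<..<1}. sl_operator p q h x = \<mu> * h x"
    using h unfolding sl_eigenfunction_def by blast
  then have "AE x in lebesgue. x \<in> {0<..<1} \<longrightarrow> sl_operator p q h x = \<mu> * h x"
    by (subst (asm) AE_restrict_space_iff) auto
  then obtain M where M: "negligible M"
    "\<And>x. x \<in> {0<..<1} - M \<Longrightarrow> sl_operator p q h x = \<mu> * h x"
    by (auto simp: eventually_ae_filter negligible_iff_null_sets)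
  have vg: "v x = g x" if x: "x \<in> {0<..<1} - (N \<union> M)" for x
  proof -
    have "(u has_real_derivative v x) (at x)"
    proof (rule has_field_derivative_transform_within_open)
      show "((\<lambda>t. u 0 + integral {0..t} v) has_real_derivative v x) (at x)"
        using N(2)[of x] x by (auto intro!: derivative_eq_intros)
      show "open {0<..<1::real}" "x \<in> {0<..<1}" using x by auto
    qed (simp_all add: u_eq)
    then have "((\<lambda>t. p t * u t) has_real_derivative deriv p x * u x + p x * v x) (at x)"
      using pD(1)[of x] x by (auto intro!: derivative_eq_intros)
    then have "((\<lambda>t. p t * deriv h t) has_real_derivative deriv p x * u x + p x * v x) (at x)"
      by (rule has_field_derivative_transform_within_open[of _ _ _ "{0<..<1}"])
         (use x dh in auto)
    then have "deriv (\<lambda>t. p t * deriv h t) x = deriv p x * u x + p x * v x"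
      by (rule DERIV_imp_deriv)
    with M(2)[of x] x have "- (deriv p x * u x + p x * v x) - q x * h x = \<mu> * h x"
      by (simp add: sl_operator_def)
    moreover have "p x > 0" using p_pos x by auto
    ultimately show ?thesis unfolding g_def by (simp add: field_simps)
  qed
  have int_vg: "integral {0..x} v = integral {0..x} g" if x: "x \<in> {0..1}" for x
  proof (rule integral_spike)
    \<comment> \<open>the end points are added because the equation is known in the open interval only\<close>
    show "negligible ({0, 1} \<union> (N \<union> M))" using N M by auto
    fix y assume "y \<in> {0..x} - ({0, 1} \<union> (N \<union> M))"
    with x have "y \<in> {0<..<1} - (N \<union> M)" by auto
    then show "g y = v y" by (rule vg[symmetric])
  qed
  have u_deriv: "(u has_real_derivative g x) (at x within {0..1})" if "x \<in> {0..1}" for x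
  proof (rule has_field_derivative_transform_within[where d = 1])
    show "((\<lambda>x. u 0 + integral {0..x} g) has_real_derivative g x) (at x within {0..1})"
      using integral_has_real_derivative[OF g_cont that] by (auto intro!: derivative_eq_intros)
  qed (use that in \<open>simp_all add: u_eq flip: int_vg\<close>)
  have "first_order_solution p q \<mu> h (\<lambda>x. p x * u x)"
    unfolding first_order_solution_def
  proof (intro conjI ballI)
    fix x :: real assume x: "x \<in> {0..1}"
    have px: "p x > 0" using p_pos x by blast
    show "(h has_real_derivative p x * u x / p x) (at x within {0..1})"
      using h_deriv[OF x] px by simp
    have "(p has_real_derivative deriv p x) (at x within {0..1})"
      using pD(1)[OF x] by (rule has_field_derivative_at_within)
    then have "((\<lambda>x. p x * u x) has_real_derivative deriv p x * u x + p x * g x) (at x within {0..1})"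
      using u_deriv[OF x] by (auto intro!: derivative_eq_intros)
    also have "deriv p x * u x + p x * g x = - (q x + \<mu>) * h x"
      unfolding g_def using px by (simp add: field_simps)
    finally show "((\<lambda>x. p x * u x) has_real_derivative - (q x + \<mu>) * h x) (at x within {0..1})" .
  qed
  then show thesis by (rule that)
qed

section \<open>Separation of Sturm-Liouville eigenvalues\<close>

lemma gronwall_unit_interval:
  fixes G :: "real \<Rightarrow> real"
  assumes G: "\<And>x. x \<in> {0..1} \<Longrightarrow> (G has_real_derivative G' x) (at x within {0..1})"
    and x: "x \<in> {0..1}"
  shows "(\<And>t. t \<in> {0..1} \<Longrightarrow> G' t \<le> C * G t) \<Longrightarrow> G x \<le> exp (C * x) * G 0"
    and "(\<And>t. t \<in> {0..1} \<Longrightarrow> - C * G t \<le> G' t) \<Longrightarrow> exp (- C * x) * G 0 \<le> G x"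
proof -
  have deriv: "((\<lambda>t. exp (c * t) * G t) has_real_derivative exp (c * t) * (G' t + c * G t))
      (at t within {0..x})" if "0 \<le> t" "t \<le> x" for c t
  proof -
    have "(G has_real_derivative G' t) (at t within {0..x})"
      using G[of t] x that by (auto intro: DERIV_subset)
    then show ?thesis by (auto intro!: derivative_eq_intros simp: algebra_simps)
  qed
  have mvt: "\<exists>t\<in>{0..x}. exp (c * x) * G x - G 0 = exp (c * t) * (G' t + c * G t) * x" for c
    using mvt_very_simple[of 0 x, OF _ has_field_derivative_imp_has_derivative[OF deriv], of c] x
    by simp
  show "G x \<le> exp (C * x) * G 0" if le: "\<And>t. t \<in> {0..1} \<Longrightarrow> G' t \<le> C * G t"
  proof -
    obtain t where t: "t \<in> {0..x}" "exp (- C * x) * G x - G 0 = exp (- C * t) * (G' t + - C * G t) * x"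
      using mvt[of "- C"] by blast
    have "exp (- C * t) * (G' t + - C * G t) * x \<le> 0"
      using le[of t] t(1) x by (intro mult_nonpos_nonneg mult_nonneg_nonpos) auto
    with t(2) have "exp (- C * x) * G x \<le> G 0" by linarith
    then have "exp (C * x) * (exp (- C * x) * G x) \<le> exp (C * x) * G 0"
      by (intro mult_left_mono) auto
    then show ?thesis by (simp flip: mult.assoc exp_add)
  qed
  show "exp (- C * x) * G 0 \<le> G x" if ge: "\<And>t. t \<in> {0..1} \<Longrightarrow> - C * G t \<le> G' t"
  proof -
    obtain t where t: "t \<in> {0..x}" "exp (C * x) * G x - G 0 = exp (C * t) * (G' t + C * G t) * x"
      using mvt[of C] by blast
    have "0 \<le> exp (C * t) * (G' t + C * G t) * x"
      using ge[of t] t(1) x by (intro mult_nonneg_nonneg) auto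
    with t(2) have "G 0 \<le> exp (C * x) * G x" by linarith
    then have "exp (- C * x) * G 0 \<le> exp (- C * x) * (exp (C * x) * G x)"
      by (intro mult_left_mono) auto
    then show ?thesis by (simp flip: mult.assoc exp_add)
  qed
qed

text \<open>The bounds on the coefficients are kept as parameters so that all constants below are visibly
uniform in the eigenvalue.\<close>
locale bounded_coefficients =
  fixes p p' q :: "real \<Rightarrow> real" and p_min p_max P Q :: real
  assumes p_deriv: "\<And>x. x \<in> {0..1} \<Longrightarrow> (p has_real_derivative p' x) (at x within {0..1})"
    and p_min: "0 < p_min" and p_bounds: "\<And>x. x \<in> {0..1} \<Longrightarrow> p_min \<le> p x \<and> p x \<le> p_max"
    and p'_bound: "\<And>x. x \<in> {0..1} \<Longrightarrow> \<bar>p' x\<bar> \<le> P"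
    and q_bound: "\<And>x. x \<in> {0..1} \<Longrightarrow> \<bar>q x\<bar> \<le> Q"
begin

lemma nonneg: "0 \<le> P" "0 \<le> Q" "0 < p_max"
  using p'_bound[of 0] q_bound[of 0] p_bounds[of 0] p_min by auto

text \<open>Growth rates in the Gronwall estimates for the energy of one solution and for the energy of the
difference of two solutions, and the resulting lower bound for the \<open>L\<^sup>2\<close> mass of \<open>\<omega> h\<close>.\<close>
definition energy_rate where "energy_rate = P / p_min + Q / p_min + Q"
definition difference_rate where "difference_rate = P / p_min + (1 + Q) / p_min + 1 + 2 * Q + (1 + (1 + Q) / p_min) * exp energy_rate"
definition mass_bound where "mass_bound = exp (- energy_rate) / (p_max * (2 + Q))"

lemma energy_rate_nonneg: "0 \<le> energy_rate" using nonneg p_min by (simp add: energy_rate_def)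
lemma mass_bound_pos: "0 < mass_bound" using nonneg by (simp add: mass_bound_def)

lemma quad_le:
  assumes "x \<in> {0..1}" shows "a\<^sup>2 \<le> (p x * a\<^sup>2) / p_min"
  using p_bounds[OF assms] p_min by (simp add: field_simps mult_right_mono)

text \<open>The energy \<open>p (\<omega> h)\<^sup>2 + w\<^sup>2\<close> has logarithmic derivative bounded independently of \<open>\<omega>\<close>: the terms
\<open>2 \<omega>\<^sup>2 h w\<close> and \<open>- 2 \<omega>\<^sup>2 h w\<close> of its derivative, which exceed it by a factor \<open>\<omega>\<close>, cancel.\<close>
lemma energy_bounds:
  assumes s: "first_order_solution p q (\<omega>\<^sup>2) h w" and w: "1 \<le> \<omega>" and h0: "h 0 = 0" and x: "x \<in> {0..1}"
  shows "exp (- energy_rate) * (w 0)\<^sup>2 \<le> p x * (\<omega> * h x)\<^sup>2 + (w x)\<^sup>2"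
    and "p x * (\<omega> * h x)\<^sup>2 + (w x)\<^sup>2 \<le> exp energy_rate * (w 0)\<^sup>2"
proof -
  define E where "E x = p x * (\<omega> * h x)\<^sup>2 + (w x)\<^sup>2" for x
  define E' where "E' x = p' x * (\<omega> * h x)\<^sup>2 - 2 * q x * h x * w x" for x
  have E0: "E 0 = (w 0)\<^sup>2" using h0 by (simp add: E_def)
  have d: "(E has_real_derivative E' t) (at t within {0..1})" if t: "t \<in> {0..1}" for t
  proof -
    have "p t > 0" using p_bounds[OF t] p_min by linarith
    moreover have "(h has_real_derivative w t / p t) (at t within {0..1})"
      "(w has_real_derivative - (q t + \<omega>\<^sup>2) * h t) (at t within {0..1})"
      using s t by (auto simp: first_order_solution_def)
    ultimately show ?thesis unfolding E_def E'_def using p_deriv[OF t]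
      by (auto intro!: derivative_eq_intros simp: field_simps power2_eq_square)
  qed
  have b: "\<bar>E' t\<bar> \<le> energy_rate * E t" if t: "t \<in> {0..1}" for t
  proof -
    define a where "a = p t * (\<omega> * h t)\<^sup>2"
    define b where "b = (w t)\<^sup>2"
    have a0: "a \<ge> 0" "b \<ge> 0" using p_bounds[OF t] p_min by (auto simp: a_def b_def)
    have q1: "(\<omega> * h t)\<^sup>2 \<le> a / p_min" unfolding a_def by (rule quad_le[OF t])
    have "(h t)\<^sup>2 \<le> (\<omega> * h t)\<^sup>2"
      using w by (simp add: power_mult_distrib mult_le_cancel_right1)
    with q1 have q2: "(h t)\<^sup>2 \<le> a / p_min" by linarith
    have "\<bar>p' t * (\<omega> * h t)\<^sup>2\<bar> \<le> P * (a / p_min)"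
      unfolding abs_mult using q1 p'_bound[OF t] nonneg by (intro mult_mono) auto
    moreover have "\<bar>2 * q t * h t * w t\<bar> \<le> Q * (a / p_min + b)"
    proof -
      have "0 \<le> (\<bar>h t\<bar> - \<bar>w t\<bar>)\<^sup>2" by simp
      then have "\<bar>2 * h t * w t\<bar> \<le> (h t)\<^sup>2 + b"
        by (simp add: power2_diff b_def abs_mult)
      then have "\<bar>2 * h t * w t\<bar> \<le> a / p_min + b" using q2 by linarith
      then have "\<bar>q t\<bar> * \<bar>2 * h t * w t\<bar> \<le> Q * (a / p_min + b)"
        using q_bound[OF t] nonneg by (intro mult_mono) auto
      then show ?thesis by (simp add: abs_mult mult_ac)
    qed
    ultimately have "\<bar>E' t\<bar> \<le> P * (a / p_min) + Q * (a / p_min + b)" unfolding E'_def by linarith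
    also have "\<dots> \<le> energy_rate * (a + b)"
    proof -
      have "energy_rate * (a + b) - (P * (a / p_min) + Q * (a / p_min + b)) = (P / p_min) * b + (Q / p_min) * b + Q * a"
        by (simp add: energy_rate_def algebra_simps add_divide_distrib)
      also have "\<dots> \<ge> 0" using a0 nonneg p_min by simp
      finally show ?thesis by simp
    qed
    finally show ?thesis by (simp add: E_def a_def b_def)
  qed
  have Epos: "(w 0)\<^sup>2 \<ge> 0" by simp
  have cx: "energy_rate * x \<le> energy_rate" using energy_rate_nonneg x by (simp add: mult_left_le)
  have "E x \<le> exp (energy_rate * x) * E 0"
    using b by (intro gronwall_unit_interval(1)[OF d x]) (auto simp: abs_le_iff)
  also have "\<dots> \<le> exp energy_rate * (w 0)\<^sup>2" unfolding E0 using cx by (intro mult_right_mono) auto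
  finally show "p x * (\<omega> * h x)\<^sup>2 + (w x)\<^sup>2 \<le> exp energy_rate * (w 0)\<^sup>2" by (simp add: E_def)
  have "exp (- energy_rate) * (w 0)\<^sup>2 \<le> exp (- energy_rate * x) * E 0"
    unfolding E0 using cx by (intro mult_right_mono) auto
  also have "\<dots> \<le> E x"
  proof (intro gronwall_unit_interval(2)[OF d x])
    fix t :: real assume "t \<in> {0..1}"
    from b[OF this] show "- energy_rate * E t \<le> E' t" by linarith
  qed
  finally show "exp (- energy_rate) * (w 0)\<^sup>2 \<le> p x * (\<omega> * h x)\<^sup>2 + (w x)\<^sup>2" by (simp add: E_def)
qed

lemma solution_cont:
  assumes "first_order_solution p q \<mu> h w"
  shows "continuous_on {0..1} h" "continuous_on {0..1} w"
  using assms unfolding first_order_solution_def continuous_on_eq_continuous_within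
  by (auto intro: DERIV_continuous)

lemma p_nonzero: "x \<in> {0..1} \<Longrightarrow> p x \<noteq> 0"
  using p_bounds p_min by fastforce

text \<open>Equipartition: integrating \<open>(h w)' = w\<^sup>2 / p - (q + \<omega>\<^sup>2) h\<^sup>2\<close> between two zeros of \<open>h\<close> shows that half of the
energy, up to lower order, sits in the term with \<open>h\<close>, and the energy is bounded below.\<close>
lemma mass_lower_bound:
  assumes s: "first_order_solution p q (\<omega>\<^sup>2) h w" and w: "1 \<le> \<omega>"
    and h: "h 0 = 0" "h 1 = 0" and w0: "w 0 = 1"
  shows "mass_bound \<le> integral {0..1} (\<lambda>x. (\<omega> * h x)\<^sup>2)"
proof -
  note cont = solution_cont[OF s]
  have "((\<lambda>x. (w x)\<^sup>2 / p x - (q x + \<omega>\<^sup>2) * (h x)\<^sup>2) has_integral h 1 * w 1 - h 0 * w 0) {0..1}"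
  proof (rule fundamental_theorem_of_calculus)
    fix x :: real assume x: "x \<in> {0..1}"
    have "(h has_real_derivative w x / p x) (at x within {0..1})"
      "(w has_real_derivative - (q x + \<omega>\<^sup>2) * h x) (at x within {0..1})"
      using s x by (auto simp: first_order_solution_def)
    then have "((\<lambda>x. h x * w x) has_real_derivative (w x)\<^sup>2 / p x - (q x + \<omega>\<^sup>2) * (h x)\<^sup>2) (at x within {0..1})"
      by (auto intro!: derivative_eq_intros simp: power2_eq_square algebra_simps)
    then show "((\<lambda>x. h x * w x) has_vector_derivative (w x)\<^sup>2 / p x - (q x + \<omega>\<^sup>2) * (h x)\<^sup>2) (at x within {0..1})"
      by (simp add: has_real_derivative_iff_has_vector_derivative)
  qed simp
  then have i1: "((\<lambda>x. (w x)\<^sup>2 / p x - (q x + \<omega>\<^sup>2) * (h x)\<^sup>2) has_integral 0) {0..1}" using h by simp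
  have "(\<lambda>x. (\<omega> * h x)\<^sup>2) integrable_on {0..1}"
    by (intro integrable_continuous_interval continuous_intros cont)
  then have i2: "((\<lambda>x. (2 + Q) * (\<omega> * h x)\<^sup>2) has_integral (2 + Q) * integral {0..1} (\<lambda>x. (\<omega> * h x)\<^sup>2)) {0..1}"
    by (intro has_integral_mult_right) (simp add: has_integral_integral)
  have i3: "((\<lambda>x. exp (- energy_rate) / p_max) has_integral exp (- energy_rate) / p_max) {0..1::real}"
    using has_integral_const_real[of "exp (- energy_rate) / p_max" 0 1] by simp
  have "exp (- energy_rate) / p_max \<le> 0 + (2 + Q) * integral {0..1} (\<lambda>x. (\<omega> * h x)\<^sup>2)"
  proof (rule has_integral_le[OF i3 has_integral_add[OF i1 i2]])
    fix x :: real assume x: "x \<in> {0..1}"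
    have px: "0 < p x" "p x \<le> p_max" using p_bounds[OF x] p_min by linarith+
    have "exp (- energy_rate) / p_max \<le> exp (- energy_rate) / p x" using px by (intro divide_left_mono) auto
    also have "\<dots> \<le> (p x * (\<omega> * h x)\<^sup>2 + (w x)\<^sup>2) / p x"
      using energy_bounds(1)[where w = w, OF s w h(1) x] w0 px by (intro divide_right_mono) auto
    also have "\<dots> = (\<omega> * h x)\<^sup>2 + (w x)\<^sup>2 / p x" using px by (simp add: field_simps)
    also have "\<dots> \<le> (w x)\<^sup>2 / p x - (q x + \<omega>\<^sup>2) * (h x)\<^sup>2 + (2 + Q) * (\<omega> * h x)\<^sup>2"
    proof -
      have "q x * (h x)\<^sup>2 \<le> Q * (h x)\<^sup>2" using q_bound[OF x] by (intro mult_right_mono) auto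
      also have "\<dots> \<le> Q * (\<omega> * h x)\<^sup>2"
        using w nonneg by (intro mult_left_mono) (auto simp: power_mult_distrib mult_le_cancel_right1)
      finally show ?thesis by (simp add: algebra_simps power_mult_distrib)
    qed
    finally show "exp (- energy_rate) / p_max \<le> (w x)\<^sup>2 / p x - (q x + \<omega>\<^sup>2) * (h x)\<^sup>2 + (2 + Q) * (\<omega> * h x)\<^sup>2" .
  qed
  moreover have "mass_bound = exp (- energy_rate) / p_max / (2 + Q)" by (simp add: mass_bound_def)
  ultimately show ?thesis using nonneg by (simp add: pos_divide_le_eq mult.commute)
qed

text \<open>Comparing \<open>\<omega>\<^sub>1 h\<^sub>1\<close> with \<open>\<omega>\<^sub>2 h\<^sub>2\<close>, rather than the solutions themselves, makes the terms of
order \<open>\<omega>\<close> cancel again.  What remains is forced only by the frequency difference \<open>d\<close>, so the energy of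
the difference, which starts from zero, is at most a multiple of \<open>d\<^sup>2\<close>.\<close>
lemma difference_bound:
  assumes s1: "first_order_solution p q (\<omega>1\<^sup>2) h1 w1" and s2: "first_order_solution p q (\<omega>2\<^sup>2) h2 w2"
    and w: "1 \<le> \<omega>1" "1 \<le> \<omega>2"
    and h: "h1 0 = 0" "h2 0 = 0" and w0: "w1 0 = 1" "w2 0 = 1" and x: "x \<in> {0..1}"
  shows "(\<omega>1 * h1 x - \<omega>2 * h2 x)\<^sup>2 \<le> exp difference_rate / p_min * (\<omega>2 - \<omega>1)\<^sup>2"
proof -
  define d where "d = \<omega>2 - \<omega>1"
  define A where "A x = \<omega>1 * h1 x - \<omega>2 * h2 x" for x
  define B where "B x = w1 x - w2 x" for x
  \<comment> \<open>adding the square of d makes the differential inequality for F homogeneous\<close>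
  define F where "F x = p x * (A x)\<^sup>2 + (B x)\<^sup>2 + d\<^sup>2" for x
  define F' where "F' x = p' x * (A x)\<^sup>2 - 2 * A x * (d * w2 x) + 2 * B x * (d * (\<omega>2 * h2 x))
      - 2 * B x * q x * (h1 x - h2 x)" for x
  have dF: "(F has_real_derivative F' t) (at t within {0..1})" if t: "t \<in> {0..1}" for t
  proof -
    have "p t \<noteq> 0" using p_nonzero[OF t] .
    moreover have "(h1 has_real_derivative w1 t / p t) (at t within {0..1})"
      "(w1 has_real_derivative - (q t + \<omega>1\<^sup>2) * h1 t) (at t within {0..1})"
      "(h2 has_real_derivative w2 t / p t) (at t within {0..1})"
      "(w2 has_real_derivative - (q t + \<omega>2\<^sup>2) * h2 t) (at t within {0..1})"
      using s1 s2 t by (auto simp: first_order_solution_def)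
    ultimately show ?thesis unfolding F_def F'_def A_def B_def d_def using p_deriv[OF t]
      by (auto intro!: derivative_eq_intros simp: field_simps power2_eq_square)
  qed
  have b: "F' t \<le> difference_rate * F t" if t: "t \<in> {0..1}" for t
  proof -
    define a where "a = p t * (A t)\<^sup>2"
    define b where "b = (B t)\<^sup>2"
    have a0: "a \<ge> 0" "b \<ge> 0" using p_bounds[OF t] p_min by (auto simp: a_def b_def)
    have Aa: "(A t)\<^sup>2 \<le> a / p_min" unfolding a_def by (rule quad_le[OF t])
    have en: "p t * (\<omega>2 * h2 t)\<^sup>2 + (w2 t)\<^sup>2 \<le> exp energy_rate"
      using energy_bounds(2)[where w = w2, OF s2 w(2) h(2) t] w0 by simp
    have pw: "0 \<le> p t * (\<omega>2 * h2 t)\<^sup>2" using p_bounds[OF t] p_min by simp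
    have w2: "(w2 t)\<^sup>2 \<le> exp energy_rate" using en pw by linarith
    have h2: "(\<omega>2 * h2 t)\<^sup>2 \<le> exp energy_rate / p_min"
    proof -
      have "(\<omega>2 * h2 t)\<^sup>2 \<le> p t * (\<omega>2 * h2 t)\<^sup>2 / p_min" by (rule quad_le[OF t])
      also have "\<dots> \<le> exp energy_rate / p_min"
        using en zero_le_power2[of "w2 t"] p_min by (intro divide_right_mono) linarith+
      finally show ?thesis .
    qed
    have amgm: "\<bar>2 * u * v\<bar> \<le> u\<^sup>2 + v\<^sup>2" for u v :: real
    proof -
      have "0 \<le> (\<bar>u\<bar> - \<bar>v\<bar>)\<^sup>2" by simp
      then show ?thesis by (simp add: power2_diff abs_mult)
    qed
    have t1: "p' t * (A t)\<^sup>2 \<le> P * (a / p_min)"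
      using p'_bound[OF t] Aa nonneg by (intro mult_mono) auto
    have t2: "- 2 * A t * (d * w2 t) \<le> a / p_min + d\<^sup>2 * exp energy_rate"
    proof -
      have "- 2 * A t * (d * w2 t) \<le> (A t)\<^sup>2 + (d * w2 t)\<^sup>2" using amgm[of "A t" "d * w2 t"] by linarith
      also have "\<dots> \<le> a / p_min + d\<^sup>2 * exp energy_rate"
        unfolding power_mult_distrib using Aa w2 by (intro add_mono mult_left_mono) auto
      finally show ?thesis .
    qed
    have t3: "2 * B t * (d * (\<omega>2 * h2 t)) \<le> b + d\<^sup>2 * (exp energy_rate / p_min)"
    proof -
      have "2 * B t * (d * (\<omega>2 * h2 t)) \<le> b + (d * (\<omega>2 * h2 t))\<^sup>2"
        using amgm[of "B t" "d * (\<omega>2 * h2 t)"] unfolding b_def by linarith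
      also have "(d * (\<omega>2 * h2 t))\<^sup>2 \<le> d\<^sup>2 * (exp energy_rate / p_min)"
        unfolding power_mult_distrib[of d] using h2 by (intro mult_left_mono) auto
      finally show ?thesis by simp
    qed
    have t4: "- 2 * B t * q t * (h1 t - h2 t) \<le> Q * (a / p_min + 2 * b + d\<^sup>2 * (exp energy_rate / p_min))"
    proof -
      define y where "y = A t + d * h2 t"
      have y: "h1 t - h2 t = y / \<omega>1" using w by (simp add: y_def A_def d_def field_simps)
      have "\<bar>h1 t - h2 t\<bar> \<le> \<bar>y\<bar>" unfolding y using w mult_right_mono[of 1 \<omega>1 "\<bar>y\<bar>"] by (simp add: field_simps)
      then have "\<bar>2 * B t * (h1 t - h2 t)\<bar> \<le> \<bar>2 * B t\<bar> * \<bar>y\<bar>"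
        unfolding abs_mult[of "2 * B t"] by (intro mult_left_mono) auto
      also have "\<dots> \<le> \<bar>2 * B t * A t\<bar> + \<bar>2 * B t * (d * h2 t)\<bar>"
        unfolding y_def abs_mult[symmetric] by (simp add: distrib_left abs_triangle_ineq)
      also have "\<dots> \<le> (b + (A t)\<^sup>2) + (b + (d * h2 t)\<^sup>2)"
        unfolding b_def by (intro add_mono amgm)
      also have "(d * h2 t)\<^sup>2 \<le> d\<^sup>2 * (exp energy_rate / p_min)"
      proof -
        have "(h2 t)\<^sup>2 \<le> (\<omega>2 * h2 t)\<^sup>2"
          using w by (simp add: power_mult_distrib mult_le_cancel_right1)
        then show ?thesis unfolding power_mult_distrib[of d] using h2 by (intro mult_left_mono) auto
      qed
      finally have le: "\<bar>2 * B t * (h1 t - h2 t)\<bar> \<le> a / p_min + 2 * b + d\<^sup>2 * (exp energy_rate / p_min)" using Aa by linarith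
      have "- 2 * B t * q t * (h1 t - h2 t) \<le> \<bar>q t\<bar> * \<bar>2 * B t * (h1 t - h2 t)\<bar>"
        unfolding abs_mult[symmetric] by (rule order_trans[OF _ abs_ge_minus_self]) (simp add: algebra_simps)
      also have "\<dots> \<le> Q * (a / p_min + 2 * b + d\<^sup>2 * (exp energy_rate / p_min))"
        using le q_bound[OF t] nonneg by (intro mult_mono) auto
      finally show ?thesis .
    qed
    have "F' t \<le> P * (a / p_min) + (a / p_min + d\<^sup>2 * exp energy_rate) + (b + d\<^sup>2 * (exp energy_rate / p_min))
        + Q * (a / p_min + 2 * b + d\<^sup>2 * (exp energy_rate / p_min))"
      unfolding F'_def using t1 t2 t3 t4 by linarith
    also have "\<dots> \<le> difference_rate * (a + b + d\<^sup>2)"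
    proof -
      define c2 where "c2 = P / p_min + (1 + Q) / p_min"
      define c3 where "c3 = (1 + (1 + Q) / p_min) * exp energy_rate"
      have C: "difference_rate = c2 + (1 + 2 * Q) + c3" by (simp add: difference_rate_def c2_def c3_def)
      have nn: "c2 \<ge> 0" "c3 \<ge> 0" using nonneg p_min by (auto simp: c2_def c3_def)
      have "P * (a / p_min) + (a / p_min + d\<^sup>2 * exp energy_rate) + (b + d\<^sup>2 * (exp energy_rate / p_min))
        + Q * (a / p_min + 2 * b + d\<^sup>2 * (exp energy_rate / p_min)) = c2 * a + (1 + 2 * Q) * b + c3 * d\<^sup>2"
        by (simp add: c2_def c3_def algebra_simps add_divide_distrib)
      moreover have "c2 \<le> difference_rate" "1 + 2 * Q \<le> difference_rate" "c3 \<le> difference_rate"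
        unfolding C using nn nonneg by auto
      then have "c2 * a + (1 + 2 * Q) * b + c3 * d\<^sup>2 \<le> difference_rate * a + difference_rate * b + difference_rate * d\<^sup>2"
        using a0 by (intro add_mono mult_right_mono) auto
      ultimately show ?thesis by (simp add: algebra_simps)
    qed
    finally show ?thesis by (simp add: F_def a_def b_def)
  qed
  have C0: "difference_rate \<ge> 0"
  proof -
    have "0 \<le> (1 + (1 + Q) / p_min) * exp energy_rate" using nonneg p_min by simp
    then show ?thesis unfolding difference_rate_def using nonneg p_min by (intro add_nonneg_nonneg) auto
  qed
  have "F x \<le> exp (difference_rate * x) * F 0"
    using b by (intro gronwall_unit_interval(1)[OF dF x]) auto
  also have "F 0 = d\<^sup>2" by (simp add: F_def A_def B_def h w0)
  also have "exp (difference_rate * x) * d\<^sup>2 \<le> exp difference_rate * d\<^sup>2"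
    using x C0 by (intro mult_right_mono) (auto simp: mult_left_le)
  finally have "p x * (A x)\<^sup>2 \<le> exp difference_rate * d\<^sup>2"
    using zero_le_power2[of "B x"] zero_le_power2[of d] unfolding F_def by linarith
  then have "p x * (A x)\<^sup>2 / p_min \<le> exp difference_rate * d\<^sup>2 / p_min" using p_min by (intro divide_right_mono) auto
  with quad_le[OF x, of "A x"] show ?thesis by (simp add: A_def d_def)
qed

text \<open>The derivative of the Wronskian \<open>h\<^sub>1 w\<^sub>2 - h\<^sub>2 w\<^sub>1\<close> is a multiple of \<open>h\<^sub>1 h\<^sub>2\<close>.\<close>
lemma orthogonality:
  assumes s1: "first_order_solution p q (\<omega>1\<^sup>2) h1 w1" and s2: "first_order_solution p q (\<omega>2\<^sup>2) h2 w2"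
    and w: "1 \<le> \<omega>1" "\<omega>1 < \<omega>2"
    and h: "h1 0 = 0" "h2 0 = 0" "h1 1 = 0" "h2 1 = 0"
  shows "((\<lambda>x. h1 x * h2 x) has_integral 0) {0..1}"
proof -
  have "((\<lambda>x. (\<omega>1\<^sup>2 - \<omega>2\<^sup>2) * (h1 x * h2 x)) has_integral
      (h1 1 * w2 1 - h2 1 * w1 1) - (h1 0 * w2 0 - h2 0 * w1 0)) {0..1}"
  proof (rule fundamental_theorem_of_calculus)
    fix x :: real assume x: "x \<in> {0..1}"
    have "(h1 has_real_derivative w1 x / p x) (at x within {0..1})"
      "(w1 has_real_derivative - (q x + \<omega>1\<^sup>2) * h1 x) (at x within {0..1})"
      "(h2 has_real_derivative w2 x / p x) (at x within {0..1})"
      "(w2 has_real_derivative - (q x + \<omega>2\<^sup>2) * h2 x) (at x within {0..1})"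
      using s1 s2 x by (auto simp: first_order_solution_def)
    then have "((\<lambda>x. h1 x * w2 x - h2 x * w1 x) has_real_derivative (\<omega>1\<^sup>2 - \<omega>2\<^sup>2) * (h1 x * h2 x)) (at x within {0..1})"
      by (auto intro!: derivative_eq_intros simp: algebra_simps)
    then show "((\<lambda>x. h1 x * w2 x - h2 x * w1 x) has_vector_derivative (\<omega>1\<^sup>2 - \<omega>2\<^sup>2) * (h1 x * h2 x)) (at x within {0..1})"
      by (simp add: has_real_derivative_iff_has_vector_derivative)
  qed simp
  moreover have "\<omega>1\<^sup>2 - \<omega>2\<^sup>2 \<noteq> 0" using w by (simp add: power2_eq_iff)
  ultimately show ?thesis
    using has_integral_cmul_iff[of "\<omega>1\<^sup>2 - \<omega>2\<^sup>2" "\<lambda>x. h1 x * h2 x" 0 "{0..1}"] h by simp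
qed

text \<open>By orthogonality the square of \<open>\<omega>\<^sub>1 h\<^sub>1 - \<omega>\<^sub>2 h\<^sub>2\<close> integrates to the sum of the two masses.  The masses are
bounded below and the square is at most a multiple of the squared frequency difference.\<close>
lemma sqrt_eigenvalue_gap:
  assumes s1: "first_order_solution p q (\<omega>1\<^sup>2) h1 w1" and s2: "first_order_solution p q (\<omega>2\<^sup>2) h2 w2"
    and w: "1 \<le> \<omega>1" "\<omega>1 < \<omega>2"
    and h: "h1 0 = 0" "h2 0 = 0" "h1 1 = 0" "h2 1 = 0" and w0: "w1 0 = 1" "w2 0 = 1"
  shows "sqrt (mass_bound * p_min / exp difference_rate) \<le> \<omega>2 - \<omega>1"
proof -
  note cont = solution_cont[OF s1] solution_cont[OF s2]
  have i1: "((\<lambda>x. (\<omega>1 * h1 x)\<^sup>2) has_integral integral {0..1} (\<lambda>x. (\<omega>1 * h1 x)\<^sup>2)) {0..1}"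
    by (intro integrable_integral integrable_continuous_interval continuous_intros cont)
  have i2: "((\<lambda>x. (\<omega>2 * h2 x)\<^sup>2) has_integral integral {0..1} (\<lambda>x. (\<omega>2 * h2 x)\<^sup>2)) {0..1}"
    by (intro integrable_integral integrable_continuous_interval continuous_intros cont)
  have i3: "((\<lambda>x. - (2 * \<omega>1 * \<omega>2) * (h1 x * h2 x)) has_integral - (2 * \<omega>1 * \<omega>2) * 0) {0..1}"
    by (intro has_integral_mult_right orthogonality[OF s1 s2 w h])
  have i4: "((\<lambda>x. exp difference_rate / p_min * (\<omega>2 - \<omega>1)\<^sup>2) has_integral exp difference_rate / p_min * (\<omega>2 - \<omega>1)\<^sup>2) {0..1::real}"
    using has_integral_const_real[of "exp difference_rate / p_min * (\<omega>2 - \<omega>1)\<^sup>2" 0 1] by simp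
  have "integral {0..1} (\<lambda>x. (\<omega>1 * h1 x)\<^sup>2) + integral {0..1} (\<lambda>x. (\<omega>2 * h2 x)\<^sup>2)
      + - (2 * \<omega>1 * \<omega>2) * 0 \<le> exp difference_rate / p_min * (\<omega>2 - \<omega>1)\<^sup>2"
  proof (rule has_integral_le[OF has_integral_add[OF has_integral_add[OF i1 i2] i3] i4])
    fix x :: real assume x: "x \<in> {0..1}"
    have "(\<omega>1 * h1 x)\<^sup>2 + (\<omega>2 * h2 x)\<^sup>2 + - (2 * \<omega>1 * \<omega>2) * (h1 x * h2 x) = (\<omega>1 * h1 x - \<omega>2 * h2 x)\<^sup>2"
      by (simp add: power2_eq_square algebra_simps)
    also have "\<dots> \<le> exp difference_rate / p_min * (\<omega>2 - \<omega>1)\<^sup>2"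
      using w by (intro difference_bound[OF s1 s2 _ _ h(1,2) w0 x]) auto
    finally show "(\<omega>1 * h1 x)\<^sup>2 + (\<omega>2 * h2 x)\<^sup>2 + - (2 * \<omega>1 * \<omega>2) * (h1 x * h2 x)
      \<le> exp difference_rate / p_min * (\<omega>2 - \<omega>1)\<^sup>2" .
  qed
  moreover have "mass_bound \<le> integral {0..1} (\<lambda>x. (\<omega>1 * h1 x)\<^sup>2)"
    using w h w0 by (intro mass_lower_bound[OF s1]) auto
  moreover have "0 \<le> integral {0..1} (\<lambda>x. (\<omega>2 * h2 x)\<^sup>2)"
    by (intro Henstock_Kurzweil_Integration.integral_nonneg has_integral_integrable[OF i2]) auto
  ultimately have "mass_bound \<le> exp difference_rate / p_min * (\<omega>2 - \<omega>1)\<^sup>2" by linarith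
  then have "mass_bound * p_min / exp difference_rate \<le> (\<omega>2 - \<omega>1)\<^sup>2" using p_min by (simp add: field_simps)
  then show ?thesis using w by (intro real_le_lsqrt) auto
qed

end

lemma smooth_coefficients_bounded:
  assumes p: "smooth_near_unit_interval p" and q: "smooth_near_unit_interval q"
    and p_pos: "\<And>x. x \<in> {0..1} \<Longrightarrow> p x > 0"
  obtains p_min p_max P Q where "bounded_coefficients p (deriv p) q p_min p_max P Q"
proof -
  note pD = smooth_near_unit_intervalD[OF p] and qD = smooth_near_unit_intervalD[OF q]
  have p_cont: "continuous_on {0..1} p"
    using pD(1) by (meson DERIV_isCont continuous_at_imp_continuous_on)
  have q_cont: "continuous_on {0..1} q"
    using qD(1) by (meson DERIV_isCont continuous_at_imp_continuous_on)
  have bdd: "\<exists>B. \<forall>x\<in>{0..1}. \<bar>f x\<bar> \<le> B" if f: "continuous_on {0..1} f" for f :: "real \<Rightarrow> real"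
  proof -
    have "bounded (f ` {0..1})"
      using f by (intro compact_imp_bounded compact_continuous_image) auto
    then show ?thesis by (auto simp: bounded_iff)
  qed
  obtain x0 where x0: "x0 \<in> {0..1}" "\<forall>x\<in>{0..1}. p x0 \<le> p x"
    using continuous_attains_inf[OF _ _ p_cont] by auto
  obtain p_max where "\<forall>x\<in>{0..1}. \<bar>p x\<bar> \<le> p_max" using bdd[OF p_cont] by blast
  moreover obtain P where "\<forall>x\<in>{0..1}. \<bar>deriv p x\<bar> \<le> P" using bdd[OF pD(2)] by blast
  moreover obtain Q where "\<forall>x\<in>{0..1}. \<bar>q x\<bar> \<le> Q" using bdd[OF q_cont] by blast
  ultimately have "bounded_coefficients p (deriv p) q (p x0) p_max P Q"
  proof unfold_locales
    show "(p has_real_derivative deriv p x) (at x within {0..1})" if "x \<in> {0..1}" for x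
      using pD(1)[OF that] by (rule has_field_derivative_at_within)
  qed (use x0 p_pos in \<open>auto simp: abs_le_iff\<close>)
  then show thesis by (rule that)
qed

text \<open>Eigenfunctions are normalised to initial flux 1, which is possible because the flux at 0 cannot vanish.\<close>
lemma sl_sqrt_eigenvalue_gap:
  assumes p: "smooth_near_unit_interval p" and q: "smooth_near_unit_interval q"
    and p_pos: "\<And>x. x \<in> {0..1} \<Longrightarrow> p x > 0"
  obtains c where "c > 0" "\<And>\<mu> \<nu>. \<lbrakk>sl_eigenvalue p q \<mu>; sl_eigenvalue p q \<nu>; 1 \<le> \<mu>; \<mu> < \<nu>\<rbrakk> \<Longrightarrow>
      c \<le> sqrt \<nu> - sqrt \<mu>"
proof -
  obtain p_min p_max P Q where "bounded_coefficients p (deriv p) q p_min p_max P Q"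
    using smooth_coefficients_bounded[OF p q p_pos] by blast
  then interpret bounded_coefficients p "deriv p" q p_min p_max P Q .
  have normalised: "\<exists>h w. first_order_solution p q ((sqrt \<mu>)\<^sup>2) h w \<and> h 0 = 0 \<and> h 1 = 0 \<and> w 0 = 1"
    if mu: "sl_eigenvalue p q \<mu>" "1 \<le> \<mu>" for \<mu>
  proof -
    obtain h where h: "sl_eigenfunction p q \<mu> h" using mu by (auto simp: sl_eigenvalue_def)
    obtain w where w: "first_order_solution p q \<mu> h w"
      using eigenfunction_first_order[OF p q p_pos h] by blast
    have h01: "h 0 = 0" "h 1 = 0" and hne: "\<exists>x\<in>{0..1}. h x \<noteq> 0"
      using h by (auto simp: sl_eigenfunction_def sl_domain_def)
    \<comment> \<open>otherwise the energy vanishes at 0, hence everywhere\<close>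
    have w0: "w 0 \<noteq> 0"
    proof
      assume z: "w 0 = 0"
      have "h x = 0" if x: "x \<in> {0..1}" for x
      proof -
        have "p x * (sqrt \<mu> * h x)\<^sup>2 + (w x)\<^sup>2 \<le> 0"
          using energy_bounds(2)[of "sqrt \<mu>" h w x] w mu h01 x z by simp
        then have "p x * (sqrt \<mu> * h x)\<^sup>2 \<le> 0"
          using zero_le_power2[of "w x"] by linarith
        then show ?thesis using p_bounds[OF x] p_min mu
          by (auto simp: mult_le_0_iff power_mult_distrib)
      qed
      then show False using hne by blast
    qed
    obtain c where c: "w 0 * c = 1" using w0 by (metis right_inverse)
    have "((\<lambda>x. h x * c) has_real_derivative (w x * c) / p x) (at x within {0..1})"
      "((\<lambda>x. w x * c) has_real_derivative - (q x + \<mu>) * (h x * c)) (at x within {0..1})"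
      if x: "x \<in> {0..1}" for x
    proof -
      have d: "(h has_real_derivative w x / p x) (at x within {0..1})"
        "(w has_real_derivative - (q x + \<mu>) * h x) (at x within {0..1})"
        using w x unfolding first_order_solution_def by blast+
      show "((\<lambda>x. h x * c) has_real_derivative (w x * c) / p x) (at x within {0..1})"
        using DERIV_cmult_right[OF d(1), of c] by simp
      show "((\<lambda>x. w x * c) has_real_derivative - (q x + \<mu>) * (h x * c)) (at x within {0..1})"
        using DERIV_cmult_right[OF d(2), of c] by (simp add: mult.assoc)
    qed
    then have "first_order_solution p q ((sqrt \<mu>)\<^sup>2) (\<lambda>x. h x * c) (\<lambda>x. w x * c)"
      using mu unfolding first_order_solution_def by simp
    then show ?thesis using h01 c
      by (intro exI[of _ "\<lambda>x. h x * c"] exI[of _ "\<lambda>x. w x * c"]) auto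
  qed
  show thesis
  proof
    show "sqrt (mass_bound * p_min / exp difference_rate) > 0" using mass_bound_pos p_min by simp
    fix \<mu> \<nu> assume mn: "sl_eigenvalue p q \<mu>" "sl_eigenvalue p q \<nu>" "1 \<le> \<mu>" "\<mu> < \<nu>"
    obtain h1 w1 where 1: "first_order_solution p q ((sqrt \<mu>)\<^sup>2) h1 w1" "h1 0 = 0" "h1 1 = 0" "w1 0 = 1"
      using normalised[OF mn(1,3)] by blast
    obtain h2 w2 where 2: "first_order_solution p q ((sqrt \<nu>)\<^sup>2) h2 w2" "h2 0 = 0" "h2 1 = 0" "w2 0 = 1"
      using normalised[OF mn(2)] mn by force
    show "sqrt (mass_bound * p_min / exp difference_rate) \<le> sqrt \<nu> - sqrt \<mu>"
      by (rule sqrt_eigenvalue_gap[OF 1(1) 2(1)]) (use 1 2 mn in auto)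
  qed
qed

text \<open>A uniform gap \<open>c\<close> between square roots makes the square root of the \<open>n\<close>-th eigenvalue grow at least linearly, and
\<open>\<lambda>\<^sub>n\<^sub>+\<^sub>1 - \<lambda>\<^sub>n\<close> factors into the difference and the sum of the two square roots.  The finitely many eigenvalues below
that range only lower the constant.\<close>
lemma sl_eigenvalue_gap_linear:
  assumes p: "smooth_near_unit_interval p" and q: "smooth_near_unit_interval q"
    and p_pos: "\<And>x. x \<in> {0..1} \<Longrightarrow> p x > 0"
    and lam: "sl_eigenvalue_sequence p q lam"
  obtains c where "c > 0" "\<And>n. n \<ge> 1 \<Longrightarrow> c * (2 * real n + 1) \<le> lam (Suc n) - lam n"
proof -
  obtain c where c: "c > 0" "\<And>\<mu> \<nu>. \<lbrakk>sl_eigenvalue p q \<mu>; sl_eigenvalue p q \<nu>; 1 \<le> \<mu>; \<mu> < \<nu>\<rbrakk> \<Longrightarrow>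
      c \<le> sqrt \<nu> - sqrt \<mu>"
    using sl_sqrt_eigenvalue_gap[OF p q p_pos] by blast
  have mono: "lam n < lam (Suc n)" if "n \<ge> 1" for n
    using lam that unfolding sl_eigenvalue_sequence_def by (auto dest: strict_mono_onD)
  have ev: "sl_eigenvalue p q (lam n)" if "n \<ge> 1" for n
  proof -
    have "lam n \<in> lam ` {1..}" using that by simp
    then show ?thesis using lam unfolding sl_eigenvalue_sequence_def by simp
  qed
  have "\<forall>\<^sub>F n in sequentially. 1 \<le> lam n"
    using lam unfolding sl_eigenvalue_sequence_def filterlim_at_top by blast
  then obtain n1 where n1: "\<And>n. n \<ge> n1 \<Longrightarrow> 1 \<le> lam n" unfolding eventually_sequentially by blast
  define n0 where "n0 = max 1 n1"
  have n0: "n0 \<ge> 1" "\<And>n. n \<ge> n0 \<Longrightarrow> 1 \<le> lam n" using n1 by (auto simp: n0_def)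
  have step: "c \<le> sqrt (lam (Suc n)) - sqrt (lam n)" if "n \<ge> n0" for n
    using that n0 by (intro c(2) ev mono) auto
  have lower: "c * real k \<le> sqrt (lam (n0 + k))" for k
  proof (induction k)
    case 0
    have "1 \<le> lam n0" using n0 by simp
    then show ?case by simp
  next
    case (Suc k)
    then show ?case using step[of "n0 + k"] by (simp add: algebra_simps)
  qed
  \<comment> \<open>from 2 n0 on, the linear lower bound c (n - n0) is at least half of c n\<close>
  have big: "c\<^sup>2 / 3 * (2 * real n + 1) \<le> lam (Suc n) - lam n" if n: "n \<ge> 2 * n0" for n
  proof -
    have l1: "lam n \<ge> 1" "lam (Suc n) \<ge> 1" using n n0 by auto
    have s: "c \<le> sqrt (lam (Suc n)) - sqrt (lam n)" using step n by simp
    have low: "c * (real n / 2) \<le> sqrt (lam n)"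
    proof -
      have "c * (real n / 2) \<le> c * real (n - n0)" using n c(1) by (intro mult_left_mono) auto
      also have "\<dots> \<le> sqrt (lam n)" using lower[of "n - n0"] n by simp
      finally show ?thesis .
    qed
    have "c\<^sup>2 / 3 * (2 * real n + 1) \<le> c\<^sup>2 * real n"
    proof -
      have "(2 * real n + 1) / 3 \<le> real n" using n n0(1) by simp
      then have "c\<^sup>2 * ((2 * real n + 1) / 3) \<le> c\<^sup>2 * real n" by (intro mult_left_mono) auto
      then show ?thesis by simp
    qed
    also have "\<dots> = c * (2 * (c * (real n / 2)))" by (simp add: power2_eq_square)
    also have "\<dots> \<le> (sqrt (lam (Suc n)) - sqrt (lam n)) * (sqrt (lam (Suc n)) + sqrt (lam n))"
      using s low c(1) mono[of n] n n0(1) by (intro mult_mono) auto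
    also have "\<dots> = lam (Suc n) - lam n" using l1 by (simp add: algebra_simps)
    finally show ?thesis .
  qed
  define g where "g n = (lam (Suc n) - lam n) / (2 * real n + 1)" for n
  define c' where "c' = Min (insert (c\<^sup>2 / 3) (g ` {1..2 * n0}))"
  have "c' > 0" unfolding c'_def using c(1) mono by (subst Min_gr_iff) (auto simp: g_def)
  moreover have "c' * (2 * real n + 1) \<le> lam (Suc n) - lam n" if n: "n \<ge> 1" for n
  proof (cases "n \<ge> 2 * n0")
    case True
    have "c' * (2 * real n + 1) \<le> c\<^sup>2 / 3 * (2 * real n + 1)"
      unfolding c'_def by (intro mult_right_mono Min_le) auto
    with big[OF True] show ?thesis by linarith
  next
    case False
    then have "c' \<le> g n" unfolding c'_def using n by (intro Min_le) auto
    then show ?thesis by (simp add: g_def field_simps)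
  qed
  ultimately show thesis by (rule that)
qed

lemma sl_eigenvalue_gap_quadratic:
  assumes "\<And>n. n \<ge> 1 \<Longrightarrow> c * (2 * real n + 1) \<le> lam (Suc n) - lam n"
    and "1 \<le> k" "k \<le> s"
  shows "c * ((real s)\<^sup>2 - (real k)\<^sup>2) \<le> lam s - lam k"
  using assms(3)
proof (induction s rule: dec_induct)
  case (step n)
  then show ?case using assms(1)[of n] assms(2) by (simp add: power2_eq_square algebra_simps)
qed simp

section \<open>The Prony polynomial as an orthogonal polynomial\<close>

definition node_poly :: "(nat \<Rightarrow> real) \<Rightarrow> nat set \<Rightarrow> real poly" where
  "node_poly x S = (\<Prod>j\<in>S. [:- x j, 1:])"

definition lagrange_poly :: "(nat \<Rightarrow> real) \<Rightarrow> nat set \<Rightarrow> nat \<Rightarrow> real poly" where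
  "lagrange_poly x S i = smult (1 / (\<Prod>j\<in>S - {i}. x i - x j)) (node_poly x (S - {i}))"

lemma poly_node_poly: "poly (node_poly x S) z = (\<Prod>j\<in>S. z - x j)"
  by (simp add: node_poly_def poly_prod)

lemma degree_node_poly_le: "finite S \<Longrightarrow> degree (node_poly x S) \<le> card S"
  unfolding node_poly_def by (rule order_trans[OF degree_prod_sum_le]) (simp_all add: o_def)

lemma poly_lagrange_poly: "poly (lagrange_poly x S i) z = (\<Prod>j\<in>S - {i}. (z - x j) / (x i - x j))"
  by (simp add: lagrange_poly_def poly_node_poly prod_dividef)

lemma poly_lagrange_poly_node:
  assumes "finite S" "inj_on x S" "i \<in> S" "j \<in> S"
  shows "poly (lagrange_poly x S i) (x j) = (if i = j then 1 else 0)"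
proof (cases "i = j")
  case True
  have "x i - x k \<noteq> 0" if "k \<in> S - {i}" for k
    using that assms by (auto simp: inj_on_def)
  then show ?thesis using True by (simp add: poly_lagrange_poly)
next
  case False
  then show ?thesis using assms by (auto simp: poly_lagrange_poly)
qed

lemma degree_lagrange_poly_less:
  assumes "finite S" "i \<in> S"
  shows "degree (lagrange_poly x S i) < card S"
proof -
  have "degree (lagrange_poly x S i) \<le> card (S - {i})"
    unfolding lagrange_poly_def
    by (rule order_trans[OF degree_smult_le degree_node_poly_le]) (use assms in auto)
  also have "\<dots> < card S" using assms by (rule card_Diff1_less)
  finally show ?thesis .
qed

lemma lagrange_interpolation:
  assumes S: "finite S" "inj_on x S" and f: "degree f < card S"
  shows "(\<Sum>i\<in>S. poly f (x i) * poly (lagrange_poly x S i) z) = poly f z"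
proof -
  have "(\<Sum>i\<in>S. smult (poly f (x i)) (lagrange_poly x S i)) = f" (is "?g = f")
  proof (rule poly_eqI_degree)
    show "card (x ` S) > degree f" using f S by (simp add: card_image)
    show "card (x ` S) > degree ?g"
      unfolding card_image[OF S(2)]
    proof (rule degree_sum_less)
      show "degree (smult (poly f (x i)) (lagrange_poly x S i)) < card S" if "i \<in> S" for i
        using degree_lagrange_poly_less[OF S(1) that] degree_smult_le by (rule le_less_trans[rotated])
      show "0 < card S" using f by linarith
    qed
    fix t assume "t \<in> x ` S"
    then obtain j where j: "j \<in> S" "t = x j" by blast
    have "poly ?g t = (\<Sum>i\<in>S. if i = j then poly f (x i) else 0)"
      unfolding poly_sum j(2) poly_smult
      by (intro sum.cong refl) (simp add: poly_lagrange_poly_node S j(1))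
    then show "poly ?g t = poly f t" using S j by simp
  qed
  then have "poly f z = poly ?g z" by simp
  then show ?thesis by (simp add: poly_sum)
qed

definition moment :: "(nat \<Rightarrow> real) \<Rightarrow> (nat \<Rightarrow> real) \<Rightarrow> nat set \<Rightarrow> real poly \<Rightarrow> real" where
  "moment c x S f = (\<Sum>n\<in>S. c n * poly f (x n))"

lemma moment_diff_smult:
  "moment c x S (smult a f - smult b g) = a * moment c x S f - b * moment c x S g"
  by (simp add: moment_def sum_subtractf sum_distrib_left algebra_simps)

lemma poly_eq_sum_coeff:
  fixes f :: "real poly"
  assumes "degree f \<le> n" shows "poly f z = (\<Sum>j\<le>n. coeff f j * z ^ j)"
  using arg_cong[OF poly_as_sum_of_monoms'[OF assms], of "\<lambda>f. poly f z"]
  by (simp add: poly_sum poly_monom)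

lemma moment_eq_sum_coeff:
  assumes "degree f \<le> n"
  shows "(\<Sum>j\<le>n. coeff f j * (\<Sum>k\<in>S. c k * x k ^ (i + j))) = moment c x S (monom 1 i * f)"
proof -
  have "(\<Sum>j\<le>n. coeff f j * (\<Sum>k\<in>S. c k * x k ^ (i + j)))
      = (\<Sum>k\<in>S. \<Sum>j\<le>n. c k * (x k ^ i * (coeff f j * x k ^ j)))"
    unfolding sum_distrib_left by (subst sum.swap) (simp add: power_add mult_ac)
  also have "\<dots> = moment c x S (monom 1 i * f)"
    unfolding moment_def poly_mult poly_monom poly_eq_sum_coeff[OF assms] sum_distrib_left
    by simp
  finally show ?thesis .
qed

text \<open>A null vector of the matrix is the coefficient vector of \<open>g\<close>: the first row evaluates \<open>g\<close> at \<open>z\<close>,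
and row \<open>i + 1\<close> integrates \<open>X\<^sup>i g\<close>.\<close>
lemma prony_poly_eq_0_iff:
  assumes m: "\<And>k. m k = (\<Sum>n\<in>S. c n * x n ^ k)"
  shows "prony_poly N m z = 0 \<longleftrightarrow>
    (\<exists>g. g \<noteq> 0 \<and> degree g \<le> N \<and> poly g z = 0 \<and> (\<forall>i<N. moment c x S (monom 1 i * g) = 0))"
proof -
  let ?A = "Matrix.mat (N + 1) (N + 1) (\<lambda>(i, j). if i = 0 then z ^ j else m (i - 1 + j))"
  have A: "?A \<in> carrier_mat (N + 1) (N + 1)" by simp
  have entry: "vec_index (?A *\<^sub>v v) i = (if i = 0 then poly g z else moment c x S (monom 1 (i - 1) * g))"
    if i: "i < N + 1" and v: "v = Matrix.vec (N + 1) (coeff g)" and g: "degree g \<le> N" for i v g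
  proof -
    have "vec_index (?A *\<^sub>v v) i
        = (\<Sum>j\<in>{0..<N+1}. (if i = 0 then z ^ j else m (i - 1 + j)) * coeff g j)"
      using i v by (simp add: scalar_prod_def)
    also have "{0..<N+1} = {..N}" by auto
    also have "(\<Sum>j\<le>N. (if i = 0 then z ^ j else m (i - 1 + j)) * coeff g j)
        = (if i = 0 then poly g z else moment c x S (monom 1 (i - 1) * g))"
      using poly_eq_sum_coeff[OF g, of z] moment_eq_sum_coeff[OF g, of c x "i - 1" S]
      by (cases i) (simp_all add: m mult.commute[where b = "coeff g j" for j])
    finally show ?thesis .
  qed
  have "prony_poly N m z = 0 \<longleftrightarrow>
      (\<exists>v. v \<in> carrier_vec (N + 1) \<and> v \<noteq> 0\<^sub>v (N + 1) \<and> ?A *\<^sub>v v = 0\<^sub>v (N + 1))"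
    unfolding prony_poly_def by (rule det_0_iff_vec_prod_zero[OF A])
  also have "\<dots> \<longleftrightarrow>
    (\<exists>g. g \<noteq> 0 \<and> degree g \<le> N \<and> poly g z = 0 \<and> (\<forall>i<N. moment c x S (monom 1 i * g) = 0))"
  proof
    assume "\<exists>v. v \<in> carrier_vec (N + 1) \<and> v \<noteq> 0\<^sub>v (N + 1) \<and> ?A *\<^sub>v v = 0\<^sub>v (N + 1)"
    then obtain v where v: "v \<in> carrier_vec (N + 1)" "v \<noteq> 0\<^sub>v (N + 1)" "?A *\<^sub>v v = 0\<^sub>v (N + 1)"
      by blast
    define g where "g = (\<Sum>j\<le>N. monom (vec_index v j) j)"
    have cg: "coeff g j = (if j \<le> N then vec_index v j else 0)" for j
      by (simp add: g_def coeff_sum coeff_monom)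
    have deg: "degree g \<le> N" by (rule degree_le) (simp add: cg)
    have v_eq: "v = Matrix.vec (N + 1) (coeff g)"
      using v(1) by (intro eq_vecI) (auto simp: cg)
    have "g \<noteq> 0"
    proof
      assume "g = 0"
      then have "v = 0\<^sub>v (N + 1)" unfolding v_eq by (intro eq_vecI) auto
      then show False using v(2) by blast
    qed
    moreover have "poly g z = 0" using entry[OF _ v_eq deg, of 0] unfolding v(3) by simp
    moreover have "moment c x S (monom 1 i * g) = 0" if "i < N" for i
      using entry[OF _ v_eq deg, of "Suc i"] that unfolding v(3) by simp
    ultimately show "\<exists>g. g \<noteq> 0 \<and> degree g \<le> N \<and> poly g z = 0 \<and> (\<forall>i<N. moment c x S (monom 1 i * g) = 0)"
      using deg by blast
  next
    assume "\<exists>g. g \<noteq> 0 \<and> degree g \<le> N \<and> poly g z = 0 \<and> (\<forall>i<N. moment c x S (monom 1 i * g) = 0)"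
    then obtain g where g: "g \<noteq> 0" "degree g \<le> N" "poly g z = 0"
      "\<And>i. i < N \<Longrightarrow> moment c x S (monom 1 i * g) = 0" by blast
    define v where "v = Matrix.vec (N + 1) (coeff g)"
    have "v \<noteq> 0\<^sub>v (N + 1)"
    proof
      assume "v = 0\<^sub>v (N + 1)"
      then have "vec_index v (degree g) = 0" using g(2) by simp
      then show False using g(1,2) by (simp add: v_def)
    qed
    moreover have "?A *\<^sub>v v = 0\<^sub>v (N + 1)"
    proof (rule eq_vecI)
      fix i assume "i < dim_vec (0\<^sub>v (N + 1) :: real Matrix.vec)"
      then have i: "i < N + 1" by simp
      show "vec_index (?A *\<^sub>v v) i = vec_index (0\<^sub>v (N + 1)) i"
        using entry[OF i v_def g(2)] g(3) g(4)[of "i - 1"] i by simp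
    qed simp
    ultimately show "\<exists>v. v \<in> carrier_vec (N + 1) \<and> v \<noteq> 0\<^sub>v (N + 1) \<and> ?A *\<^sub>v v = 0\<^sub>v (N + 1)"
      by (intro exI[of _ v]) (simp add: v_def)
  qed
  finally show ?thesis .
qed

lemma moment_orthogonalI:
  assumes "\<And>i. i < N \<Longrightarrow> moment c x S (monom 1 i * g) = 0" and f: "degree f < N"
  shows "moment c x S (f * g) = 0"
proof -
  have "f * g = (\<Sum>i\<le>degree f. smult (coeff f i) (monom 1 i * g))"
    by (subst (1) poly_as_sum_of_monoms[of f, symmetric])
       (simp add: sum_distrib_right smult_monom flip: mult_smult_left)
  then have "moment c x S (f * g) = (\<Sum>i\<le>degree f. coeff f i * moment c x S (monom 1 i * g))"
    unfolding moment_def poly_sum sum_distrib_left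
    by (subst sum.swap) (simp add: poly_sum sum_distrib_left mult_ac)
  also have "\<dots> = 0" using assms by (intro sum.neutral) auto
  finally show ?thesis .
qed

text \<open>The first \<open>N\<close> masses are the amplitudes; the last one carries the noise and will be divided by them.\<close>
locale perturbed_measure =
  fixes N :: nat and x c :: "nat \<Rightarrow> real"
  assumes N: "1 \<le> N" and inj: "inj_on x {1..N + 1}" and c_nz: "\<And>n. n \<in> {1..N} \<Longrightarrow> c n \<noteq> 0"
begin

abbreviation "mu \<equiv> moment c x {1..N + 1}"

definition basis_value :: "nat \<Rightarrow> real" where
  "basis_value k = poly (lagrange_poly x {1..N} k) (x (N + 1))"

text \<open>Expanding the Prony determinant over the \<open>N\<close>-element subsets of the \<open>N + 1\<close> nodes and
normalising the term of \<open>{1..N}\<close> gives this polynomial.\<close>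
definition perturbed_prony :: "real poly" where
  "perturbed_prony = node_poly x {1..N} +
     (\<Sum>k\<in>{1..N}. smult (c (N + 1) / c k * (basis_value k)\<^sup>2) (node_poly x ({1..N + 1} - {k})))"

lemma injN: "inj_on x {1..N}" using inj by (rule inj_on_subset) auto

lemma node_neq: "i \<in> {1..N+1} \<Longrightarrow> j \<in> {1..N+1} \<Longrightarrow> i \<noteq> j \<Longrightarrow> x i - x j \<noteq> 0"
  using inj by (auto simp: inj_on_def)

lemma insert_node: "k \<in> {1..N} \<Longrightarrow> {1..N + 1} - {k} = insert (N + 1) ({1..N} - {k})"
  by auto

lemma degree_perturbed_prony: "degree perturbed_prony \<le> N"
  unfolding perturbed_prony_def
proof (intro degree_add_le degree_sum_le)
  show "degree (node_poly x {1..N}) \<le> N" using degree_node_poly_le[of "{1..N}" x] by simp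
  fix k assume "k \<in> {1..N}"
  then show "degree (smult (c (N + 1) / c k * (basis_value k)\<^sup>2) (node_poly x ({1..N + 1} - {k}))) \<le> N"
    using degree_node_poly_le[of "{1..N + 1} - {k}" x]
    by (intro order_trans[OF degree_smult_le]) simp
qed simp

lemma basis_value_eq: "basis_value k = (\<Prod>j\<in>{1..N} - {k}. (x (N + 1) - x j) / (x k - x j))"
  by (simp add: basis_value_def poly_lagrange_poly)

lemma basis_value_times: 
  assumes k: "k \<in> {1..N}"
  shows "basis_value k * (\<Prod>j\<in>{1..N + 1} - {k}. x k - x j) = - (\<Prod>j\<in>{1..N}. x (N + 1) - x j)"
proof -
  have nz: "(\<Prod>j\<in>{1..N} - {k}. x k - x j) \<noteq> 0"
    using node_neq[of k] k by auto
  have "basis_value k * (\<Prod>j\<in>{1..N + 1} - {k}. x k - x j)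
      = (\<Prod>j\<in>{1..N} - {k}. x (N + 1) - x j) * (x k - x (N + 1))"
    unfolding insert_node[OF k] using nz by (simp add: basis_value_eq prod_dividef)
  also have "\<dots> = - ((x (N + 1) - x k) * (\<Prod>j\<in>{1..N} - {k}. x (N + 1) - x j))"
    by (simp add: algebra_simps)
  also have "(x (N + 1) - x k) * (\<Prod>j\<in>{1..N} - {k}. x (N + 1) - x j) = (\<Prod>j\<in>{1..N}. x (N + 1) - x j)"
    using k by (intro prod.remove[symmetric]) auto
  finally show ?thesis .
qed

lemma poly_perturbed_prony_last: "poly perturbed_prony (x (N + 1)) = (\<Prod>j\<in>{1..N}. x (N + 1) - x j)"
proof -
  have "poly (node_poly x ({1..N + 1} - {k})) (x (N + 1)) = 0" if "k \<in> {1..N}" for k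
    unfolding poly_node_poly insert_node[OF that] by simp
  then have "(\<Sum>k\<in>{1..N}. c (N + 1) / c k * (basis_value k)\<^sup>2 * poly (node_poly x ({1..N + 1} - {k})) (x (N + 1))) = 0"
    by (intro sum.neutral) simp
  then show ?thesis unfolding perturbed_prony_def poly_add poly_sum poly_smult poly_node_poly by linarith
qed

lemma perturbed_prony_last_nz: "poly perturbed_prony (x (N + 1)) \<noteq> 0"
  unfolding poly_perturbed_prony_last using node_neq by auto

lemma perturbed_prony_nz: "perturbed_prony \<noteq> 0" using perturbed_prony_last_nz by auto

text \<open>At a node only one summand survives, and the squared basis value is exactly what is needed for
\<open>c\<^sub>k\<close> times the value to be a multiple of \<open>L\<^sub>k(x\<^sub>N\<^sub>+\<^sub>1)\<close>.\<close>
lemma poly_perturbed_prony_node: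
  assumes k: "k \<in> {1..N}"
  shows "c k * poly perturbed_prony (x k) = - (c (N + 1) * basis_value k * poly perturbed_prony (x (N + 1)))"
proof -
  have z: "poly (node_poly x ({1..N + 1} - {i})) (x k)
      = (if i = k then \<Prod>j\<in>{1..N + 1} - {k}. x k - x j else 0)" for i
    using k by (auto simp: poly_node_poly)
  have z0: "poly (node_poly x {1..N}) (x k) = 0" using k by (auto simp: poly_node_poly)
  have "poly perturbed_prony (x k) = (\<Sum>i\<in>{1..N}. if i = k
        then c (N + 1) / c i * (basis_value i)\<^sup>2 * (\<Prod>j\<in>{1..N + 1} - {k}. x k - x j) else 0)"
    unfolding perturbed_prony_def poly_add poly_sum poly_smult z z0 by (simp add: if_distrib cong: if_cong)
  also have "\<dots> = c (N + 1) / c k * (basis_value k)\<^sup>2 * (\<Prod>j\<in>{1..N + 1} - {k}. x k - x j)"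
    using k by (subst sum.delta) auto
  also have "\<dots> = c (N + 1) / c k * basis_value k * (basis_value k * (\<Prod>j\<in>{1..N + 1} - {k}. x k - x j))"
    by (simp add: power2_eq_square)
  also have "\<dots> = - (c (N + 1) / c k * basis_value k * poly perturbed_prony (x (N + 1)))"
    unfolding basis_value_times[OF k] poly_perturbed_prony_last by simp
  finally show ?thesis using c_nz[OF k] by simp
qed

lemma moment_split: "mu f = (\<Sum>k\<in>{1..N}. c k * poly f (x k)) + c (N + 1) * poly f (x (N + 1))"
  by (simp add: moment_def)

text \<open>By the values at the nodes, the claim is Lagrange interpolation of \<open>f\<close> at the last node.\<close>
lemma perturbed_prony_orthogonal:
  assumes "degree f < N" shows "mu (f * perturbed_prony) = 0"
proof -
  have "(\<Sum>k\<in>{1..N}. c k * poly (f * perturbed_prony) (x k))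
      = (\<Sum>k\<in>{1..N}. - (c (N + 1) * poly perturbed_prony (x (N + 1))) * (poly f (x k) * basis_value k))"
  proof (rule sum.cong)
    fix k assume "k \<in> {1..N}"
    have "c k * poly (f * perturbed_prony) (x k) = (c k * poly perturbed_prony (x k)) * poly f (x k)" by simp
    also have "\<dots> = - (c (N + 1) * poly perturbed_prony (x (N + 1))) * (poly f (x k) * basis_value k)"
      unfolding poly_perturbed_prony_node[OF \<open>k \<in> {1..N}\<close>] by simp
    finally show "c k * poly (f * perturbed_prony) (x k) = - (c (N + 1) * poly perturbed_prony (x (N + 1))) * (poly f (x k) * basis_value k)" .
  qed simp
  also have "\<dots> = - (c (N + 1) * poly perturbed_prony (x (N + 1))) * poly f (x (N + 1))"
    unfolding sum_distrib_left[symmetric] basis_value_def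
    using lagrange_interpolation[OF _ injN, of f] assms by simp
  finally show ?thesis unfolding moment_split by simp
qed

text \<open>The combination of the two polynomials that vanishes at the last node is orthogonal to the Lagrange basis
of the other nodes, hence vanishes there as well.\<close>
lemma orthogonal_unique:
  assumes g: "degree g \<le> N" and orth: "\<And>f. degree f < N \<Longrightarrow> mu (f * g) = 0"
  shows "smult (poly perturbed_prony (x (N + 1))) g = smult (poly g (x (N + 1))) perturbed_prony"
proof -
  define h where "h = smult (poly perturbed_prony (x (N + 1))) g - smult (poly g (x (N + 1))) perturbed_prony"
  have h_last: "poly h (x (N + 1)) = 0" by (simp add: h_def)
  have h_node: "poly h (x k) = 0" if k: "k \<in> {1..N}" for k
  proof -
    let ?l = "lagrange_poly x {1..N} k"
    have deg: "degree ?l < N" using degree_lagrange_poly_less[of "{1..N}" k x] k by simp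
    have "?l * h = smult (poly perturbed_prony (x (N + 1))) (?l * g) - smult (poly g (x (N + 1))) (?l * perturbed_prony)"
      by (simp add: h_def algebra_simps)
    then have "mu (?l * h) = poly perturbed_prony (x (N + 1)) * mu (?l * g) - poly g (x (N + 1)) * mu (?l * perturbed_prony)"
      by (simp only: moment_diff_smult)
    also have "\<dots> = 0" using orth[OF deg] perturbed_prony_orthogonal[OF deg] by simp
    finally have "(\<Sum>i\<in>{1..N}. c i * poly (?l * h) (x i)) = 0"
      unfolding moment_split using h_last by simp
    moreover have "c i * poly (?l * h) (x i) = (if k = i then c i * poly h (x i) else 0)"
      if "i \<in> {1..N}" for i
      using poly_lagrange_poly_node[OF _ injN k that] by simp
    then have "(\<Sum>i\<in>{1..N}. c i * poly (?l * h) (x i))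
        = (\<Sum>i\<in>{1..N}. if k = i then c i * poly h (x i) else 0)"
      by (rule sum.cong[OF refl])
    ultimately have "(\<Sum>i\<in>{1..N}. if k = i then c i * poly h (x i) else 0) = 0" by simp
    then show ?thesis using k c_nz[OF k] by (simp add: sum.delta')
  qed
  have "h = 0"
  proof (rule poly_eqI_degree)
    have "card (x ` {1..N + 1}) = N + 1" using inj by (simp add: card_image)
    moreover have "degree h \<le> N" unfolding h_def
      by (intro degree_diff_le order_trans[OF degree_smult_le] g degree_perturbed_prony)
    ultimately show "card (x ` {1..N + 1}) > degree h" "card (x ` {1..N + 1}) > degree (0 :: real poly)"
      by simp_all
    fix t assume "t \<in> x ` {1..N + 1}"
    then obtain k where "k \<in> {1..N+1}" "t = x k" by blast
    then show "poly h t = poly 0 t" using h_last h_node[of k] by (cases "k = N + 1") auto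
  qed
  then show ?thesis by (simp add: h_def)
qed

lemma prony_poly_root_iff:
  assumes m: "\<And>k. m k = (\<Sum>n\<in>{1..N+1}. c n * x n ^ k)"
  shows "prony_poly N m z = 0 \<longleftrightarrow> poly perturbed_prony z = 0"
proof
  assume "prony_poly N m z = 0"
  then obtain g where g: "g \<noteq> 0" "degree g \<le> N" "poly g z = 0"
    "\<And>i. i < N \<Longrightarrow> mu (monom 1 i * g) = 0"
    using prony_poly_eq_0_iff[of m c x "{1..N + 1}" N z, OF m] by blast
  have eq: "smult (poly perturbed_prony (x (N + 1))) g = smult (poly g (x (N + 1))) perturbed_prony"
    by (intro orthogonal_unique g(2) moment_orthogonalI[OF g(4)])
  have "poly g (x (N + 1)) \<noteq> 0"
  proof
    assume "poly g (x (N + 1)) = 0"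
    then have "smult (poly perturbed_prony (x (N + 1))) g = 0" using eq by simp
    then show False using g(1) perturbed_prony_last_nz by simp
  qed
  moreover have "poly (smult (poly g (x (N + 1))) perturbed_prony) z = 0"
    unfolding eq[symmetric] using g(3) by simp
  ultimately show "poly perturbed_prony z = 0" by simp
next
  assume "poly perturbed_prony z = 0"
  then show "prony_poly N m z = 0"
    unfolding prony_poly_eq_0_iff[of m c x "{1..N + 1}" N z, OF m]
    using perturbed_prony_nz degree_perturbed_prony perturbed_prony_orthogonal
    by (intro exI[of _ perturbed_prony]) (auto simp: degree_monom_eq)
qed

lemma vandermonde_extend:
  assumes V: "\<And>k. k < N \<Longrightarrow> (\<Sum>n\<in>{1..N}. yh n * z n ^ k) = (\<Sum>n\<in>{1..N+1}. c n * x n ^ k)"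
    and f: "degree f < N"
  shows "(\<Sum>n\<in>{1..N}. yh n * poly f (z n)) = mu f"
proof -
  have "(\<Sum>j\<le>N-1. coeff f j * (\<Sum>n\<in>{1..N}. yh n * z n ^ (0 + j))) = moment yh z {1..N} (monom 1 0 * f)"
    using f by (intro moment_eq_sum_coeff) simp
  moreover have "(\<Sum>j\<le>N-1. coeff f j * (\<Sum>n\<in>{1..N+1}. c n * x n ^ (0 + j))) = mu (monom 1 0 * f)"
    using f by (intro moment_eq_sum_coeff) simp
  moreover have "(\<Sum>j\<le>N-1. coeff f j * (\<Sum>n\<in>{1..N}. yh n * z n ^ (0 + j)))
      = (\<Sum>j\<le>N-1. coeff f j * (\<Sum>n\<in>{1..N+1}. c n * x n ^ (0 + j)))"
    using V N by (intro sum.cong refl) simp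
  ultimately show ?thesis by (simp add: moment_def monom_eq_1)
qed

text \<open>Division by the orthogonal polynomial leaves a remainder of degree below \<open>N\<close>, on which the rule is
exact by the Vandermonde system; the multiple of the orthogonal polynomial contributes zero on both sides.\<close>
lemma gauss_quadrature:
  assumes V: "\<And>k. k < N \<Longrightarrow> (\<Sum>n\<in>{1..N}. yh n * z n ^ k) = (\<Sum>n\<in>{1..N+1}. c n * x n ^ k)"
    and z: "inj_on z {1..N}" "\<And>n. n \<in> {1..N} \<Longrightarrow> poly perturbed_prony (z n) = 0"
    and f: "degree f < 2 * N"
  shows "(\<Sum>n\<in>{1..N}. yh n * poly f (z n)) = mu f"
proof -
  have "N = card (z ` {1..N})" using z(1) by (simp add: card_image)
  also have "\<dots> \<le> card {t. poly perturbed_prony t = 0}"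
    using z(2) perturbed_prony_nz by (intro card_mono poly_roots_finite) auto
  also have "\<dots> \<le> degree perturbed_prony" by (rule card_poly_roots_bound[OF perturbed_prony_nz])
  finally have deg_Q: "degree perturbed_prony = N" using degree_perturbed_prony by simp
  define r where "r = f mod perturbed_prony"
  define s where "s = f div perturbed_prony"
  have f_eq: "f = s * perturbed_prony + r" by (simp add: s_def r_def)
  have r: "degree r < N"
    using degree_mod_less[OF perturbed_prony_nz, of f] N deg_Q unfolding r_def by auto
  have s: "degree s < N"
  proof (cases "s = 0")
    case False
    have "degree s + N = degree (f - r)" using False perturbed_prony_nz f_eq deg_Q by (simp add: degree_mult_eq)
    also have "\<dots> < 2 * N" using f r by (intro degree_diff_less) auto
    finally show ?thesis by simp
  qed (use N in simp)
  have "(\<Sum>n\<in>{1..N}. yh n * poly f (z n)) = (\<Sum>n\<in>{1..N}. yh n * poly r (z n))"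
    unfolding f_eq using z(2) by (intro sum.cong) auto
  also have "\<dots> = mu r" by (rule vandermonde_extend[OF V r])
  also have "\<dots> = mu f"
    using perturbed_prony_orthogonal[OF s] unfolding f_eq
    by (simp add: moment_def sum.distrib algebra_simps del: sum.cl_ivl_Suc)
  finally show ?thesis .
qed

text \<open>The test polynomial vanishes at all \<open>z\<^sub>k\<close> and all \<open>x\<^sub>k\<close> with \<open>k \<noteq> n\<close>, equals 1 at \<open>z\<^sub>n\<close>, and has the largest degree
\<open>2 N - 1\<close> for which the quadrature rule is exact.\<close>
lemma amplitude_formula:
  assumes V: "\<And>k. k < N \<Longrightarrow> (\<Sum>n\<in>{1..N}. yh n * z n ^ k) = (\<Sum>n\<in>{1..N+1}. c n * x n ^ k)"
    and z: "inj_on z {1..N}" "\<And>n. n \<in> {1..N} \<Longrightarrow> poly perturbed_prony (z n) = 0"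
    and n: "n \<in> {1..N}" and sep: "\<And>k. k \<in> {1..N + 1} - {n} \<Longrightarrow> z n \<noteq> x k"
  shows "yh n = c n * (\<Prod>k\<in>{1..N} - {n}. (x n - z k) / (z n - z k)) *
    (\<Prod>k\<in>{1..N + 1} - {n}. (x n - x k) / (z n - x k))"
proof -
  define d where "d = (\<Prod>k\<in>{1..N + 1} - {n}. z n - x k)"
  have d: "d \<noteq> 0" using sep by (auto simp: d_def)
  define g where "g = smult (1 / d) (node_poly x ({1..N + 1} - {n}))"
  have poly_g: "poly g t = (\<Prod>k\<in>{1..N + 1} - {n}. (t - x k) / (z n - x k))" for t
    by (simp add: g_def d_def poly_node_poly prod_dividef)
  define f where "f = lagrange_poly z {1..N} n * g"
  have "degree g \<le> N" unfolding g_def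
    using degree_node_poly_le[of "{1..N + 1} - {n}" x] n by (intro order_trans[OF degree_smult_le]) simp
  then have deg_f: "degree f < 2 * N"
    using degree_mult_le[of "lagrange_poly z {1..N} n" g] degree_lagrange_poly_less[of "{1..N}" n z] n
    unfolding f_def by simp
  have "(\<Sum>k\<in>{1..N}. yh k * poly f (z k)) = mu f"
    by (rule gauss_quadrature[OF V z deg_f])
  moreover have "(\<Sum>k\<in>{1..N}. yh k * poly f (z k)) = yh n"
  proof -
    have "poly g (z n) = 1" using d by (simp add: g_def poly_node_poly d_def)
    then have "yh k * poly f (z k) = (if k = n then yh k else 0)" if "k \<in> {1..N}" for k
      using poly_lagrange_poly_node[OF _ z(1) n that] by (simp add: f_def)
    then have "(\<Sum>k\<in>{1..N}. yh k * poly f (z k)) = (\<Sum>k\<in>{1..N}. if k = n then yh k else 0)"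
      by (rule sum.cong[OF refl])
    then show ?thesis using n by simp
  qed
  moreover have "mu f = c n * poly f (x n)"
  proof -
    have "poly g (x k) = 0" if "k \<in> {1..N + 1} - {n}" for k
      unfolding poly_g using that by (intro prod_zero) auto
    then have "c k * poly f (x k) = (if k = n then c k * poly f (x k) else 0)" if "k \<in> {1..N + 1}" for k
      using that by (simp add: f_def)
    then have "mu f = (\<Sum>k\<in>{1..N + 1}. if k = n then c k * poly f (x k) else 0)"
      unfolding moment_def by (rule sum.cong[OF refl])
    also have "\<dots> = c n * poly f (x n)" using n by (subst sum.delta) auto
    finally show ?thesis .
  qed
  ultimately show ?thesis by (simp add: f_def poly_lagrange_poly poly_g mult.assoc)
qed

text \<open>The \<open>n\<close>-th unknown is the integral of the \<open>n\<close>-th Lagrange basis polynomial of the points \<open>z\<close>.\<close>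
lemma vandermonde_solvable:
  assumes z: "inj_on z {1..N}"
  obtains yh where "\<And>k. k < N \<Longrightarrow> (\<Sum>n\<in>{1..N}. yh n * z n ^ k) = (\<Sum>n\<in>{1..N+1}. c n * x n ^ k)"
proof
  fix k assume k: "k < N"
  have "(\<Sum>n\<in>{1..N}. mu (lagrange_poly z {1..N} n) * z n ^ k)
      = (\<Sum>j\<in>{1..N+1}. c j * (\<Sum>n\<in>{1..N}. poly (monom 1 k) (z n) * poly (lagrange_poly z {1..N} n) (x j)))"
    unfolding moment_def sum_distrib_right sum_distrib_left poly_monom
    by (subst sum.swap) (simp add: mult_ac del: sum.cl_ivl_Suc)
  also have "\<dots> = (\<Sum>j\<in>{1..N+1}. c j * x j ^ k)"
    using lagrange_interpolation[OF _ z, of "monom 1 k"] k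
    by (intro sum.cong refl) (simp add: degree_monom_eq poly_monom)
  finally show "(\<Sum>n\<in>{1..N}. mu (lagrange_poly z {1..N} n) * z n ^ k) = (\<Sum>j\<in>{1..N+1}. c j * x j ^ k)" .
qed

end

section \<open>Displacement of the nodes and of the amplitudes\<close>

lemma abs_prod_minus_1_le:
  fixes u :: "nat \<Rightarrow> real"
  assumes "finite A" "\<And>k. k \<in> A \<Longrightarrow> \<bar>u k\<bar> \<le> b"
  shows "\<bar>(\<Prod>k\<in>A. 1 + u k) - 1\<bar> \<le> exp (real (card A) * b) - 1"
proof -
  have "\<bar>(\<Prod>k\<in>A. 1 + u k) - 1\<bar> \<le> (\<Prod>k\<in>A. 1 + \<bar>u k\<bar>) - 1"
    using norm_prod_minus1_le_prod_minus1[of u A] by simp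
  also have "(\<Prod>k\<in>A. 1 + \<bar>u k\<bar>) \<le> (\<Prod>k\<in>A. exp b)"
  proof (intro prod_mono conjI)
    fix k assume "k \<in> A"
    then show "1 + \<bar>u k\<bar> \<le> exp b" using assms(2)[of k] exp_ge_add_one_self[of b] by linarith
  qed simp
  also have "(\<Prod>k\<in>A. exp b) = exp (real (card A) * b)" by (simp flip: exp_of_nat_mult)
  finally show ?thesis by simp
qed

lemma strictly_decreasing_enumeration_unique:
  fixes f g :: "nat \<Rightarrow> real"
  assumes f: "\<And>i j. \<lbrakk>i \<in> {1..N}; j \<in> {1..N}; i < j\<rbrakk> \<Longrightarrow> f j < f i"
    and g: "\<And>i j. \<lbrakk>i \<in> {1..N}; j \<in> {1..N}; i < j\<rbrakk> \<Longrightarrow> g j < g i"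
    and eq: "f ` {1..N} = g ` {1..N}" and n: "n \<in> {1..N}"
  shows "f n = g n"
proof -
  have inj: "inj_on h {1..N}" if "\<And>i j. \<lbrakk>i \<in> {1..N}; j \<in> {1..N}; i < j\<rbrakk> \<Longrightarrow> h j < h i"
    for h :: "nat \<Rightarrow> real"
    using that by (intro linorder_inj_onI) force+
  have rank: "card {t \<in> h ` {1..N}. h n < t} = n - 1"
    if h: "\<And>i j. \<lbrakk>i \<in> {1..N}; j \<in> {1..N}; i < j\<rbrakk> \<Longrightarrow> h j < h i" and n: "n \<in> {1..N}"
    for h :: "nat \<Rightarrow> real" and n
  proof -
    have "h n < h i \<longleftrightarrow> i < n" if "i \<in> {1..N}" for i
      using h[of i n] h[of n i] n that by (cases i n rule: linorder_cases) auto
    then have "{t \<in> h ` {1..N}. h n < t} = h ` {1..<n}" using n by auto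
    moreover have "inj_on h {1..N}" using h by (rule inj)
    then have "inj_on h {1..<n}" by (rule inj_on_subset) (use n in auto)
    ultimately show ?thesis by (simp add: card_image)
  qed
  have "f n \<in> g ` {1..N}" using eq n by blast
  then obtain k where k: "k \<in> {1..N}" "f n = g k" by auto
  have "card {t \<in> f ` {1..N}. f n < t} = n - 1" using f n by (rule rank)
  moreover have "card {t \<in> g ` {1..N}. g k < t} = k - 1" using g k(1) by (rule rank)
  ultimately have "n - 1 = k - 1" using eq k(2) by simp
  then have "n = k" using n k(1) by auto
  then show ?thesis using k(2) by simp
qed

text \<open>The radius of the interval in which the \<open>n\<close>-th zero is sought is \<open>\<rho>\<^sub>n x\<^sub>n\<close>.  It may depend on \<open>n\<close>
because, for a sampling step of order \<open>1 / N\<close>, the relative gaps between nodes are of order \<open>n / N\<close>: a radius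
uniform in \<open>n\<close> would have to be of order \<open>1 / N\<close> and would spoil the smallness condition for the last
weights, which do not decay with \<open>N\<close>.  Growth by at most a factor 2 lets \<open>\<rho>\<^sub>n\<close> be compared with its neighbours, and
\<open>e\<close> stands for \<open>\<epsilon>\<close> times the bound on the amplitude ratios.\<close>
locale separated_perturbation = perturbed_measure +
  fixes \<rho> :: "nat \<Rightarrow> real" and e :: real
  assumes x_pos: "\<And>n. n \<in> {1..N + 1} \<Longrightarrow> 0 < x n"
    and rho_pos: "\<And>n. 1 \<le> n \<Longrightarrow> 0 < \<rho> n"
    and rho_mono: "\<And>n. 1 \<le> n \<Longrightarrow> \<rho> n \<le> \<rho> (Suc n)"
    and rho_double: "\<And>n. 1 \<le> n \<Longrightarrow> \<rho> (Suc n) \<le> 2 * \<rho> n"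
    and rho_small: "\<And>n. n \<in> {1..N} \<Longrightarrow> \<rho> n \<le> 1 / 4"
    and gap: "\<And>n. n \<in> {1..N} \<Longrightarrow> x (Suc n) \<le> (1 - 4 * \<rho> n) * x n"
    and ratio: "\<And>k. k \<in> {1..N} \<Longrightarrow> \<bar>c (N + 1) / c k\<bar> \<le> e"
    and small: "e * (\<Sum>k\<in>{1..N}. (basis_value k)\<^sup>2 / \<rho> k) \<le> 1 / 4"
begin

lemma e_nonneg: "0 \<le> e" using order_trans[OF abs_ge_zero ratio[of 1]] N by simp

lemma rho_le:
  assumes "1 \<le> i" "i \<le> j" shows "\<rho> i \<le> \<rho> j"
  using assms(2,1) by (induction j rule: dec_induct) (auto intro!: order_trans[OF _ rho_mono])

lemma x_antimono:
  assumes "1 \<le> i" "i \<le> j" "j \<le> N + 1" shows "x j \<le> x i"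
  using assms(2,1,3)
proof (induction j rule: dec_induct)
  case (step j)
  have "x (Suc j) \<le> (1 - 4 * \<rho> j) * x j" using gap[of j] step by simp
  also have "\<dots> \<le> 1 * x j"
    using rho_pos[of j] x_pos[of j] step by (intro mult_right_mono) auto
  finally show ?case using step by simp
qed simp

lemma x_gap:
  assumes "1 \<le> i" "i < j" "j \<le> N + 1"
  shows "x j \<le> (1 - 4 * \<rho> (j - 1)) * x i"
proof -
  obtain m where m: "j = Suc m" using assms by (cases j) auto
  have "x j \<le> (1 - 4 * \<rho> (j - 1)) * x (j - 1)" using gap[of m] assms m by simp
  also have "\<dots> \<le> (1 - 4 * \<rho> (j - 1)) * x i"
    using rho_small[of m] x_antimono[of i m] assms m by (intro mult_left_mono) auto
  finally show ?thesis .
qed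

text \<open>The distance from the interval around \<open>x\<^sub>n\<close> to another node \<open>x\<^sub>k\<close> is measured by the radius at \<open>k\<close>, but in units of \<open>x\<^sub>n\<close>;
this is what makes the sum in the smallness condition independent of \<open>n\<close>.\<close>
lemma near_node_separation:
  assumes n: "n \<in> {1..N}" and k: "k \<in> {1..N + 1}" "k \<noteq> n" and z: "\<bar>z - x n\<bar> \<le> \<rho> n * x n"
  shows "\<rho> k * x n \<le> \<bar>z - x k\<bar>"
proof (cases "n < k")
  case True
  then have "x k \<le> (1 - 4 * \<rho> (k - 1)) * x n" using x_gap[of n k] n k by simp
  moreover have "\<rho> n * x n \<le> \<rho> (k - 1) * x n"
    using rho_le[of n "k - 1"] True n x_pos[of n] by (intro mult_right_mono) auto
  moreover have "\<rho> k * x n \<le> (2 * \<rho> (k - 1)) * x n"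
    using rho_double[of "k - 1"] True n x_pos[of n] by (intro mult_right_mono) auto
  moreover have "0 \<le> \<rho> (k - 1) * x n"
    using True n less_imp_le[OF x_pos[of n]] by (intro mult_nonneg_nonneg less_imp_le[OF rho_pos]) auto
  ultimately show ?thesis using z by (simp add: algebra_simps abs_le_iff)
next
  case False
  then have kn: "k < n" using k by simp
  then have "x n \<le> (1 - 4 * \<rho> (n - 1)) * x k" using x_gap[of k n] n k by simp
  moreover have "4 * (\<rho> (n - 1) * x n) \<le> 4 * (\<rho> (n - 1) * x k)"
    using x_antimono[of k n] kn n k by (intro mult_left_mono less_imp_le[OF rho_pos]) auto
  moreover have "\<rho> n * x n \<le> (2 * \<rho> (n - 1)) * x n"
    using rho_double[of "n - 1"] kn n k x_pos[of n] by (intro mult_right_mono) auto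
  moreover have "\<rho> k * x n \<le> \<rho> n * x n"
    using rho_le[of k n] kn n k x_pos[of n] by (intro mult_right_mono) auto
  ultimately show ?thesis using z by (simp add: algebra_simps abs_le_iff)
qed

lemma near_node_last:
  assumes n: "n \<in> {1..N}" and z: "\<bar>z - x n\<bar> \<le> \<rho> n * x n"
  shows "0 \<le> z - x (N + 1)" "z - x (N + 1) \<le> 2 * x n"
proof -
  have "\<rho> n * x n \<le> 1 / 4 * x n" using rho_small[OF n] x_pos[of n] n by (intro mult_right_mono) auto
  moreover have "z - x n \<le> \<rho> n * x n" "0 < x (N + 1)" "0 < x n" using z x_pos n by auto
  ultimately show "z - x (N + 1) \<le> 2 * x n" by linarith
  have "x (N + 1) \<le> x (Suc n)" using x_antimono[of "Suc n" "N + 1"] n by simp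
  also have "\<dots> \<le> (1 - 4 * \<rho> n) * x n" by (rule gap[OF n])
  finally show "0 \<le> z - x (N + 1)"
    using z mult_pos_pos[OF rho_pos[of n] x_pos[of n]] n by (simp add: algebra_simps abs_le_iff)
qed

text \<open>Division of the perturbed Prony polynomial by the factors \<open>z - x\<^sub>k\<close> with \<open>k \<noteq> n\<close>, \<open>k \<le> N\<close>, leaves
\<open>near_factor n\<close>, a perturbation of \<open>z - x\<^sub>n\<close>; \<open>far_sum n\<close> collects the influence of the other nodes.\<close>
definition noise_coeff where "noise_coeff k = c (N + 1) / c k * (basis_value k)\<^sup>2"
definition far_sum where "far_sum n z = (\<Sum>k\<in>{1..N} - {n}. noise_coeff k * (z - x (N + 1)) / (z - x k))"
definition near_factor where "near_factor n z = (z - x n) * (1 + far_sum n z) + noise_coeff n * (z - x (N + 1))"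

lemma noise_coeff_bound: "k \<in> {1..N} \<Longrightarrow> \<bar>noise_coeff k\<bar> \<le> e * (basis_value k)\<^sup>2"
  unfolding noise_coeff_def abs_mult using ratio by (intro mult_mono) (auto simp: e_nonneg)

lemma poly_perturbed_prony_factor:
  assumes n: "n \<in> {1..N}" and nz: "\<And>k. k \<in> {1..N} - {n} \<Longrightarrow> z \<noteq> x k"
  shows "poly perturbed_prony z = (\<Prod>j\<in>{1..N} - {n}. z - x j) * near_factor n z"
proof -
  let ?P = "\<Prod>j\<in>{1..N} - {n}. z - x j"
  have 1: "(\<Prod>j\<in>{1..N}. z - x j) = (z - x n) * ?P"
    using n by (intro prod.remove) auto
  have drop: "(\<Prod>j\<in>{1..N + 1} - {k}. z - x j) = (z - x (N + 1)) * (\<Prod>j\<in>{1..N} - {k}. z - x j)"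
    if "k \<in> {1..N}" for k
    unfolding insert_node[OF that] by simp
  have 2: "(\<Prod>j\<in>{1..N} - {k}. z - x j) = (z - x n) * ?P / (z - x k)" if k: "k \<in> {1..N} - {n}" for k
  proof -
    have "(\<Prod>j\<in>{1..N}. z - x j) = (z - x k) * (\<Prod>j\<in>{1..N} - {k}. z - x j)"
      using k by (intro prod.remove) auto
    then show ?thesis using nz[OF k] unfolding 1 by (simp add: field_simps)
  qed
  have "poly perturbed_prony z = (z - x n) * ?P + (\<Sum>k\<in>{1..N}. noise_coeff k * (\<Prod>j\<in>{1..N + 1} - {k}. z - x j))"
    by (simp only: perturbed_prony_def poly_add poly_sum poly_smult poly_node_poly 1 noise_coeff_def)
  also have "(\<Sum>k\<in>{1..N}. noise_coeff k * (\<Prod>j\<in>{1..N + 1} - {k}. z - x j))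
      = noise_coeff n * (\<Prod>j\<in>{1..N + 1} - {n}. z - x j) + (\<Sum>k\<in>{1..N} - {n}. noise_coeff k * (\<Prod>j\<in>{1..N + 1} - {k}. z - x j))"
    using n by (intro sum.remove) auto
  also have "(\<Sum>k\<in>{1..N} - {n}. noise_coeff k * (\<Prod>j\<in>{1..N + 1} - {k}. z - x j)) = (z - x n) * ?P * far_sum n z"
    unfolding far_sum_def sum_distrib_left
  proof (rule sum.cong)
    fix k assume k: "k \<in> {1..N} - {n}"
    then have "k \<in> {1..N}" by simp
    from drop[OF this] 2[OF k]
    show "noise_coeff k * (\<Prod>j\<in>{1..N + 1} - {k}. z - x j) = (z - x n) * ?P * (noise_coeff k * (z - x (N + 1)) / (z - x k))"
      by simp
  qed simp
  also have "(z - x n) * ?P + (noise_coeff n * (\<Prod>j\<in>{1..N + 1} - {n}. z - x j) + (z - x n) * ?P * far_sum n z) = ?P * near_factor n z"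
    unfolding drop[OF n] near_factor_def by (simp add: algebra_simps)
  finally show ?thesis .
qed

lemma near_node_neq:
  assumes "n \<in> {1..N}" "k \<in> {1..N + 1}" "k \<noteq> n" "\<bar>z - x n\<bar> \<le> \<rho> n * x n"
  shows "z \<noteq> x k"
proof -
  have "0 < \<rho> k * x n" using rho_pos[of k] x_pos[of n] assms by (intro mult_pos_pos) auto
  then show ?thesis using near_node_separation[OF assms] by auto
qed

lemma far_sum_bound:
  assumes n: "n \<in> {1..N}" and z: "\<bar>z - x n\<bar> \<le> \<rho> n * x n"
  shows "\<bar>far_sum n z\<bar> \<le> 1 / 2"
proof -
  have xn: "x n > 0" using x_pos n by simp
  have "\<bar>far_sum n z\<bar> \<le> (\<Sum>k\<in>{1..N} - {n}. 2 * e * ((basis_value k)\<^sup>2 / \<rho> k))"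
    unfolding far_sum_def
  proof (rule order_trans[OF sum_abs], rule sum_mono)
    fix k assume k: "k \<in> {1..N} - {n}"
    have sep: "\<rho> k * x n \<le> \<bar>z - x k\<bar>" using near_node_separation[OF n _ _ z, of k] k by simp
    have pos: "0 < \<rho> k * x n" using rho_pos[of k] xn k by simp
    have "\<bar>noise_coeff k * (z - x (N + 1))\<bar> \<le> e * (basis_value k)\<^sup>2 * (2 * x n)"
      unfolding abs_mult using near_node_last[OF n z] noise_coeff_bound[of k] k e_nonneg
      by (intro mult_mono) auto
    then have "\<bar>noise_coeff k * (z - x (N + 1)) / (z - x k)\<bar> \<le> e * (basis_value k)\<^sup>2 * (2 * x n) / (\<rho> k * x n)"
      unfolding abs_divide using sep pos e_nonneg xn by (intro frac_le) auto
    also have "\<dots> = 2 * e * ((basis_value k)\<^sup>2 / \<rho> k)" using xn by (simp add: field_simps)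
    finally show "\<bar>noise_coeff k * (z - x (N + 1)) / (z - x k)\<bar> \<le> 2 * e * ((basis_value k)\<^sup>2 / \<rho> k)" .
  qed
  also have "\<dots> \<le> (\<Sum>k\<in>{1..N}. 2 * e * ((basis_value k)\<^sup>2 / \<rho> k))"
    using e_nonneg rho_pos by (intro sum_mono2) (auto intro!: mult_nonneg_nonneg divide_nonneg_pos)
  also have "\<dots> = 2 * (e * (\<Sum>k\<in>{1..N}. (basis_value k)\<^sup>2 / \<rho> k))" by (simp add: sum_distrib_left mult.assoc)
  also have "\<dots> \<le> 1 / 2" using small by simp
  finally show ?thesis .
qed

lemma weight_small:
  assumes n: "n \<in> {1..N}" shows "e * (basis_value n)\<^sup>2 \<le> \<rho> n / 4"
proof -
  have "(basis_value n)\<^sup>2 / \<rho> n \<le> (\<Sum>k\<in>{1..N}. (basis_value k)\<^sup>2 / \<rho> k)"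
    using n rho_pos by (intro member_le_sum) (auto intro!: divide_nonneg_pos)
  then have "e * ((basis_value n)\<^sup>2 / \<rho> n) \<le> e * (\<Sum>k\<in>{1..N}. (basis_value k)\<^sup>2 / \<rho> k)"
    using e_nonneg by (rule mult_left_mono)
  with small have "e * ((basis_value n)\<^sup>2 / \<rho> n) \<le> 1 / 4" by linarith
  then show ?thesis using rho_pos[of n] n by (simp add: field_simps)
qed

lemma perturbation_term_bound:
  assumes n: "n \<in> {1..N}" and z: "\<bar>z - x n\<bar> \<le> \<rho> n * x n"
  shows "\<bar>noise_coeff n * (z - x (N + 1))\<bar> \<le> 2 * e * (basis_value n)\<^sup>2 * x n"
proof -
  have "\<bar>noise_coeff n * (z - x (N + 1))\<bar> \<le> e * (basis_value n)\<^sup>2 * (2 * x n)"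
    unfolding abs_mult using near_node_last[OF n z] noise_coeff_bound[OF n] e_nonneg by (intro mult_mono) auto
  then show ?thesis by simp
qed

text \<open>At both ends of the interval the leading part of \<open>near_factor n\<close> has modulus at least half the radius
and opposite signs, and the remaining term is at most half the radius.\<close>
lemma root_near_node:
  assumes n: "n \<in> {1..N}"
  obtains z where "poly perturbed_prony z = 0" "\<bar>z - x n\<bar> \<le> \<rho> n * x n"
proof -
  define r where "r = \<rho> n * x n"
  have r: "0 < r" unfolding r_def using rho_pos[of n] x_pos[of n] n by simp
  have near: "\<bar>z - x n\<bar> \<le> \<rho> n * x n" if "z \<in> {x n - r..x n + r}" for z
    using that by (auto simp: r_def abs_le_iff)
  have cont: "continuous_on {x n - r..x n + r} (near_factor n)"
    unfolding near_factor_def far_sum_def using near_node_neq[OF n _ _ near]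
    by (intro continuous_intros) auto
  have b: "\<bar>noise_coeff n * (z - x (N + 1))\<bar> \<le> r / 2" if "\<bar>z - x n\<bar> \<le> \<rho> n * x n" for z
  proof -
    have "2 * (e * (basis_value n)\<^sup>2) * x n \<le> 2 * (\<rho> n / 4) * x n"
      using weight_small[OF n] x_pos[of n] n by (intro mult_right_mono) auto
    with perturbation_term_bound[OF n that] show ?thesis by (simp add: r_def mult_ac)
  qed
  have "0 \<le> near_factor n (x n + r)"
  proof -
    have z: "\<bar>(x n + r) - x n\<bar> \<le> \<rho> n * x n" using r by (simp add: r_def)
    have "r * (1 / 2) \<le> r * (1 + far_sum n (x n + r))"
      using far_sum_bound[OF n z] r by (intro mult_left_mono) auto
    then show ?thesis using b[OF z] by (simp add: near_factor_def abs_le_iff)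
  qed
  moreover have "near_factor n (x n - r) \<le> 0"
  proof -
    have z: "\<bar>(x n - r) - x n\<bar> \<le> \<rho> n * x n" using r by (simp add: r_def)
    have "r * (1 / 2) \<le> r * (1 + far_sum n (x n - r))"
      using far_sum_bound[OF n z] r by (intro mult_left_mono) auto
    then show ?thesis using b[OF z] by (simp add: near_factor_def abs_le_iff)
  qed
  ultimately obtain z where z: "x n - r \<le> z" "z \<le> x n + r" "near_factor n z = 0"
    using IVT'[of "near_factor n" "x n - r" 0 "x n + r"] cont r by auto
  have "\<bar>z - x n\<bar> \<le> \<rho> n * x n" using near z by simp
  moreover from this have "poly perturbed_prony z = 0"
    using poly_perturbed_prony_factor[OF n, of z] near_node_neq[OF n] z(3) by auto
  ultimately show thesis using that by blast
qed

lemma root_displacement: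
  assumes n: "n \<in> {1..N}" and z: "\<bar>z - x n\<bar> \<le> \<rho> n * x n" and root: "poly perturbed_prony z = 0"
  shows "\<bar>z - x n\<bar> \<le> 4 * e * (basis_value n)\<^sup>2 * x n"
proof -
  have neq: "z \<noteq> x k" if "k \<in> {1..N} - {n}" for k using near_node_neq[OF n _ _ z] that by auto
  have "(\<Prod>j\<in>{1..N} - {n}. z - x j) \<noteq> 0" using neq by auto
  then have "near_factor n z = 0" using poly_perturbed_prony_factor[OF n neq] root by simp
  then have "(z - x n) * (1 + far_sum n z) = - (noise_coeff n * (z - x (N + 1)))" by (simp add: near_factor_def)
  then have "\<bar>z - x n\<bar> * \<bar>1 + far_sum n z\<bar> = \<bar>noise_coeff n * (z - x (N + 1))\<bar>" by (metis abs_minus abs_mult)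
  moreover have "\<bar>z - x n\<bar> * (1 / 2) \<le> \<bar>z - x n\<bar> * \<bar>1 + far_sum n z\<bar>"
    using far_sum_bound[OF n z] by (intro mult_left_mono) auto
  ultimately show ?thesis using perturbation_term_bound[OF n z] by simp
qed

lemma roots_separated:
  assumes z: "\<And>i. i \<in> {1..N} \<Longrightarrow> \<bar>z i - x i\<bar> \<le> \<rho> i * x i"
    and ij: "i \<in> {1..N}" "j \<in> {1..N}" "i < j"
  shows "\<rho> 1 * x i \<le> z i - z j"
proof -
  have xi: "0 < x i" using x_pos ij by simp
  have xj: "x j \<le> (1 - 4 * \<rho> (j - 1)) * x i" using x_gap[of i j] ij by simp
  have "\<rho> i * x i \<le> \<rho> (j - 1) * x i"
    using rho_le[of i "j - 1"] ij xi by (intro mult_right_mono) auto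
  moreover have "\<rho> j * x j \<le> 2 * \<rho> (j - 1) * x i"
  proof (intro mult_mono)
    obtain m where "j = Suc m" "1 \<le> m" using ij by (cases j) auto
    then show "\<rho> j \<le> 2 * \<rho> (j - 1)" "0 \<le> 2 * \<rho> (j - 1)"
      using rho_double[of m] rho_pos[of m] by auto
    show "x j \<le> x i" "0 \<le> x j" using x_antimono[of i j] x_pos[of j] ij by auto
  qed
  moreover have "\<rho> 1 * x i \<le> \<rho> (j - 1) * x i"
    using rho_le[of 1 "j - 1"] ij xi by (intro mult_right_mono) auto
  moreover have "x i - \<rho> i * x i \<le> z i" "z j \<le> x j + \<rho> j * x j"
    using z[OF ij(1)] z[OF ij(2)] by (auto simp: abs_le_iff)
  ultimately show ?thesis using xj by (simp add: algebra_simps)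
qed

lemma roots_exist:
  obtains z where "\<And>i. i \<in> {1..N} \<Longrightarrow> poly perturbed_prony (z i) = 0"
    "\<And>i. i \<in> {1..N} \<Longrightarrow> \<bar>z i - x i\<bar> \<le> \<rho> i * x i"
    "\<And>i j. \<lbrakk>i \<in> {1..N}; j \<in> {1..N}; i < j\<rbrakk> \<Longrightarrow> z j < z i"
proof -
  have "\<forall>i\<in>{1..N}. \<exists>z. poly perturbed_prony z = 0 \<and> \<bar>z - x i\<bar> \<le> \<rho> i * x i"
    using root_near_node by metis
  then obtain z where z: "\<forall>i\<in>{1..N}. poly perturbed_prony (z i) = 0 \<and> \<bar>z i - x i\<bar> \<le> \<rho> i * x i"
    by metis
  have "z j < z i" if "i \<in> {1..N}" "j \<in> {1..N}" "i < j" for i j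
    using roots_separated[of z i j] z that mult_pos_pos[OF rho_pos[of 1] x_pos[of i]] by force
  with z that show thesis by blast
qed

text \<open>The intervals already account for as many zeros as the degree allows, so every decreasing family of \<open>N\<close>
zeros lists the same set.\<close>
lemma decreasing_roots_unique:
  assumes z: "\<And>i. i \<in> {1..N} \<Longrightarrow> poly perturbed_prony (z i) = 0"
    "\<And>i j. \<lbrakk>i \<in> {1..N}; j \<in> {1..N}; i < j\<rbrakk> \<Longrightarrow> z j < z i"
    and z': "\<And>i. i \<in> {1..N} \<Longrightarrow> poly perturbed_prony (z' i) = 0"
    "\<And>i j. \<lbrakk>i \<in> {1..N}; j \<in> {1..N}; i < j\<rbrakk> \<Longrightarrow> z' j < z' i"
    and n: "n \<in> {1..N}"
  shows "z n = z' n"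
proof (rule strictly_decreasing_enumeration_unique[OF z(2) z'(2) _ n])
  have all: "y ` {1..N} = {t. poly perturbed_prony t = 0}"
    if "\<And>i. i \<in> {1..N} \<Longrightarrow> poly perturbed_prony (y i) = 0"
      "\<And>i j. \<lbrakk>i \<in> {1..N}; j \<in> {1..N}; i < j\<rbrakk> \<Longrightarrow> y j < y i" for y :: "nat \<Rightarrow> real"
  proof (rule card_seteq)
    show "finite {t. poly perturbed_prony t = 0}" using perturbed_prony_nz by (rule poly_roots_finite)
    show "y ` {1..N} \<subseteq> {t. poly perturbed_prony t = 0}" using that(1) by auto
    have "inj_on y {1..N}" using that(2) by (intro linorder_inj_onI) force+
    then have "card (y ` {1..N}) = N" by (simp add: card_image)
    then show "card {t. poly perturbed_prony t = 0} \<le> card (y ` {1..N})"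
      using card_poly_roots_bound[OF perturbed_prony_nz] degree_perturbed_prony by simp
  qed
  show "z ` {1..N} = z' ` {1..N}" using all[of z] all[of z'] z z' by simp
qed

text \<open>Every factor of the amplitude formula is \<open>1 + (x\<^sub>n - z\<^sub>n) / d\<close> with \<open>d\<close> the difference of \<open>z\<^sub>n\<close> and another
node or zero, of modulus at least \<open>\<rho>\<^sub>1 x\<^sub>n\<close>.\<close>
lemma amplitude_error:
  assumes V: "\<And>k. k < N \<Longrightarrow> (\<Sum>n\<in>{1..N}. yh n * z n ^ k) = (\<Sum>n\<in>{1..N+1}. c n * x n ^ k)"
    and root: "\<And>i. i \<in> {1..N} \<Longrightarrow> poly perturbed_prony (z i) = 0"
    and dec: "\<And>i j. \<lbrakk>i \<in> {1..N}; j \<in> {1..N}; i < j\<rbrakk> \<Longrightarrow> z j < z i"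
    and n: "n \<in> {1..N}"
  shows "\<bar>yh n - c n\<bar> \<le> \<bar>c n\<bar> * (exp (8 * real N * e * (basis_value n)\<^sup>2 / \<rho> 1) - 1)"
proof -
  obtain z' where z': "\<And>i. i \<in> {1..N} \<Longrightarrow> poly perturbed_prony (z' i) = 0"
    "\<And>i. i \<in> {1..N} \<Longrightarrow> \<bar>z' i - x i\<bar> \<le> \<rho> i * x i"
    "\<And>i j. \<lbrakk>i \<in> {1..N}; j \<in> {1..N}; i < j\<rbrakk> \<Longrightarrow> z' j < z' i"
    using roots_exist by blast
  have zz': "z i = z' i" if "i \<in> {1..N}" for i
    using decreasing_roots_unique[OF root dec z'(1,3) that] .
  have near: "\<bar>z i - x i\<bar> \<le> \<rho> i * x i" if "i \<in> {1..N}" for i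
    using z'(2)[OF that] zz'[OF that] by simp
  have inj_z: "inj_on z {1..N}" using dec by (intro linorder_inj_onI) force+
  have xn: "0 < x n" using x_pos n by simp
  have r1: "0 < \<rho> 1" by (rule rho_pos) simp
  define u where "u = 4 * e * (basis_value n)\<^sup>2 / \<rho> 1"
  have u0: "0 \<le> u" unfolding u_def using e_nonneg r1 by simp
  have disp: "\<bar>x n - z n\<bar> \<le> 4 * e * (basis_value n)\<^sup>2 * x n"
    using root_displacement[OF n near[OF n] root[OF n]] by (simp add: abs_minus_commute)
  have quotient: "\<bar>(x n - z n) / d\<bar> \<le> u" if d: "\<rho> 1 * x n \<le> \<bar>d\<bar>" for d
  proof -
    have "\<bar>(x n - z n) / d\<bar> \<le> (4 * e * (basis_value n)\<^sup>2 * x n) / (\<rho> 1 * x n)"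
      unfolding abs_divide using disp d xn r1 e_nonneg by (intro frac_le) auto
    also have "\<dots> = u" using xn by (simp add: u_def)
    finally show ?thesis .
  qed
  have sep_z: "\<rho> 1 * x n \<le> \<bar>z n - z k\<bar>" if k: "k \<in> {1..N} - {n}" for k
  proof (cases "n < k")
    case True
    then show ?thesis using roots_separated[OF near n, of k] k by force
  next
    case False
    have "\<rho> 1 * x n \<le> \<rho> 1 * x k" using x_antimono[of k n] False k n r1 by (intro mult_left_mono) auto
    then show ?thesis using roots_separated[OF near _ n, of k] False k by force
  qed
  have sep_x: "\<rho> 1 * x n \<le> \<bar>z n - x k\<bar>" if k: "k \<in> {1..N + 1} - {n}" for k
  proof -
    have "\<rho> 1 * x n \<le> \<rho> k * x n" using rho_le[of 1 k] k xn by (intro mult_right_mono) auto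
    then show ?thesis using near_node_separation[OF n _ _ near[OF n], of k] k by simp
  qed
  have neq_z: "z n - z k \<noteq> 0" if "k \<in> {1..N} - {n}" for k
    using sep_z[OF that] mult_pos_pos[OF r1 xn] by auto
  have neq_x: "z n - x k \<noteq> 0" if "k \<in> {1..N + 1} - {n}" for k
    using sep_x[OF that] mult_pos_pos[OF r1 xn] by auto
  define P1 where "P1 = (\<Prod>k\<in>{1..N} - {n}. (x n - z k) / (z n - z k))"
  define P2 where "P2 = (\<Prod>k\<in>{1..N + 1} - {n}. (x n - x k) / (z n - x k))"
  have "yh n = c n * P1 * P2"
    unfolding P1_def P2_def using neq_x by (intro amplitude_formula[OF V inj_z root n]) auto
  moreover have "\<bar>P1 - 1\<bar> \<le> exp (real N * u) - 1"
  proof -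
    have "P1 = (\<Prod>k\<in>{1..N} - {n}. 1 + (x n - z n) / (z n - z k))"
      unfolding P1_def using neq_z by (intro prod.cong) (auto simp: field_simps)
    then have "\<bar>P1 - 1\<bar> \<le> exp (real (card ({1..N} - {n})) * u) - 1"
      using abs_prod_minus_1_le[of "{1..N} - {n}" "\<lambda>k. (x n - z n) / (z n - z k)" u] quotient[OF sep_z] by simp
    also have "real (card ({1..N} - {n})) * u \<le> real N * u"
      using n u0 by (intro mult_right_mono) auto
    finally show ?thesis by simp
  qed
  moreover have "\<bar>P2 - 1\<bar> \<le> exp (real N * u) - 1"
  proof -
    have "P2 = (\<Prod>k\<in>{1..N + 1} - {n}. 1 + (x n - z n) / (z n - x k))"
      unfolding P2_def using neq_x by (intro prod.cong) (auto simp: field_simps)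
    moreover have "card ({1..N + 1} - {n}) = N" using n by simp
    ultimately show ?thesis
      using abs_prod_minus_1_le[of "{1..N + 1} - {n}" "\<lambda>k. (x n - z n) / (z n - x k)" u] quotient[OF sep_x] by simp
  qed
  ultimately have yh: "yh n = c n * (P1 * P2)" and P: "\<bar>P1 - 1\<bar> \<le> exp (real N * u) - 1" "\<bar>P2 - 1\<bar> \<le> exp (real N * u) - 1"
    by (simp_all add: mult.assoc)
  have "P1 * P2 - 1 = (P1 - 1) * (P2 - 1) + (P1 - 1) + (P2 - 1)" by (simp add: algebra_simps)
  then have "\<bar>P1 * P2 - 1\<bar> \<le> \<bar>P1 - 1\<bar> * \<bar>P2 - 1\<bar> + \<bar>P1 - 1\<bar> + \<bar>P2 - 1\<bar>"
    by (simp add: abs_mult[symmetric])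
  also have "\<dots> \<le> (exp (real N * u) - 1) * (exp (real N * u) - 1) + (exp (real N * u) - 1) + (exp (real N * u) - 1)"
    using P u0 by (intro add_mono mult_mono) auto
  also have "\<dots> = exp (real N * u) * exp (real N * u) - 1" by (simp add: algebra_simps)
  also have "\<dots> = exp (8 * real N * e * (basis_value n)\<^sup>2 / \<rho> 1) - 1"
    unfolding exp_add[symmetric] by (simp add: u_def)
  finally have "\<bar>c n\<bar> * \<bar>P1 * P2 - 1\<bar> \<le> \<bar>c n\<bar> * (exp (8 * real N * e * (basis_value n)\<^sup>2 / \<rho> 1) - 1)"
    by (intro mult_left_mono) auto
  then show ?thesis unfolding yh by (simp add: abs_mult[symmetric] algebra_simps)
qed

end

text \<open>The square of \<open>L\<^sub>k(x\<^sub>N\<^sub>+\<^sub>1)\<close> for the Lagrange basis on the first \<open>N\<close> nodes.\<close>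
definition lagrange_weight :: "(nat \<Rightarrow> real) \<Rightarrow> nat \<Rightarrow> nat \<Rightarrow> real" where
  "lagrange_weight x N k = (\<Prod>j\<in>{1..N} - {k}. (x (N + 1) - x j) / (x k - x j))\<^sup>2"

text \<open>After this lemma each regime is a matter of choosing radii and of bounding the Lagrange weights.\<close>
lemma prony_amplitude_boundI:
  fixes lam :: "nat \<Rightarrow> real" and \<Delta> :: real and \<rho> :: "nat \<Rightarrow> real"
  defines "x \<equiv> exp_node lam \<Delta>"
  assumes N: "1 \<le> N" and eps: "0 < \<epsilon>" and My: "0 < My" and ellc: "1 < ellc" and eta: "\<eta> < 1"
    and rho: "\<And>n. 1 \<le> n \<Longrightarrow> 0 < \<rho> n" "\<And>n. 1 \<le> n \<Longrightarrow> \<rho> n \<le> \<rho> (Suc n)"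
      "\<And>n. 1 \<le> n \<Longrightarrow> \<rho> (Suc n) \<le> 2 * \<rho> n"
      "\<And>n. n \<in> {1..N} \<Longrightarrow> \<rho> n \<le> 1 / 4" "\<And>n. n \<in> {1..N} \<Longrightarrow> \<rho> n \<le> \<tau>"
    and gap: "\<And>n. n \<in> {1..N} \<Longrightarrow> x (Suc n) \<le> (1 - 4 * \<rho> n) * x n"
    and small: "\<epsilon> * My * (\<Sum>k\<in>{1..N}. lagrange_weight x N k / \<rho> k) \<le> 1 / 4"
    and B: "\<And>n. n \<in> {1..N} \<Longrightarrow> real n \<le> \<eta> * real N \<Longrightarrow>
      ellc * (exp (8 * real N * (\<epsilon> * My) * lagrange_weight x N n / \<rho> 1) - 1) \<le> B"
  shows "prony_amplitude_bound lam \<tau> ellc My \<eta> \<Delta> N \<epsilon> B"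
proof -
  have x_pos: "0 < x n" for n by (simp add: x_def exp_node_def)
  have x_dec: "x (Suc n) < x n" if n: "n \<in> {1..N}" for n
  proof -
    have "(1 - 4 * \<rho> n) * x n < 1 * x n" using rho(1)[of n] x_pos[of n] n by (intro mult_strict_right_mono) auto
    then show ?thesis using gap[OF n] by simp
  qed
  have x_less: "x j < x i" if "i \<in> {1..N + 1}" "j \<in> {1..N + 1}" "i < j" for i j
  proof -
    have "Suc i \<le> j" using that by simp
    then have "j \<le> N + 1 \<longrightarrow> x j < x i"
    proof (induction j rule: dec_induct)
      case base
      then show ?case using x_dec[of i] that by simp
    next
      case (step m)
      then show ?case using x_dec[of m] that by force
    qed
    then show ?thesis using that by simp
  qed
  have inj: "inj_on x {1..N + 1}" using x_less by (intro linorder_inj_onI) force+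
  have region: "n \<in> {1..N}" "real n \<le> \<eta> * real N" if "(n, N) \<in> index_region \<eta>" for n
  proof -
    have n: "1 \<le> n" "int n \<le> \<lfloor>\<eta> * real N\<rfloor>" using that by (auto simp: index_region_def)
    then show le: "real n \<le> \<eta> * real N" by (simp add: le_floor_iff)
    also have "\<dots> \<le> 1 * real N" using eta by (intro mult_right_mono) auto
    finally show "n \<in> {1..N}" using n by simp
  qed
  show ?thesis unfolding prony_amplitude_bound_def
  proof (intro allI impI)
    fix y assume adm: "admissible_amplitudes ellc My N y"
    have y_bd: "1 / ellc \<le> \<bar>y n\<bar>" "\<bar>y n\<bar> \<le> ellc" "\<bar>y (N + 1)\<bar> / \<bar>y n\<bar> \<le> My" if "n \<in> {1..N}" for n
      using adm that unfolding admissible_amplitudes_def by blast+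
    define c where "c n = (if n \<le> N then y n else \<epsilon> * y n)" for n
    have cN: "c n = y n" if "n \<in> {1..N}" for n using that by (simp add: c_def)
    have cN1: "c (N + 1) = \<epsilon> * y (N + 1)" by (simp add: c_def)
    have c_nz: "c n \<noteq> 0" if n: "n \<in> {1..N}" for n
    proof -
      have "0 < 1 / ellc" using ellc by simp
      then show ?thesis using y_bd(1)[OF n] cN[OF n] by auto
    qed
    interpret perturbed_measure N x c
      by unfold_locales (use N inj c_nz in auto)
    have basis_value_weight: "(basis_value k)\<^sup>2 = lagrange_weight x N k" for k
      by (simp add: basis_value_eq lagrange_weight_def)
    interpret separated_perturbation N x c \<rho> "\<epsilon> * My"
    proof unfold_locales
      fix k assume k: "k \<in> {1..N}"
      have "\<bar>c (N + 1) / c k\<bar> = \<epsilon> * (\<bar>y (N + 1)\<bar> / \<bar>y k\<bar>)"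
        unfolding cN1 cN[OF k] abs_divide abs_mult using eps by simp
      also have "\<dots> \<le> \<epsilon> * My" using y_bd(3)[OF k] eps by (intro mult_left_mono) auto
      finally show "\<bar>c (N + 1) / c k\<bar> \<le> \<epsilon> * My" .
    qed (use x_pos rho gap small in \<open>simp_all add: basis_value_weight\<close>)
    have m: "noisy_measurement lam \<Delta> N \<epsilon> y k = (\<Sum>n\<in>{1..N+1}. c n * x n ^ k)" for k
    proof -
      have "(\<Sum>n = 1..N. y n * x n ^ k) = (\<Sum>n = 1..N. c n * x n ^ k)"
        using cN by (intro sum.cong) auto
      then show ?thesis unfolding noisy_measurement_def x_def[symmetric] using cN1 by simp
    qed
    note root_iff = prony_poly_root_iff[of "noisy_measurement lam \<Delta> N \<epsilon> y", OF m]
    have est_iff: "prony_estimates lam \<tau> \<Delta> N \<epsilon> y phih yh \<longleftrightarrow>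
       (\<forall>n\<in>{1..N}. poly perturbed_prony (phih n) = 0 \<and> \<bar>phih n - x n\<bar> \<le> \<tau> * x n) \<and>
       (\<forall>i\<in>{1..N}. \<forall>j\<in>{1..N}. i < j \<longrightarrow> phih j < phih i) \<and>
       (\<forall>k<N. (\<Sum>n\<in>{1..N}. yh n * phih n ^ k) = (\<Sum>n\<in>{1..N+1}. c n * x n ^ k))" for phih yh
      unfolding prony_estimates_def Let_def root_iff m x_def ..
    show "(\<exists>phih yh. prony_estimates lam \<tau> \<Delta> N \<epsilon> y phih yh) \<and>
       (\<forall>phih yh. prony_estimates lam \<tau> \<Delta> N \<epsilon> y phih yh \<longrightarrow>
          (\<forall>n. (n, N) \<in> index_region \<eta> \<longrightarrow> \<bar>yh n - y n\<bar> \<le> B))"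
    proof (intro conjI allI impI)
      obtain z where z: "\<And>i. i \<in> {1..N} \<Longrightarrow> poly perturbed_prony (z i) = 0"
        "\<And>i. i \<in> {1..N} \<Longrightarrow> \<bar>z i - x i\<bar> \<le> \<rho> i * x i"
        "\<And>i j. \<lbrakk>i \<in> {1..N}; j \<in> {1..N}; i < j\<rbrakk> \<Longrightarrow> z j < z i"
        using roots_exist by blast
      have "inj_on z {1..N}" using z(3) by (intro linorder_inj_onI) force+
      from vandermonde_solvable[OF this] obtain yh where
        yh: "\<And>k. k < N \<Longrightarrow> (\<Sum>n\<in>{1..N}. yh n * z n ^ k) = (\<Sum>n\<in>{1..N+1}. c n * x n ^ k)" by blast
      have "\<bar>z i - x i\<bar> \<le> \<tau> * x i" if i: "i \<in> {1..N}" for i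
      proof -
        have "\<rho> i * x i \<le> \<tau> * x i" using rho(5)[OF i] x_pos[of i] i by (intro mult_right_mono) auto
        then show ?thesis using z(2)[OF i] by simp
      qed
      then have "prony_estimates lam \<tau> \<Delta> N \<epsilon> y z yh"
        unfolding est_iff using z(1,3) yh by blast
      then show "\<exists>phih yh. prony_estimates lam \<tau> \<Delta> N \<epsilon> y phih yh" by blast
    next
      fix phih yh n
      assume est: "prony_estimates lam \<tau> \<Delta> N \<epsilon> y phih yh" and reg: "(n, N) \<in> index_region \<eta>"
      have n: "n \<in> {1..N}" "real n \<le> \<eta> * real N" using region[OF reg] by auto
      have "\<bar>yh n - c n\<bar> \<le> \<bar>c n\<bar> * (exp (8 * real N * (\<epsilon> * My) * (basis_value n)\<^sup>2 / \<rho> 1) - 1)"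
        using est n(1) unfolding est_iff by (intro amplitude_error[of yh phih]) auto
      also have "\<dots> \<le> ellc * (exp (8 * real N * (\<epsilon> * My) * (basis_value n)\<^sup>2 / \<rho> 1) - 1)"
        using y_bd(2)[OF n(1)] cN[OF n(1)] e_nonneg rho(1)[of 1]
        by (intro mult_right_mono) auto
      also have "\<dots> \<le> B" unfolding basis_value_weight by (rule B[OF n])
      finally show "\<bar>yh n - y n\<bar> \<le> B" using cN[OF n(1)] by simp
    qed
  qed
qed

section \<open>Size of the Lagrange weights and the three regimes\<close>

lemma sum_geometric_le:
  fixes r :: real
  assumes "finite S" "inj_on f S" "0 \<le> r" "r < 1"
  shows "(\<Sum>j\<in>S. r ^ f j) \<le> 1 / (1 - r)"
proof -
  have "(\<Sum>j\<in>S. r ^ f j) = (\<Sum>m\<in>f ` S. r ^ m)" using assms(2) by (simp add: sum.reindex)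
  also have "\<dots> \<le> (\<Sum>m. r ^ m)"
    using assms by (intro sum_le_suminf summable_geometric) auto
  also have "\<dots> = 1 / (1 - r)" using assms by (simp add: suminf_geometric)
  finally show ?thesis .
qed

definition nat_dist :: "nat \<Rightarrow> nat \<Rightarrow> nat" where "nat_dist k j = (k - j) + (j - k)"

text \<open>The infinite product \<open>\<Prod> 1 / (1 - r\<^sup>m)\<close> converges; here it occurs once for each side of \<open>k\<close>, with a bound
that depends neither on \<open>N\<close> nor on \<open>k\<close>.\<close>
lemma prod_geometric_bound:
  fixes r :: real
  assumes r: "0 < r" "r < 1"
  shows "(\<Prod>j\<in>{1..N} - {k}. 1 / (1 - r ^ nat_dist k j)) \<le> exp (2 / (1 - r)\<^sup>2)"
proof -
  have fac: "1 / (1 - r ^ m) \<le> exp (r ^ m / (1 - r))" if m: "1 \<le> m" for m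
  proof -
    have rm: "r ^ m \<le> r" using r m power_decreasing[of 1 m r] by simp
    have "1 / (1 - r ^ m) = 1 + r ^ m / (1 - r ^ m)" using rm r by (simp add: field_simps)
    also have "\<dots> \<le> 1 + r ^ m / (1 - r)" using rm r by (intro add_left_mono divide_left_mono) auto
    also have "\<dots> \<le> exp (r ^ m / (1 - r))" by (rule exp_ge_add_one_self)
    finally show ?thesis .
  qed
  have "(\<Prod>j\<in>{1..N} - {k}. 1 / (1 - r ^ nat_dist k j)) \<le> (\<Prod>j\<in>{1..N} - {k}. exp (r ^ nat_dist k j / (1 - r)))"
  proof (intro prod_mono conjI)
    fix j assume "j \<in> {1..N} - {k}"
    then have m: "1 \<le> nat_dist k j" by (auto simp: nat_dist_def)
    show "1 / (1 - r ^ nat_dist k j) \<le> exp (r ^ nat_dist k j / (1 - r))" by (rule fac[OF m])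
    show "0 \<le> 1 / (1 - r ^ nat_dist k j)" using r by (simp add: power_le_one)
  qed
  also have "\<dots> = exp ((\<Sum>j\<in>{1..N} - {k}. r ^ nat_dist k j) / (1 - r))"
    by (simp add: exp_sum sum_divide_distrib)
  also have "\<dots> \<le> exp ((2 / (1 - r)) / (1 - r))"
  proof -
    have "(\<Sum>j\<in>{1..N} - {k}. r ^ nat_dist k j)
        = (\<Sum>j\<in>{1..N} \<inter> {..<k}. r ^ nat_dist k j) + (\<Sum>j\<in>{1..N} \<inter> {k<..}. r ^ nat_dist k j)"
      by (subst sum.union_disjoint[symmetric]) (auto intro!: sum.cong)
    also have "\<dots> \<le> 1 / (1 - r) + 1 / (1 - r)"
      using r by (intro add_mono sum_geometric_le) (auto simp: inj_on_def nat_dist_def)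
    finally have "(\<Sum>j\<in>{1..N} - {k}. r ^ nat_dist k j) \<le> 2 / (1 - r)" by simp
    then have "(\<Sum>j\<in>{1..N} - {k}. r ^ nat_dist k j) / (1 - r) \<le> 2 / (1 - r) / (1 - r)"
      using r by (intro divide_right_mono) auto
    then show ?thesis unfolding exp_le_cancel_iff .
  qed
  also have "(2 / (1 - r)) / (1 - r) = 2 / (1 - r)\<^sup>2" by (simp add: power2_eq_square)
  finally show ?thesis .
qed

locale quadratic_gaps =
  fixes lam :: "nat \<Rightarrow> real" and c :: real
  assumes c: "0 < c"
    and lam_gap: "\<And>k s. 1 \<le> k \<Longrightarrow> k \<le> s \<Longrightarrow> c * ((real s)\<^sup>2 - (real k)\<^sup>2) \<le> lam s - lam k"
begin

lemma exp_node_ratio: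
  assumes "0 < \<Delta>" "1 \<le> k" "k \<le> s"
  shows "exp_node lam \<Delta> s \<le> exp (- (c * \<Delta> * ((real s)\<^sup>2 - (real k)\<^sup>2))) * exp_node lam \<Delta> k"
proof -
  have "c * ((real s)\<^sup>2 - (real k)\<^sup>2) * \<Delta> \<le> (lam s - lam k) * \<Delta>"
    using lam_gap[OF assms(2,3)] assms(1) by (intro mult_right_mono) auto
  then show ?thesis unfolding exp_node_def exp_add[symmetric] by (simp add: algebra_simps)
qed

text \<open>A factor of \<open>L\<^sub>k(x\<^sub>N\<^sub>+\<^sub>1)\<close> with \<open>j < k\<close> is about 1 and one with \<open>j > k\<close> about \<open>x\<^sub>j / x\<^sub>k\<close>, both up to the
reciprocal relative gap of \<open>x\<^sub>j\<close> and \<open>x\<^sub>k\<close>, for which \<open>u j\<close> is a bound of the caller's choice.\<close>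
lemma lagrange_weight_le:
  assumes Delta: "0 < \<Delta>" and k: "k \<in> {1..N}"
    and u: "\<And>j. j \<in> {1..N} - {k} \<Longrightarrow> 1 / (1 - exp (- (c * \<Delta> * \<bar>(real j)\<^sup>2 - (real k)\<^sup>2\<bar>))) \<le> u j"
  shows "lagrange_weight (exp_node lam \<Delta>) N k
    \<le> (\<Prod>j\<in>{1..N} - {k}. u j)\<^sup>2 * exp (- 2 * c * \<Delta> * (\<Sum>j\<in>{k<..N}. (real j)\<^sup>2 - (real k)\<^sup>2))"
proof -
  define x where "x = exp_node lam \<Delta>"
  have x_pos: "0 < x n" for n by (simp add: x_def exp_node_def)
  have a: "0 < c * \<Delta>" using c Delta by simp
  define E where "E s k = exp (- (c * \<Delta> * ((real s)\<^sup>2 - (real k)\<^sup>2)))" for s k :: nat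
  have ratio: "x s \<le> E s k * x k" if "1 \<le> k" "k \<le> s" for s k
    unfolding x_def E_def by (rule exp_node_ratio[OF Delta that])
  have E1: "E s k < 1" if "k < s" for s k
    unfolding E_def using a that by (auto intro!: mult_pos_pos power_strict_mono)
  have E0: "0 < E s k" for s k by (simp add: E_def)
  \<comment> \<open>the exponentially small part of the factor\<close>
  define g where "g j = (if j < k then 1 else E j k)" for j
  have factor: "\<bar>(x (N + 1) - x j) / (x k - x j)\<bar> \<le> u j * g j" if j: "j \<in> {1..N} - {k}" for j
  proof (cases "j < k")
    case True
    have "x k \<le> E k j * x j" using ratio[of j k] True j by simp
    then have d: "(1 - E k j) * x j \<le> x j - x k" by (simp add: algebra_simps)
    have pos: "0 < (1 - E k j) * x j" using E1[OF True] x_pos[of j] by simp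
    have "x (N + 1) \<le> E (N + 1) j * x j" using ratio[of j "N + 1"] j by simp
    also have "\<dots> \<le> 1 * x j" using E1[of j "N + 1"] x_pos[of j] j by (intro mult_right_mono) auto
    finally have "\<bar>x (N + 1) - x j\<bar> \<le> x j" using x_pos[of "N + 1"] by simp
    then have "\<bar>(x (N + 1) - x j) / (x k - x j)\<bar> \<le> x j / ((1 - E k j) * x j)"
      unfolding abs_divide using d pos x_pos[of j] by (intro frac_le) auto
    also have "\<dots> = 1 / (1 - E k j)" using x_pos[of j] by simp
    also have "E k j = exp (- (c * \<Delta> * \<bar>(real j)\<^sup>2 - (real k)\<^sup>2\<bar>))"
      using True by (simp add: E_def abs_if power_strict_mono)
    finally show ?thesis using u[OF j] True by (simp add: g_def)
  next
    case False
    then have jk: "k < j" using j by auto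
    have xj: "x j \<le> E j k * x k" using ratio[of k j] jk k by simp
    then have d: "(1 - E j k) * x k \<le> x k - x j" by (simp add: algebra_simps)
    have pos: "0 < (1 - E j k) * x k" using E1[OF jk] x_pos[of k] by simp
    have "x (N + 1) \<le> E (N + 1) j * x j" using ratio[of j "N + 1"] j by simp
    also have "\<dots> \<le> 1 * x j" using E1[of j "N + 1"] x_pos[of j] j by (intro mult_right_mono) auto
    finally have "\<bar>x (N + 1) - x j\<bar> \<le> E j k * x k" using x_pos[of "N + 1"] xj by simp
    then have "\<bar>(x (N + 1) - x j) / (x k - x j)\<bar> \<le> (E j k * x k) / ((1 - E j k) * x k)"
      unfolding abs_divide using d pos x_pos[of k] E0[of j k] by (intro frac_le) auto
    also have "\<dots> = 1 / (1 - E j k) * E j k" using x_pos[of k] by simp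
    also have "\<dots> \<le> u j * E j k"
    proof (rule mult_right_mono)
      have "(real k)\<^sup>2 \<le> (real j)\<^sup>2" using jk by (intro power_mono) auto
      then have "E j k = exp (- (c * \<Delta> * \<bar>(real j)\<^sup>2 - (real k)\<^sup>2\<bar>))"
        by (simp add: E_def)
      then show "1 / (1 - E j k) \<le> u j" using u[OF j] by simp
    qed (simp add: E_def)
    finally show ?thesis using False by (simp add: g_def)
  qed
  have "\<bar>\<Prod>j\<in>{1..N} - {k}. (x (N + 1) - x j) / (x k - x j)\<bar> \<le> (\<Prod>j\<in>{1..N} - {k}. u j * g j)"
    unfolding abs_prod using factor by (intro prod_mono) auto
  also have "\<dots> = (\<Prod>j\<in>{1..N} - {k}. u j) * (\<Prod>j\<in>{1..N} - {k}. g j)" by (rule prod.distrib)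
  also have "(\<Prod>j\<in>{1..N} - {k}. g j) = (\<Prod>j\<in>{k<..N}. E j k)"
    using k by (intro prod.mono_neutral_cong_right) (auto simp: g_def)
  also have "(\<Prod>j\<in>{k<..N}. E j k) = exp (- (c * \<Delta>) * (\<Sum>j\<in>{k<..N}. (real j)\<^sup>2 - (real k)\<^sup>2))"
    unfolding E_def sum_distrib_left by (simp add: exp_sum)
  finally have "\<bar>\<Prod>j\<in>{1..N} - {k}. (x (N + 1) - x j) / (x k - x j)\<bar>\<^sup>2
      \<le> ((\<Prod>j\<in>{1..N} - {k}. u j) * exp (- (c * \<Delta>) * (\<Sum>j\<in>{k<..N}. (real j)\<^sup>2 - (real k)\<^sup>2)))\<^sup>2"
    by (rule power_mono) simp
  also have "\<dots> = (\<Prod>j\<in>{1..N} - {k}. u j)\<^sup>2 * exp (- 2 * c * \<Delta> * (\<Sum>j\<in>{k<..N}. (real j)\<^sup>2 - (real k)\<^sup>2))"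
    by (simp add: power_mult_distrib mult_ac flip: exp_of_nat_mult)
  finally show ?thesis by (simp add: lagrange_weight_def x_def)
qed

end

lemma sum_square_diff_ge_last:
  assumes "k \<le> N" shows "(real N)\<^sup>2 - (real k)\<^sup>2 \<le> (\<Sum>j\<in>{k<..N}. (real j)\<^sup>2 - (real k)\<^sup>2)"
proof (cases "k = N")
  case False
  then show ?thesis using assms
    by (intro member_le_sum[of N "{k<..N}" "\<lambda>j. (real j)\<^sup>2 - (real k)\<^sup>2"]) (auto simp: power_mono)
qed simp

lemma sum_square_diff_ge_cube:
  assumes "k \<le> N" shows "real (N - k) ^ 3 / 3 \<le> (\<Sum>j\<in>{k<..N}. (real j)\<^sup>2 - (real k)\<^sup>2)"
  using assms
proof (induction N rule: dec_induct)
  case (step N)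
  have "real (Suc N - k) ^ 3 / 3 = (real (N - k) + 1) ^ 3 / 3" using step(1) by (simp add: Suc_diff_le add.commute)
  also have "\<dots> \<le> real (N - k) ^ 3 / 3 + (real (N - k) + 1)\<^sup>2"
    by (simp add: power3_eq_cube power2_eq_square field_simps)
  also have "(real (N - k) + 1)\<^sup>2 \<le> (real (Suc N))\<^sup>2 - (real k)\<^sup>2"
  proof -
    have "(real (Suc N))\<^sup>2 - (real k)\<^sup>2 - (real (N - k) + 1)\<^sup>2 = 2 * real k * (real (N - k) + 1)"
      using step(1) by (simp add: of_nat_diff power2_eq_square algebra_simps)
    also have "\<dots> \<ge> 0" by simp
    finally show ?thesis by simp
  qed
  also have "{k<..Suc N} = insert (Suc N) {k<..N}" using step(1) by auto
  ultimately show ?case using step.IH by simp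
qed simp

lemma sum_square_diff_ge_cubic:
  assumes "k \<le> N" "real k \<le> \<zeta> * real N" "\<zeta> \<le> 1"
  shows "(1 - \<zeta>) ^ 3 / 3 * real N ^ 3 \<le> (\<Sum>j\<in>{k<..N}. (real j)\<^sup>2 - (real k)\<^sup>2)"
proof -
  have "(1 - \<zeta>) * real N \<le> real (N - k)" using assms by (simp add: of_nat_diff algebra_simps)
  then have "((1 - \<zeta>) * real N) ^ 3 \<le> real (N - k) ^ 3"
    using assms(3) by (intro power_mono mult_nonneg_nonneg) auto
  then show ?thesis using sum_square_diff_ge_cube[OF assms(1)] by (simp add: power_mult_distrib)
qed

lemma square_diff_ge_nat_dist:
  "real (nat_dist k j) * real k \<le> \<bar>(real j)\<^sup>2 - (real k)\<^sup>2\<bar>"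
proof -
  have "(real j)\<^sup>2 - (real k)\<^sup>2 = (real j - real k) * (real j + real k)"
    by (simp add: power2_eq_square algebra_simps)
  moreover have "real (nat_dist k j) = \<bar>real j - real k\<bar>"
    by (cases "j \<le> k") (auto simp: nat_dist_def of_nat_diff)
  ultimately show ?thesis by (simp add: abs_mult mult_left_mono)
qed

lemma square_diff_ge_1:
  assumes "j \<noteq> k" shows "1 \<le> \<bar>(real j)\<^sup>2 - (real k)\<^sup>2\<bar>"
proof -
  have "int j ^ 2 \<noteq> int k ^ 2" using assms by (simp add: power2_eq_iff_nonneg)
  then have "0 < \<bar>int j ^ 2 - int k ^ 2\<bar>" unfolding zero_less_abs_iff by linarith
  then have "1 \<le> \<bar>int j ^ 2 - int k ^ 2\<bar>" by linarith
  then have "real_of_int 1 \<le> real_of_int \<bar>int j ^ 2 - int k ^ 2\<bar>" by (simp only: of_int_le_iff)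
  then show ?thesis by simp
qed

text \<open>Turns the exponent in the amplitude error into the linear form of the claimed bounds.\<close>
lemma exp_minus_one_bound:
  fixes X :: real
  assumes X: "X \<le> \<epsilon> * D * E" and D: "0 \<le> D" and E: "0 \<le> E" "E \<le> 1" and eps: "0 \<le> \<epsilon>" "\<epsilon> \<le> 1"
    and ellc: "0 \<le> ellc"
  shows "ellc * (exp X - 1) \<le> \<epsilon> * (ellc * D * exp D) * E"
proof -
  define Y where "Y = \<epsilon> * D * E"
  have Y0: "0 \<le> Y" using D E eps by (simp add: Y_def)
  have "\<epsilon> * D * E \<le> 1 * D * 1" using D E eps by (intro mult_mono) auto
  then have YD: "Y \<le> D" by (simp add: Y_def)
  have "exp X \<le> exp Y" using X by (simp add: Y_def)
  moreover have "exp Y - 1 \<le> Y * exp Y"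
  proof -
    have "1 - Y \<le> exp (- Y)" using exp_ge_add_one_self[of "- Y"] by simp
    then have "(1 - Y) * exp Y \<le> exp (- Y) * exp Y" by (intro mult_right_mono) auto
    then show ?thesis by (simp add: algebra_simps flip: exp_add)
  qed
  moreover have "Y * exp Y \<le> Y * exp D" using Y0 YD by (intro mult_left_mono) auto
  ultimately have "exp X - 1 \<le> Y * exp D" by linarith
  then have "ellc * (exp X - 1) \<le> ellc * (Y * exp D)" using ellc by (intro mult_left_mono) auto
  then show ?thesis by (simp add: Y_def mult_ac)
qed

lemma crude_factor_negligible:
  fixes b \<gamma> :: real
  assumes "0 < b" "0 < \<gamma>"
  shows "\<forall>\<^sub>F N in sequentially. real N ^ 2 * (1 + real N / b) ^ (2 * N) * exp (- (b * \<gamma> * real N ^ 2)) \<le> 1"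
proof -
  have "((\<lambda>N::nat. real N ^ 2 * exp (2 * real N * ln (1 + real N / b)) * exp (- (b * \<gamma> * real N ^ 2))) \<longlongrightarrow> 0) sequentially"
    using assms by real_asymp
  then have "\<forall>\<^sub>F N in sequentially. real N ^ 2 * exp (2 * real N * ln (1 + real N / b)) * exp (- (b * \<gamma> * real N ^ 2)) < 1"
    by (rule order_tendstoD) simp
  then show ?thesis
  proof eventually_elim
    case (elim N)
    have "exp (2 * real N * ln (1 + real N / b)) = exp (real (2 * N) * ln (1 + real N / b))" by simp
    also have "\<dots> = (1 + real N / b) ^ (2 * N)"
      unfolding exp_of_nat_mult using assms by (simp add: add_pos_nonneg)
    finally show ?case using elim by simp
  qed
qed

context quadratic_gaps
begin

text \<open>Useful when \<open>c \<Delta> k\<close> is bounded below: always for \<open>\<Delta> \<ge> \<Delta>\<^sub>*\<close>, and for \<open>\<Delta> = T / N\<close> when \<open>k\<close> is of order \<open>N\<close>.\<close>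
lemma weight_le_geometric:
  assumes Delta: "0 < \<Delta>" and k: "k \<in> {1..N}" and b: "0 < b" "b \<le> c * \<Delta> * real k"
  shows "lagrange_weight (exp_node lam \<Delta>) N k
    \<le> (exp (2 / (1 - exp (- b))\<^sup>2))\<^sup>2 * exp (- 2 * c * \<Delta> * (\<Sum>j\<in>{k<..N}. (real j)\<^sup>2 - (real k)\<^sup>2))"
proof -
  define r where "r = exp (- b)"
  have r: "0 < r" "r < 1" using b by (auto simp: r_def)
  have "lagrange_weight (exp_node lam \<Delta>) N k \<le> (\<Prod>j\<in>{1..N} - {k}. 1 / (1 - r ^ nat_dist k j))\<^sup>2
      * exp (- 2 * c * \<Delta> * (\<Sum>j\<in>{k<..N}. (real j)\<^sup>2 - (real k)\<^sup>2))"
  proof (rule lagrange_weight_le[OF Delta k])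
    fix j assume j: "j \<in> {1..N} - {k}"
    then have nd: "0 < nat_dist k j" by (auto simp: nat_dist_def)
    have "real (nat_dist k j) * b \<le> real (nat_dist k j) * (c * \<Delta> * real k)"
      using b by (intro mult_left_mono) auto
    also have "\<dots> = c * \<Delta> * (real (nat_dist k j) * real k)" by simp
    also have "\<dots> \<le> c * \<Delta> * \<bar>(real j)\<^sup>2 - (real k)\<^sup>2\<bar>"
      using c Delta square_diff_ge_nat_dist by (intro mult_left_mono) auto
    finally have "exp (- (c * \<Delta> * \<bar>(real j)\<^sup>2 - (real k)\<^sup>2\<bar>)) \<le> exp (- (real (nat_dist k j) * b))" by simp
    also have "exp (- (real (nat_dist k j) * b)) = r ^ nat_dist k j"
      by (simp add: r_def flip: exp_of_nat_mult)
    finally have le: "exp (- (c * \<Delta> * \<bar>(real j)\<^sup>2 - (real k)\<^sup>2\<bar>)) \<le> r ^ nat_dist k j" .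
    have "r ^ nat_dist k j < 1" using r nd by (simp add: power_Suc_less_one power_less_one_iff)
    moreover from this have "exp (- (c * \<Delta> * \<bar>(real j)\<^sup>2 - (real k)\<^sup>2\<bar>)) < 1"
      using le by linarith
    ultimately show "1 / (1 - exp (- (c * \<Delta> * \<bar>(real j)\<^sup>2 - (real k)\<^sup>2\<bar>))) \<le> 1 / (1 - r ^ nat_dist k j)"
      using le by (intro divide_left_mono mult_pos_pos) auto
  qed
  also have "\<dots> \<le> (exp (2 / (1 - r)\<^sup>2))\<^sup>2 * exp (- 2 * c * \<Delta> * (\<Sum>j\<in>{k<..N}. (real j)\<^sup>2 - (real k)\<^sup>2))"
    using r by (intro mult_right_mono power_mono prod_geometric_bound prod_nonneg) (auto simp: power_le_one)
  finally show ?thesis by (simp add: r_def)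
qed

text \<open>For \<open>\<Delta> = T / N\<close> and small \<open>k\<close> each relative gap is bounded below by the smallest possible one.  The resulting factor
\<open>exp (O(N ln N))\<close> is harmless next to \<open>exp (- \<Gamma> N\<^sup>2)\<close>.\<close>
lemma weight_le_crude:
  assumes Delta: "0 < \<Delta>" and k: "k \<in> {1..N}"
  shows "lagrange_weight (exp_node lam \<Delta>) N k
    \<le> (1 + 1 / (c * \<Delta>)) ^ (2 * N) * exp (- 2 * c * \<Delta> * (\<Sum>j\<in>{k<..N}. (real j)\<^sup>2 - (real k)\<^sup>2))"
proof -
  define a where "a = c * \<Delta>"
  have a: "0 < a" using c Delta by (simp add: a_def)
  have "lagrange_weight (exp_node lam \<Delta>) N k \<le> (\<Prod>j\<in>{1..N} - {k}. 1 + 1 / a)\<^sup>2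
      * exp (- 2 * c * \<Delta> * (\<Sum>j\<in>{k<..N}. (real j)\<^sup>2 - (real k)\<^sup>2))"
  proof (rule lagrange_weight_le[OF Delta k])
    fix j assume j: "j \<in> {1..N} - {k}"
    define t where "t = c * \<Delta> * \<bar>(real j)\<^sup>2 - (real k)\<^sup>2\<bar>"
    have "a * 1 \<le> t" unfolding t_def a_def[symmetric] using a square_diff_ge_1[of j k] j
      by (intro mult_left_mono) auto
    then have at: "a \<le> t" by simp
    have "exp (- t) \<le> 1 / (1 + t)"
      using exp_ge_add_one_self[of t] at a by (simp add: exp_minus field_simps)
    then have "t / (1 + t) \<le> 1 - exp (- t)" using at a by (simp add: field_simps)
    then have "1 / (1 - exp (- t)) \<le> 1 / (t / (1 + t))"
      using at a by (intro divide_left_mono mult_pos_pos) auto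
    also have "\<dots> = 1 + 1 / t" using at a by (simp add: field_simps)
    also have "\<dots> \<le> 1 + 1 / a" using at a by (intro add_left_mono divide_left_mono) auto
    finally show "1 / (1 - exp (- (c * \<Delta> * \<bar>(real j)\<^sup>2 - (real k)\<^sup>2\<bar>))) \<le> 1 + 1 / a"
      by (simp add: t_def)
  qed
  also have "(\<Prod>j\<in>{1..N} - {k}. 1 + 1 / a)\<^sup>2 \<le> (1 + 1 / a) ^ (2 * N)"
  proof -
    have "(\<Prod>j\<in>{1..N} - {k}. 1 + 1 / a) \<le> (1 + 1 / a) ^ N"
      using a k by (simp add: power_increasing)
    then have "(\<Prod>j\<in>{1..N} - {k}. 1 + 1 / a)\<^sup>2 \<le> ((1 + 1 / a) ^ N)\<^sup>2"
      using a by (intro power_mono prod_nonneg) auto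
    then show ?thesis by (simp add: power_mult[symmetric] mult.commute)
  qed
  finally show ?thesis by (simp add: a_def)
qed

text \<open>Here the relative gaps are bounded below, so one radius serves all nodes.  The weights decay
geometrically away from \<open>k = N\<close>, which makes the noise threshold independent of \<open>N\<close> and \<open>\<Delta>\<close>.\<close>
lemma fixed_step_bound:
  assumes Ds: "0 < \<Delta>s" and eta: "\<eta> < 1" and ellc: "1 < ellc" and My: "0 < My"
    and tau: "0 < \<tau>" "\<tau> < 1 / 2"
    and sep: "\<And>\<Delta> n j. \<lbrakk>\<Delta> \<ge> \<Delta>s; n \<ge> 1; j \<ge> 1; j \<noteq> n\<rbrakk> \<Longrightarrow>
       \<bar>exp_node lam \<Delta> j - exp_node lam \<Delta> n\<bar> / exp_node lam \<Delta> n \<ge> 2 * \<tau>"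
  shows "\<exists>eps_star>0. \<exists>\<Gamma>>0. \<exists>D>0. \<forall>\<epsilon>\<in>{0<..eps_star}. \<forall>N\<ge>1. \<forall>\<Delta>\<ge>\<Delta>s.
        prony_amplitude_bound lam \<tau> ellc My \<eta> \<Delta> N \<epsilon> (\<epsilon> * D * exp (- \<Delta> * \<Gamma> * real N ^ 3))"
proof -
  define b where "b = c * \<Delta>s"
  have b: "0 < b" using c Ds by (simp add: b_def)
  define r where "r = exp (- b)"
  have r: "0 < r" "r < 1" using b by (auto simp: r_def)
  define K where "K = (exp (2 / (1 - r)\<^sup>2))\<^sup>2"
  have K: "0 < K" by (simp add: K_def)
  define \<gamma> where "\<gamma> = (1 - \<eta>) ^ 3 / 3"
  have g: "0 < \<gamma>" using eta by (simp add: \<gamma>_def)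
  define S where "S = 2 * K / \<tau> * (1 / (1 - r))"
  have S: "0 < S" using K tau r by (simp add: S_def)
  \<comment> \<open>half of the decay of the weight pays for the factor N in the amplitude error: N exp (- t) is at most N / t\<close>
  define D1 where "D1 = 16 * My * K / \<tau> * (1 / (\<gamma> * b))"
  have D1: "0 < D1" using My K tau g b by (simp add: D1_def)
  define eps_star where "eps_star = min 1 (1 / (4 * My * S))"
  have es: "0 < eps_star" using My S by (simp add: eps_star_def)
  have "prony_amplitude_bound lam \<tau> ellc My \<eta> \<Delta> N \<epsilon>
      (\<epsilon> * (ellc * D1 * exp D1) * exp (- \<Delta> * (\<gamma> * c) * real N ^ 3))"
    if eps: "\<epsilon> \<in> {0<..eps_star}" and N: "1 \<le> N" and Delta: "\<Delta>s \<le> \<Delta>" for \<epsilon> N \<Delta>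
  proof -
    have D0: "0 < \<Delta>" using Ds Delta by simp
    have bD: "b \<le> c * \<Delta>" using c Delta by (simp add: b_def)
    have weight: "lagrange_weight (exp_node lam \<Delta>) N k
        \<le> K * exp (- 2 * c * \<Delta> * (\<Sum>j\<in>{k<..N}. (real j)\<^sup>2 - (real k)\<^sup>2))" if k: "k \<in> {1..N}" for k
    proof -
      have "c * \<Delta> * 1 \<le> c * \<Delta> * real k" using c D0 k by (intro mult_left_mono) auto
      then have "b \<le> c * \<Delta> * real k" using bD by simp
      from weight_le_geometric[OF D0 k b this] show ?thesis by (simp add: K_def r_def)
    qed
    show ?thesis
    proof (rule prony_amplitude_boundI[where \<rho> = "\<lambda>_. \<tau> / 2"])
      fix n assume n: "n \<in> {1..N}"
      have pos: "0 < exp_node lam \<Delta> n" by (simp add: exp_node_def)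
      have "exp_node lam \<Delta> (Suc n) \<le> exp (- (c * \<Delta> * ((real (Suc n))\<^sup>2 - (real n)\<^sup>2))) * exp_node lam \<Delta> n"
        using n by (intro exp_node_ratio[OF D0]) auto
      also have "\<dots> \<le> 1 * exp_node lam \<Delta> n"
        using c D0 pos by (intro mult_right_mono) (auto simp: power_mono)
      finally have "exp_node lam \<Delta> (Suc n) \<le> exp_node lam \<Delta> n" by simp
      moreover have "2 * \<tau> * exp_node lam \<Delta> n \<le> \<bar>exp_node lam \<Delta> (Suc n) - exp_node lam \<Delta> n\<bar>"
        using sep[OF Delta, of n "Suc n"] n pos by (simp add: field_simps)
      ultimately show "exp_node lam \<Delta> (Suc n) \<le> (1 - 4 * (\<tau> / 2)) * exp_node lam \<Delta> n"
        by (simp add: algebra_simps)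
    next
      have "(\<Sum>k\<in>{1..N}. lagrange_weight (exp_node lam \<Delta>) N k / (\<tau> / 2))
          \<le> (\<Sum>k\<in>{1..N}. 2 * K / \<tau> * r ^ (N - k))"
      proof (rule sum_mono)
        fix k assume k: "k \<in> {1..N}"
        have "real (N - k) * 1 \<le> real (N - k) * (real N + real k)"
          using k by (intro mult_left_mono) auto
        also have "\<dots> = (real N)\<^sup>2 - (real k)\<^sup>2"
          using k by (simp add: of_nat_diff power2_eq_square algebra_simps)
        also have "\<dots> \<le> (\<Sum>j\<in>{k<..N}. (real j)\<^sup>2 - (real k)\<^sup>2)"
          using k by (intro sum_square_diff_ge_last) auto
        finally have s: "real (N - k) \<le> (\<Sum>j\<in>{k<..N}. (real j)\<^sup>2 - (real k)\<^sup>2)" by simp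
        have "b * real (N - k) \<le> (2 * c * \<Delta>) * (\<Sum>j\<in>{k<..N}. (real j)\<^sup>2 - (real k)\<^sup>2)"
          using bD b s c D0 by (intro mult_mono) auto
        then have "exp (- 2 * c * \<Delta> * (\<Sum>j\<in>{k<..N}. (real j)\<^sup>2 - (real k)\<^sup>2)) \<le> exp (real (N - k) * (- b))"
          by (simp add: mult.commute)
        also have "\<dots> = r ^ (N - k)" unfolding r_def by (rule exp_of_nat_mult)
        finally have e: "exp (- 2 * c * \<Delta> * (\<Sum>j\<in>{k<..N}. (real j)\<^sup>2 - (real k)\<^sup>2)) \<le> r ^ (N - k)" .
        have "lagrange_weight (exp_node lam \<Delta>) N k \<le> K * r ^ (N - k)"
          by (rule order_trans[OF weight[OF k] mult_left_mono[OF e]]) (use K in simp)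
        then show "lagrange_weight (exp_node lam \<Delta>) N k / (\<tau> / 2) \<le> 2 * K / \<tau> * r ^ (N - k)"
          using tau by (simp add: field_simps)
      qed
      also have "\<dots> \<le> S"
        unfolding sum_distrib_left[symmetric] S_def
        using r K tau by (intro mult_left_mono sum_geometric_le) (auto simp: inj_on_def)
      finally have "\<epsilon> * My * (\<Sum>k\<in>{1..N}. lagrange_weight (exp_node lam \<Delta>) N k / (\<tau> / 2))
          \<le> 1 / (4 * My * S) * My * S"
        using eps My S by (intro mult_mono) (auto simp: eps_star_def lagrange_weight_def intro!: sum_nonneg divide_nonneg_pos tau)
      also have "\<dots> = 1 / 4" using My S by simp
      finally show "\<epsilon> * My * (\<Sum>k\<in>{1..N}. lagrange_weight (exp_node lam \<Delta>) N k / (\<tau> / 2)) \<le> 1 / 4" .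
    next
      fix n assume n: "n \<in> {1..N}" and le: "real n \<le> \<eta> * real N"
      let ?E = "exp (- \<Delta> * (\<gamma> * c) * real N ^ 3)"
      have N3: "1 \<le> real N ^ 3" "real N \<le> real N ^ 3"
        using N by (auto intro: power_increasing[of 1 3 "real N", simplified])
      have "\<gamma> * real N ^ 3 \<le> (\<Sum>j\<in>{n<..N}. (real j)\<^sup>2 - (real n)\<^sup>2)"
        unfolding \<gamma>_def using n le eta by (intro sum_square_diff_ge_cubic) auto
      then have "(2 * c * \<Delta>) * (\<gamma> * real N ^ 3) \<le> (2 * c * \<Delta>) * (\<Sum>j\<in>{n<..N}. (real j)\<^sup>2 - (real n)\<^sup>2)"
        using c D0 by (intro mult_left_mono) auto
      then have "exp (- 2 * c * \<Delta> * (\<Sum>j\<in>{n<..N}. (real j)\<^sup>2 - (real n)\<^sup>2)) \<le> ?E * ?E"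
        unfolding exp_add[symmetric] by (simp add: algebra_simps)
      then have "lagrange_weight (exp_node lam \<Delta>) N n \<le> K * (?E * ?E)"
        using K by (intro order_trans[OF weight[OF n] mult_left_mono]) auto
      then have "real N * lagrange_weight (exp_node lam \<Delta>) N n \<le> real N * (K * (?E * ?E))"
        by (intro mult_left_mono) auto
      also have "\<dots> = K * ?E * (real N * ?E)" by simp
      also have "\<dots> \<le> K * ?E * (1 / (\<gamma> * b))"
      proof (rule mult_left_mono)
        have "\<gamma> * b * real N \<le> \<gamma> * (c * \<Delta>) * real N ^ 3"
          using g b bD N3 by (intro mult_mono) auto
        also have "\<dots> \<le> exp (\<gamma> * (c * \<Delta>) * real N ^ 3)"
          using exp_ge_add_one_self[of "\<gamma> * (c * \<Delta>) * real N ^ 3"] by linarith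
        also have "\<dots> = 1 / ?E" by (simp add: exp_minus field_simps)
        finally show "real N * ?E \<le> 1 / (\<gamma> * b)" using g b by (simp add: field_simps)
      qed (use K in simp)
      finally have w: "real N * lagrange_weight (exp_node lam \<Delta>) N n \<le> K * ?E * (1 / (\<gamma> * b))" .
      have "8 * real N * (\<epsilon> * My) * lagrange_weight (exp_node lam \<Delta>) N n / (\<tau> / 2)
          = 16 * \<epsilon> * My / \<tau> * (real N * lagrange_weight (exp_node lam \<Delta>) N n)" by simp
      also have "\<dots> \<le> 16 * \<epsilon> * My / \<tau> * (K * ?E * (1 / (\<gamma> * b)))"
        using w eps My tau by (intro mult_left_mono) auto
      also have "\<dots> = \<epsilon> * D1 * ?E" by (simp add: D1_def)
      finally show "ellc * (exp (8 * real N * (\<epsilon> * My) * lagrange_weight (exp_node lam \<Delta>) N n / (\<tau> / 2)) - 1)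
          \<le> \<epsilon> * (ellc * D1 * exp D1) * ?E"
        using D1 eps ellc g c D0 by (intro exp_minus_one_bound) (auto simp: eps_star_def)
    qed (use N eps My ellc eta tau in auto)
  qed
  moreover have "0 < \<gamma> * c" "0 < ellc * D1 * exp D1" using g c ellc D1 by auto
  ultimately show ?thesis using es by blast
qed

text \<open>With \<open>\<Delta> = T / N\<close> the relative gap after the \<open>n\<close>-th node is of order \<open>n / N\<close>, and so is the chosen radius.
Weights with \<open>2 k \<ge> N\<close> decay geometrically in \<open>N - k\<close> and meet radii bounded below; those with smaller \<open>k\<close> are of
size \<open>exp (- \<Gamma> N\<^sup>2)\<close>, which outweighs the reciprocal radius.\<close>
lemma shrinking_step_bound:
  assumes T: "0 < T" and eta: "\<eta> < 1" and ellc: "1 < ellc" and My: "0 < My" and tau: "0 < \<tau>"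
  shows "\<exists>eps_star>0. \<exists>\<Gamma>>0. \<exists>D>0. \<exists>N0\<ge>1. \<forall>\<epsilon>\<in>{0<..eps_star}. \<forall>N\<ge>N0.
        prony_amplitude_bound lam \<tau> ellc My \<eta> (T / real N) N \<epsilon> (\<epsilon> * D * exp (- \<Gamma> * real N ^ 2))"
proof -
  define b where "b = c * T"
  have b: "0 < b" using c T by (simp add: b_def)
  define r where "r = exp (- (b / 2))"
  have r: "0 < r" "r < 1" using b by (auto simp: r_def)
  define K where "K = (exp (2 / (1 - r)\<^sup>2))\<^sup>2"
  have K: "0 < K" by (simp add: K_def)
  \<comment> \<open>covers both the indices with 2 k < N in the smallness condition and those up to \<open>\<eta> N\<close> in the claim\<close>
  define \<zeta> where "\<zeta> = max (1 / 2) \<eta>"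
  have z: "\<zeta> < 1" "\<eta> \<le> \<zeta>" "1 / 2 \<le> \<zeta>" using eta by (auto simp: \<zeta>_def)
  define \<gamma> where "\<gamma> = (1 - \<zeta>) ^ 3 / 3"
  have g: "0 < \<gamma>" using z by (simp add: \<gamma>_def)
  \<comment> \<open>with \<open>t = 2 b n / N\<close> the relative gap is at least \<open>1 - exp (- t) \<ge> t / (1 + 2 b)\<close>, and the radius takes a quarter of it\<close>
  define \<kappa> where "\<kappa> = min \<tau> (b / (2 * (1 + 2 * b)))"
  have kap: "0 < \<kappa>" "\<kappa> \<le> \<tau>" "4 * \<kappa> \<le> 2 * b / (1 + 2 * b)"
  proof -
    show "0 < \<kappa>" "\<kappa> \<le> \<tau>" using tau b by (auto simp: \<kappa>_def)
    have "4 * \<kappa> \<le> 4 * (b / (2 * (1 + 2 * b)))" by (simp add: \<kappa>_def)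
    also have "\<dots> = 2 * b / (1 + 2 * b)" using b by (simp add: field_simps)
    finally show "4 * \<kappa> \<le> 2 * b / (1 + 2 * b)" .
  qed
  have "2 * b / (1 + 2 * b) \<le> 1" using b by (simp add: field_simps)
  then have kap4: "\<kappa> \<le> 1 / 4" using kap(3) by linarith
  define S where "S = 2 * K / \<kappa> * (1 / (1 - r)) + 1 / \<kappa>"
  have S: "0 < S" using K kap r by (simp add: S_def add_pos_pos)
  define D1 where "D1 = 8 * My / \<kappa>"
  have D1: "0 < D1" using My kap by (simp add: D1_def)
  define eps_star where "eps_star = min 1 (1 / (4 * My * S))"
  have es: "0 < eps_star" using My S by (simp add: eps_star_def)
  obtain N1 where N1: "\<And>N. N \<ge> N1 \<Longrightarrow>
      real N ^ 2 * (1 + real N / b) ^ (2 * N) * exp (- (b * \<gamma> * real N ^ 2)) \<le> 1"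
    using crude_factor_negligible[OF b g] unfolding eventually_sequentially by blast
  have "prony_amplitude_bound lam \<tau> ellc My \<eta> (T / real N) N \<epsilon>
      (\<epsilon> * (ellc * D1 * exp D1) * exp (- (b * \<gamma>) * real N ^ 2))"
    if eps: "\<epsilon> \<in> {0<..eps_star}" and NN: "max 1 N1 \<le> N" for \<epsilon> N
  proof -
    have N: "1 \<le> N" "N1 \<le> N" using NN by auto
    define \<Delta> where "\<Delta> = T / real N"
    have D0: "0 < \<Delta>" using T N by (simp add: \<Delta>_def)
    have cD: "c * \<Delta> = b / real N" by (simp add: b_def \<Delta>_def)
    let ?w = "lagrange_weight (exp_node lam \<Delta>) N"
    let ?E = "exp (- (b * \<gamma>) * real N ^ 2)"
    have w0: "0 \<le> ?w k" for k by (simp add: lagrange_weight_def)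
    have weight_small: "real N ^ 2 * ?w k \<le> ?E" if k: "k \<in> {1..N}" and le: "real k \<le> \<zeta> * real N" for k
    proof -
      have "\<gamma> * real N ^ 3 \<le> (\<Sum>j\<in>{k<..N}. (real j)\<^sup>2 - (real k)\<^sup>2)"
        unfolding \<gamma>_def using k le z by (intro sum_square_diff_ge_cubic) auto
      then have "(2 * (b / real N)) * (\<gamma> * real N ^ 3)
          \<le> (2 * (b / real N)) * (\<Sum>j\<in>{k<..N}. (real j)\<^sup>2 - (real k)\<^sup>2)"
        using b by (intro mult_left_mono) auto
      moreover have "(2 * (b / real N)) * (\<gamma> * real N ^ 3) = 2 * (b * \<gamma> * real N ^ 2)"
        using N by (simp add: power3_eq_cube power2_eq_square)
      moreover have "- 2 * c * \<Delta> * (\<Sum>j\<in>{k<..N}. (real j)\<^sup>2 - (real k)\<^sup>2)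
          = - ((2 * (b / real N)) * (\<Sum>j\<in>{k<..N}. (real j)\<^sup>2 - (real k)\<^sup>2))"
        unfolding cD[symmetric] by simp
      ultimately have e: "exp (- 2 * c * \<Delta> * (\<Sum>j\<in>{k<..N}. (real j)\<^sup>2 - (real k)\<^sup>2)) \<le> ?E * ?E"
        unfolding exp_add[symmetric] exp_le_cancel_iff minus_mult_left[symmetric] by linarith
      have "?w k \<le> (1 + real N / b) ^ (2 * N) * (?E * ?E)"
      proof -
        have "?w k \<le> (1 + 1 / (c * \<Delta>)) ^ (2 * N) * exp (- 2 * c * \<Delta> * (\<Sum>j\<in>{k<..N}. (real j)\<^sup>2 - (real k)\<^sup>2))"
          by (rule weight_le_crude[OF D0 k])
        also have "\<dots> \<le> (1 + 1 / (c * \<Delta>)) ^ (2 * N) * (?E * ?E)"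
          using e c D0 by (intro mult_left_mono) auto
        also have "1 / (c * \<Delta>) = real N / b" unfolding cD by simp
        finally show ?thesis .
      qed
      then have "real N ^ 2 * ?w k \<le> real N ^ 2 * ((1 + real N / b) ^ (2 * N) * (?E * ?E))"
        by (intro mult_left_mono) auto
      also have "\<dots> = (real N ^ 2 * (1 + real N / b) ^ (2 * N) * exp (- (b * \<gamma> * real N ^ 2))) * ?E" by simp
      also have "\<dots> \<le> 1 * ?E" by (intro mult_right_mono N1[OF N(2)]) simp
      finally show ?thesis by simp
    qed
    have weight_large: "?w k \<le> K * r ^ (N - k)" if k: "k \<in> {1..N}" and ge: "real N \<le> 2 * real k" for k
    proof -
      have "b / 2 \<le> c * \<Delta> * real k" unfolding cD using b ge N by (simp add: field_simps)
      from weight_le_geometric[OF D0 k _ this]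
      have w: "?w k \<le> K * exp (- 2 * c * \<Delta> * (\<Sum>j\<in>{k<..N}. (real j)\<^sup>2 - (real k)\<^sup>2))"
        using b by (simp add: K_def r_def)
      have "real (N - k) * real N \<le> real (N - k) * (real N + real k)" by (intro mult_left_mono) auto
      also have "\<dots> = (real N)\<^sup>2 - (real k)\<^sup>2"
        using k by (simp add: of_nat_diff power2_eq_square algebra_simps)
      also have "\<dots> \<le> (\<Sum>j\<in>{k<..N}. (real j)\<^sup>2 - (real k)\<^sup>2)"
        using k by (intro sum_square_diff_ge_last) auto
      finally have "(2 * (b / real N)) * (real (N - k) * real N)
          \<le> (2 * (b / real N)) * (\<Sum>j\<in>{k<..N}. (real j)\<^sup>2 - (real k)\<^sup>2)"
        using b by (intro mult_left_mono) auto
      moreover have "(2 * (b / real N)) * (real (N - k) * real N) = 2 * (real (N - k) * b)"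
        using N by simp
      moreover have "real (N - k) * (b / 2) \<le> 2 * (real (N - k) * b)" using b by simp
      moreover have "- 2 * c * \<Delta> * (\<Sum>j\<in>{k<..N}. (real j)\<^sup>2 - (real k)\<^sup>2)
          = - ((2 * (b / real N)) * (\<Sum>j\<in>{k<..N}. (real j)\<^sup>2 - (real k)\<^sup>2))"
        unfolding cD[symmetric] by simp
      ultimately have "exp (- 2 * c * \<Delta> * (\<Sum>j\<in>{k<..N}. (real j)\<^sup>2 - (real k)\<^sup>2)) \<le> exp (real (N - k) * (- (b / 2)))"
        unfolding exp_le_cancel_iff mult_minus_right by linarith
      also have "\<dots> = r ^ (N - k)" unfolding r_def by (rule exp_of_nat_mult)
      finally show ?thesis using K by (intro order_trans[OF w mult_left_mono]) auto
    qed
    have "prony_amplitude_bound lam \<tau> ellc My \<eta> \<Delta> N \<epsilon> (\<epsilon> * (ellc * D1 * exp D1) * ?E)"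
    proof (rule prony_amplitude_boundI[where \<rho> = "\<lambda>n. \<kappa> * real n / real N"])
      fix n assume n: "n \<in> {1..N}"
      have "\<kappa> * real n / real N \<le> \<kappa> * 1"
        unfolding times_divide_eq_right[symmetric] using n kap by (intro mult_left_mono) auto
      then show "\<kappa> * real n / real N \<le> 1 / 4" "\<kappa> * real n / real N \<le> \<tau>"
        using kap4 kap(2) by linarith+
      define t where "t = 2 * b * (real n / real N)"
      have t: "0 < t" "t \<le> 2 * b"
      proof -
        show "0 < t" using b n by (simp add: t_def)
        have "2 * b * (real n / real N) \<le> 2 * b * 1" using b n by (intro mult_left_mono) auto
        then show "t \<le> 2 * b" by (simp add: t_def)
      qed
      have "4 * (\<kappa> * real n / real N) = (4 * \<kappa>) * (real n / real N)" by simp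
      also have "\<dots> \<le> (2 * b / (1 + 2 * b)) * (real n / real N)"
        using kap(3) by (intro mult_right_mono) auto
      also have "\<dots> = t / (1 + 2 * b)" by (simp add: t_def)
      also have "\<dots> \<le> t / (1 + t)" using t by (intro divide_left_mono) auto
      also have "\<dots> = 1 - 1 / (1 + t)" using t by (simp add: field_simps)
      also have "\<dots> \<le> 1 - exp (- t)"
        using exp_ge_add_one_self[of t] t by (simp add: exp_minus field_simps)
      finally have e: "exp (- t) \<le> 1 - 4 * (\<kappa> * real n / real N)" by simp
      have pos: "0 < exp_node lam \<Delta> n" by (simp add: exp_node_def)
      have "exp_node lam \<Delta> (Suc n) \<le> exp (- (c * \<Delta> * ((real (Suc n))\<^sup>2 - (real n)\<^sup>2))) * exp_node lam \<Delta> n"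
        using n by (intro exp_node_ratio[OF D0]) auto
      also have "\<dots> \<le> exp (- t) * exp_node lam \<Delta> n"
      proof -
        have "t = b / real N * (2 * real n)" by (simp add: t_def)
        also have "\<dots> \<le> b / real N * ((real (Suc n))\<^sup>2 - (real n)\<^sup>2)"
          using b by (intro mult_left_mono) (auto simp: power2_eq_square algebra_simps)
        finally show ?thesis using pos unfolding cD by (intro mult_right_mono) auto
      qed
      also have "\<dots> \<le> (1 - 4 * (\<kappa> * real n / real N)) * exp_node lam \<Delta> n"
        using e pos by (intro mult_right_mono) auto
      finally show "exp_node lam \<Delta> (Suc n) \<le> (1 - 4 * (\<kappa> * real n / real N)) * exp_node lam \<Delta> n" .
    next
      have "(\<Sum>k\<in>{1..N}. ?w k / (\<kappa> * real k / real N))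
          \<le> (\<Sum>k\<in>{1..N}. 2 * K / \<kappa> * r ^ (N - k) + 1 / (\<kappa> * real N))"
      proof (rule sum_mono)
        fix k assume k: "k \<in> {1..N}"
        show "?w k / (\<kappa> * real k / real N) \<le> 2 * K / \<kappa> * r ^ (N - k) + 1 / (\<kappa> * real N)"
        proof (cases "real N \<le> 2 * real k")
          case True
          have "?w k / (\<kappa> * real k / real N) = ?w k * (real N / real k) / \<kappa>" by simp
          also have "\<dots> \<le> (K * r ^ (N - k)) * 2 / \<kappa>"
            using weight_large[OF k True] True k kap K r w0
            by (intro divide_right_mono mult_mono) (auto simp: field_simps)
          also have "\<dots> = 2 * K / \<kappa> * r ^ (N - k)" by simp
          also have "\<dots> \<le> 2 * K / \<kappa> * r ^ (N - k) + 1 / (\<kappa> * real N)" using kap by simp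
          finally show ?thesis .
        next
          case False
          have "1 / 2 * real N \<le> \<zeta> * real N" using z by (intro mult_right_mono) auto
          then have "real k \<le> \<zeta> * real N" using False by linarith
          from weight_small[OF k this] have "real N ^ 2 * ?w k \<le> ?E" .
          also have "?E \<le> 1" using b g by simp
          finally have "?w k \<le> 1 / real N ^ 2" using N by (simp add: field_simps)
          have "?w k / (\<kappa> * real k / real N) = ?w k * (real N / real k) / \<kappa>" by simp
          also have "\<dots> \<le> (1 / real N ^ 2) * real N / \<kappa>"
            using \<open>?w k \<le> 1 / real N ^ 2\<close> k kap w0
            by (intro divide_right_mono mult_mono) (auto simp: field_simps)
          also have "\<dots> = 1 / (\<kappa> * real N)" using N by (simp add: power2_eq_square)
          also have "\<dots> \<le> 2 * K / \<kappa> * r ^ (N - k) + 1 / (\<kappa> * real N)" using kap K r by simp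
          finally show ?thesis .
        qed
      qed
      also have "\<dots> = 2 * K / \<kappa> * (\<Sum>k\<in>{1..N}. r ^ (N - k)) + 1 / \<kappa>"
        using N by (simp add: sum.distrib sum_distrib_left)
      also have "\<dots> \<le> S"
        unfolding S_def using r K kap
        by (intro add_right_mono mult_left_mono sum_geometric_le) (auto simp: inj_on_def)
      finally have "\<epsilon> * My * (\<Sum>k\<in>{1..N}. ?w k / (\<kappa> * real k / real N)) \<le> 1 / (4 * My * S) * My * S"
        using eps My S w0 kap
        by (intro mult_mono) (auto simp: eps_star_def intro!: sum_nonneg divide_nonneg_nonneg)
      also have "\<dots> = 1 / 4" using My S by simp
      finally show "\<epsilon> * My * (\<Sum>k\<in>{1..N}. ?w k / (\<kappa> * real k / real N)) \<le> 1 / 4" .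
    next
      fix n assume n: "n \<in> {1..N}" and le: "real n \<le> \<eta> * real N"
      have "\<eta> * real N \<le> \<zeta> * real N" using z by (intro mult_right_mono) auto
      with le have "real n \<le> \<zeta> * real N" by linarith
      note w = weight_small[OF n this]
      have "8 * real N * (\<epsilon> * My) * ?w n / (\<kappa> * real 1 / real N) = \<epsilon> * D1 * (real N ^ 2 * ?w n)"
        by (simp add: D1_def power2_eq_square)
      also have "\<dots> \<le> \<epsilon> * D1 * ?E" using w eps D1 by (intro mult_left_mono) auto
      finally show "ellc * (exp (8 * real N * (\<epsilon> * My) * ?w n / (\<kappa> * real 1 / real N)) - 1)
          \<le> \<epsilon> * (ellc * D1 * exp D1) * ?E"
        using D1 eps ellc b g by (intro exp_minus_one_bound) (auto simp: eps_star_def)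
    qed (use N eps My ellc eta kap in \<open>auto simp: field_simps\<close>)
    then show ?thesis by (simp add: \<Delta>_def)
  qed
  moreover have "0 < b * \<gamma>" "0 < ellc * D1 * exp D1" "1 \<le> max 1 N1" using b g ellc D1 by auto
  ultimately show ?thesis using es by blast
qed

end

theorem theorem5:
  fixes p q :: "real \<Rightarrow> real" and lam :: "nat \<Rightarrow> real"
    and \<Delta>s \<tau> \<eta> ell My :: real
  assumes p_smooth: "smooth_near_unit_interval p"
    and q_smooth: "smooth_near_unit_interval q"
    and p_pos: "\<And>x. x \<in> {0..1} \<Longrightarrow> p x > 0"
    and lam: "sl_eigenvalue_sequence p q lam"
    and "\<Delta>s > 0"
    and "0 < \<eta>" "\<eta> < 1"
    and "ell > 1" "My > 0"
    and "0 < \<tau>" "\<tau> < 1/2"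
    and separation: "\<And>\<Delta> n j. \<lbrakk>\<Delta> \<ge> \<Delta>s; n \<ge> 1; j \<ge> 1; j \<noteq> n\<rbrakk> \<Longrightarrow>
       \<bar>exp_node lam \<Delta> j - exp_node lam \<Delta> n\<bar> / exp_node lam \<Delta> n \<ge> 2 * \<tau>"
  shows
    "(\<exists>eps_star>0. \<exists>\<Gamma>>0. \<exists>D>0. \<exists>N0. \<forall>\<epsilon>\<in>{0<..eps_star}. \<forall>N\<ge>N0. \<forall>\<Delta>\<ge>\<Delta>s.
        prony_amplitude_bound lam \<tau> ell My \<eta> \<Delta> N \<epsilon>
          (\<epsilon> * D * exp (- \<Delta> * \<Gamma> * real N ^ 3)))
     \<and>
     (\<exists>eps_star>0. \<forall>\<theta>>0. \<exists>N_theta. \<exists>D>0. \<exists>\<Delta>0\<ge>\<Delta>s.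
        \<forall>\<epsilon>\<in>{0<..eps_star}. \<forall>N\<ge>N_theta. \<forall>\<Delta>\<ge>\<Delta>0.
        prony_amplitude_bound lam \<tau> ell My \<eta> \<Delta> N \<epsilon>
          (\<epsilon> * D * exp (- \<theta> * \<Delta>)))
     \<and>
     (\<forall>T>0. \<exists>eps_star>0. \<exists>\<Gamma>>0. \<exists>D>0. \<exists>N0\<ge>1. \<forall>\<epsilon>\<in>{0<..eps_star}. \<forall>N\<ge>N0.
        prony_amplitude_bound lam \<tau> ell My \<eta> (T / real N) N \<epsilon>
          (\<epsilon> * D * exp (- \<Gamma> * real N ^ 2)))"
proof -
  obtain c where c: "0 < c" "\<And>n. n \<ge> 1 \<Longrightarrow> c * (2 * real n + 1) \<le> lam (Suc n) - lam n"
    using sl_eigenvalue_gap_linear[OF p_smooth q_smooth p_pos lam] by blast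
  interpret quadratic_gaps lam c
    by unfold_locales (use c sl_eigenvalue_gap_quadratic[OF c(2)] in auto)
  obtain eps_star \<Gamma> D where bound: "0 < eps_star" "0 < \<Gamma>" "0 < D"
    "\<And>\<epsilon> N \<Delta>. \<epsilon> \<in> {0<..eps_star} \<Longrightarrow> 1 \<le> N \<Longrightarrow> \<Delta>s \<le> \<Delta> \<Longrightarrow>
        prony_amplitude_bound lam \<tau> ell My \<eta> \<Delta> N \<epsilon> (\<epsilon> * D * exp (- \<Delta> * \<Gamma> * real N ^ 3))"
    using fixed_step_bound[of \<Delta>s \<eta> ell My \<tau>, OF \<open>\<Delta>s > 0\<close> \<open>\<eta> < 1\<close> \<open>ell > 1\<close> \<open>My > 0\<close>
        \<open>0 < \<tau>\<close> \<open>\<tau> < 1/2\<close> separation] by blast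
  show ?thesis
  proof (intro conjI)
    show "\<exists>eps_star>0. \<exists>\<Gamma>>0. \<exists>D>0. \<exists>N0. \<forall>\<epsilon>\<in>{0<..eps_star}. \<forall>N\<ge>N0. \<forall>\<Delta>\<ge>\<Delta>s.
        prony_amplitude_bound lam \<tau> ell My \<eta> \<Delta> N \<epsilon> (\<epsilon> * D * exp (- \<Delta> * \<Gamma> * real N ^ 3))"
      using bound by blast
  next
    show "\<exists>eps_star>0. \<forall>\<theta>>0. \<exists>N_theta. \<exists>D>0. \<exists>\<Delta>0\<ge>\<Delta>s. \<forall>\<epsilon>\<in>{0<..eps_star}. \<forall>N\<ge>N_theta. \<forall>\<Delta>\<ge>\<Delta>0.
        prony_amplitude_bound lam \<tau> ell My \<eta> \<Delta> N \<epsilon> (\<epsilon> * D * exp (- \<theta> * \<Delta>))"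
    proof (intro exI[of _ eps_star] conjI allI impI)
      fix \<theta> :: real assume "0 < \<theta>"
      obtain N1 :: nat where N1: "\<theta> / \<Gamma> \<le> real N1" using real_arch_simple by blast
      have "prony_amplitude_bound lam \<tau> ell My \<eta> \<Delta> N \<epsilon> (\<epsilon> * D * exp (- \<theta> * \<Delta>))"
        if "\<epsilon> \<in> {0<..eps_star}" "max 1 N1 \<le> N" "\<Delta>s \<le> \<Delta>" for \<epsilon> N \<Delta>
      proof -
        have N: "1 \<le> real N" "real N1 \<le> real N" using that(2) by auto
        have "\<theta> / \<Gamma> \<le> real N" using N1 N by linarith
        then have "\<theta> \<le> \<Gamma> * real N" using bound(2) by (simp add: field_simps)
        also have "\<dots> \<le> \<Gamma> * real N ^ 3"
          using power_increasing[of 1 3 "real N"] N bound(2) by (intro mult_left_mono) auto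
        finally have "\<theta> * \<Delta> \<le> \<Gamma> * real N ^ 3 * \<Delta>" using that(3) \<open>\<Delta>s > 0\<close> by (intro mult_right_mono) auto
        then have le: "\<epsilon> * D * exp (- \<Delta> * \<Gamma> * real N ^ 3) \<le> \<epsilon> * D * exp (- \<theta> * \<Delta>)"
          using that(1) bound(3) by (intro mult_left_mono) (auto simp: mult_ac)
        have "prony_amplitude_bound lam \<tau> ell My \<eta> \<Delta> N \<epsilon> (\<epsilon> * D * exp (- \<Delta> * \<Gamma> * real N ^ 3))"
          using that by (intro bound(4)) auto
        then show ?thesis unfolding prony_amplitude_bound_def using le by (meson order_trans)
      qed
      then show "\<exists>N_theta. \<exists>D>0. \<exists>\<Delta>0\<ge>\<Delta>s. \<forall>\<epsilon>\<in>{0<..eps_star}. \<forall>N\<ge>N_theta. \<forall>\<Delta>\<ge>\<Delta>0.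
        prony_amplitude_bound lam \<tau> ell My \<eta> \<Delta> N \<epsilon> (\<epsilon> * D * exp (- \<theta> * \<Delta>))"
        using bound(3) by blast
    qed (rule bound(1))
  next
    show "\<forall>T>0. \<exists>eps_star>0. \<exists>\<Gamma>>0. \<exists>D>0. \<exists>N0\<ge>1. \<forall>\<epsilon>\<in>{0<..eps_star}. \<forall>N\<ge>N0.
        prony_amplitude_bound lam \<tau> ell My \<eta> (T / real N) N \<epsilon> (\<epsilon> * D * exp (- \<Gamma> * real N ^ 2))"
      using shrinking_step_bound \<open>\<eta> < 1\<close> \<open>ell > 1\<close> \<open>My > 0\<close> \<open>0 < \<tau>\<close> by blast
  qed
qed

end
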